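(* Suppose $(\zeta_1,\zeta_2,\zeta_3,\dots)$ is a sequence of positive numbers such that (a) $\lim_{n\to\infty}\zeta_n=0$, and (b) for every $c>0$, $\lim_{n\to\infty}[\zeta_n/e^{-cn}]=\infty$. Then there exists a (real) strictly stationary, countable-state Markov chain $X:=(X_k,\ k\in\mathbb{Z})$ which is reversible, such that the following four conditions hold: (i) $E(X_0^2)<\infty$ and $EX_0=0$; (ii) $\alpha_X(n)\le\beta_X(n)\le\zeta_n$ for every $n\in\mathbb{N}$; (iii) $\lim_{n\to\infty} n^{-1}\,\mathrm{Var}\bigl(\sum_{k=1}^n X_k\bigr)=\infty$, and moreover for every $b>0$, $$\lim_{n\to\infty}\Bigl[\,\sup_{r\in\mathbb{R}} P\Bigl(r-b< n^{-1/2}\sum_{k=1}^n X_k< r+b\Bigr)\Bigr]=0;$$ (iv) there exist a strictly increasing sequence $(J(1),J(2),J(3),\dots)$ of positive integers and a sequence $(b_1,b_2,b_3,\dots)$ of positive constants satisfying $b_n\to\infty$ as $n\to\infty$, such that $$b_n^{-1}\sum_{k=1}^{J(n)}X_k\ \to\ \mu_{\mathrm{P1sL}}\quad\text{in distribution as } n\to\infty.$$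
   Context: $\mathbb{N}$ denotes the set of positive integers. All random variables are defined on a probability space $(\Omega,\mathcal{F},P)$ which is rich enough to accommodate all random variables declared. Markov chains are indexed by $\mathbb{Z}$; "countable-state" means that the state space is a finite or countably infinite subset of $\mathbb{R}$. Reversibility: a real strictly stationary Markov chain $X=(X_k,k\in\mathbb{Z})$ is reversible if the distribution (on $\mathbb{R}^{\mathbb{Z}}$ with its product Borel $\sigma$-field) of the sequence $(X_{-k},k\in\mathbb{Z})$ is the same as that of $X$. Dependence coefficients: for $\sigma$-fields $\mathcal{A},\mathcal{B}\subset\mathcal{F}$, $$\alpha(\mathcal{A},\mathcal{B}):=\sup_{A\in\mathcal{A},B\in\mathcal{B}}|P(A\cap B)-P(A)P(B)|,\qquad \beta(\mathcal{A},\mathcal{B}):=\sup\frac12\sum_{i=1}^I\sum_{j=1}^J|P(A_i\cap B_j)-P(A_i)P(B_j)|,$$ where the latter supremum is over all pairs of finite partitions $\{A_1,\dots,A_I\}$, $\{B_1,\dots,B_J\}$ of $\Omega$ with $A_i\in\mathcal{A}$ and $B_j\in\mathcal{B}$. For a strictly stationary sequence $X=(X_k,k\in\mathbb{Z})$ and $n\in\mathbb{N}$, $$\alpha_X(n):=\alpha(\sigma(X_k,k\le 0),\sigma(X_k,k\ge n)),\qquad \beta_X(n):=\beta(\sigma(X_k,k\le 0),\sigma(X_k,k\ge n)).$$ The law $\mu_{\mathrm{P1sL}}$ is the distribution on $\mathbb{R}$ of the random variable $Y=\sum_{k=1}^{N}\eta_k$ (with $Y=0$ when $N=0$), where $\eta_1,\eta_2,\dots$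 are independent, identically distributed random variables with the Laplace density $f(x)=\frac12e^{-|x|}$, $x\in\mathbb{R}$, and $N$ is a Poisson random variable with mean $1$ that is independent of $(\eta_1,\eta_2,\dots)$. *)

theory Defs
  imports "HOL-Probability.Probability"
begin

section \<open>Stochastic processes indexed by the integers\<close>

text \<open>The \<open>\<sigma>\<close>-field generated by \<open>X\<^sub>i\<close>, \<open>i \<in> I\<close>. It is a value of type \<^typ>\<open>'a measure\<close>
  (as \<^const>\<open>real_cond_exp\<close> expects), but only its space and its sets are relevant.\<close>

definition generated_sigma ::
    "'a measure \<Rightarrow> (int \<Rightarrow> 'a \<Rightarrow> real) \<Rightarrow> int set \<Rightarrow> 'a measure" where
  "generated_sigma M X I =
     sigma (space M) {X i -` B \<inter> space M | i B. i \<in> I \<and> B \<in> sets borel}"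

definition process_law ::
    "'a measure \<Rightarrow> (int \<Rightarrow> 'a \<Rightarrow> real) \<Rightarrow> (int \<Rightarrow> real) measure" where
  "process_law M X = distr M (\<Pi>\<^sub>M k\<in>UNIV. borel) (\<lambda>\<omega> k. X k \<omega>)"

definition strictly_stationary :: "'a measure \<Rightarrow> (int \<Rightarrow> 'a \<Rightarrow> real) \<Rightarrow> bool" where
  "strictly_stationary M X \<longleftrightarrow> (\<forall>h. process_law M (\<lambda>k. X (k + h)) = process_law M X)"

definition reversible :: "'a measure \<Rightarrow> (int \<Rightarrow> 'a \<Rightarrow> real) \<Rightarrow> bool" where
  "reversible M X \<longleftrightarrow> process_law M (\<lambda>k. X (- k)) = process_law M X"

text \<open>\<open>P(X\<^sub>k\<^sub>+\<^sub>1 \<in> B | \<sigma>(X\<^sub>j, j \<le> k)) = P(X\<^sub>k\<^sub>+\<^sub>1 \<in> B | \<sigma>(X\<^sub>k))\<close> almost surely, for all integers \<open>k\<close>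
  and all Borel sets \<open>B\<close>.\<close>

definition markov_property :: "'a measure \<Rightarrow> (int \<Rightarrow> 'a \<Rightarrow> real) \<Rightarrow> bool" where
  "markov_property M X \<longleftrightarrow>
     (\<forall>k. \<forall>B\<in>sets borel. AE \<omega> in M.
        real_cond_exp M (generated_sigma M X {..k}) (indicator {\<omega> \<in> space M. X (k + 1) \<omega> \<in> B}) \<omega>
      = real_cond_exp M (generated_sigma M X {k}) (indicator {\<omega> \<in> space M. X (k + 1) \<omega> \<in> B}) \<omega>)"

definition countable_state_markov_chain :: "'a measure \<Rightarrow> (int \<Rightarrow> 'a \<Rightarrow> real) \<Rightarrow> bool" where
  "countable_state_markov_chain M X \<longleftrightarrow>
     (\<forall>k. X k \<in> borel_measurable M) \<and>
     (\<exists>S. countable S \<and> (\<forall>k. X k \<in> space M \<rightarrow> S)) \<and>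
     markov_property M X"

section \<open>Dependence coefficients\<close>

text \<open>Over a probability space the suprema below are over nonempty subsets of the interval from
  0 to 1, so the (otherwise unspecified) real supremum is the intended one. In
  \<open>beta_coeff\<close> the cells of a partition are nonempty by \<^const>\<open>partition_on\<close>; empty cells would
  contribute nothing to the double sum.\<close>

definition alpha_coeff :: "'a measure \<Rightarrow> 'a measure \<Rightarrow> 'a measure \<Rightarrow> real" where
  "alpha_coeff M \<A> \<B> =
     Sup {\<bar>measure M (A \<inter> B) - measure M A * measure M B\<bar> | A B. A \<in> sets \<A> \<and> B \<in> sets \<B>}"

definition beta_coeff :: "'a measure \<Rightarrow> 'a measure \<Rightarrow> 'a measure \<Rightarrow> real" where
  "beta_coeff M \<A> \<B> =
     Sup {1 / 2 * (\<Sum>A\<in>P. \<Sum>B\<in>Q. \<bar>measure M (A \<inter> B) - measure M A * measure M B\<bar>) | P Q.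
            finite P \<and> partition_on (space M) P \<and> P \<subseteq> sets \<A> \<and>
            finite Q \<and> partition_on (space M) Q \<and> Q \<subseteq> sets \<B>}"

definition alpha_mix :: "'a measure \<Rightarrow> (int \<Rightarrow> 'a \<Rightarrow> real) \<Rightarrow> nat \<Rightarrow> real" where
  "alpha_mix M X n =
     alpha_coeff M (generated_sigma M X {..0}) (generated_sigma M X {int n..})"

definition beta_mix :: "'a measure \<Rightarrow> (int \<Rightarrow> 'a \<Rightarrow> real) \<Rightarrow> nat \<Rightarrow> real" where
  "beta_mix M X n =
     beta_coeff M (generated_sigma M X {..0}) (generated_sigma M X {int n..})"

section \<open>The compound Poisson law with Laplace summands\<close>

definition laplace_law :: "real measure" where
  "laplace_law = density lborel (\<lambda>x. ennreal (1 / 2 * exp (- \<bar>x\<bar>)))"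

text \<open>\<open>N\<close> and \<open>\<eta>\<^sub>1, \<eta>\<^sub>2, \<dots>\<close> are realised as the coordinates of a product space, which makes
  them independent with the prescribed marginals.\<close>

definition mu_P1sL :: "real measure" where
  "mu_P1sL =
     distr (measure_pmf (poisson_pmf 1) \<Otimes>\<^sub>M (\<Pi>\<^sub>M k\<in>{1::nat..}. laplace_law)) borel
       (\<lambda>(N, \<eta>). \<Sum>k = 1..N. \<eta> k)"

lemma prob_space_laplace_law: "prob_space laplace_law"
proof -
  define e where "e = (\<lambda>x::real. ennreal (exponential_density 1 x))"
  have [measurable]: "e \<in> borel_measurable borel"
    unfolding e_def by measurable
  have e1: "(\<integral>\<^sup>+x. e x \<partial>lborel) = 1"
    using prob_space.emeasure_space_1[OF prob_space_exponential_density[of 1]]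
    by (simp add: emeasure_density e_def)
  have e2: "(\<integral>\<^sup>+x. e (- x) \<partial>lborel) = 1"
    using nn_integral_real_affine[of e "-1" 0] e1 by simp
  have "(\<integral>\<^sup>+x. ennreal (1 / 2 * exp (- \<bar>x\<bar>)) \<partial>lborel)
      = (\<integral>\<^sup>+x. ennreal (1 / 2) * (e x + e (- x)) \<partial>lborel)"
  proof (rule nn_integral_cong_AE)
    have "AE x in lborel. x \<noteq> (0::real)"
      by (rule AE_lborel_singleton)
    then show "AE x in lborel. ennreal (1 / 2 * exp (- \<bar>x\<bar>)) = ennreal (1 / 2) * (e x + e (- x))"
    proof eventually_elim
      case (elim x)
      then have "e x + e (- x) = ennreal (exp (- \<bar>x\<bar>))"
        by (auto simp: e_def exponential_density_def abs_if)
      then show ?case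
        using ennreal_mult'[of "1 / 2" "exp (- \<bar>x\<bar>)"] by simp
    qed
  qed
  also have "\<dots> = ennreal (1 / 2) * (1 + 1)"
    by (subst nn_integral_cmult, simp, subst nn_integral_add) (simp_all add: e1 e2)
  also have "\<dots> = 1"
    using ennreal_mult'[of "1 / 2" 2] by (simp add: one_add_one)
  finally show ?thesis
    by (intro prob_spaceI) (simp add: laplace_law_def emeasure_density)
qed

lemma real_distribution_mu_P1sL: "real_distribution mu_P1sL"
proof -
  have [measurable_cong]: "sets laplace_law = sets borel"
    by (simp add: laplace_law_def)
  interpret L: product_prob_space "\<lambda>_::nat. laplace_law" "{1..}"
    by (rule product_prob_spaceI) (rule prob_space_laplace_law)
  interpret E: prob_space "\<Pi>\<^sub>M k\<in>{1::nat..}. laplace_law"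
    by (rule L.prob_space_axioms)
  interpret pair: pair_prob_space "measure_pmf (poisson_pmf 1)" "\<Pi>\<^sub>M k\<in>{1::nat..}. laplace_law" ..
  have "(\<lambda>p. (\<lambda>(N, \<eta>). \<Sum>k = 1..N. \<eta> k) p) \<in>
      borel_measurable (count_space UNIV \<Otimes>\<^sub>M (\<Pi>\<^sub>M k\<in>{1::nat..}. laplace_law))"
    by (intro measurable_pair_measure_countable1) (auto intro!: borel_measurable_sum)
  then have "(\<lambda>(N, \<eta>). \<Sum>k = 1..N. \<eta> k) \<in>
      borel_measurable (measure_pmf (poisson_pmf 1) \<Otimes>\<^sub>M (\<Pi>\<^sub>M k\<in>{1::nat..}. laplace_law))"
    using measurable_cong_sets[OF sets_pair_measure_cong[OF sets_measure_pmf_count_space refl] refl]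
    by simp
  then have "prob_space mu_P1sL"
    unfolding mu_P1sL_def by (rule pair.prob_space_distr)
  then show ?thesis
    by (simp add: real_distribution_def real_distribution_axioms_def mu_P1sL_def)
qed

end

theory Submission
  imports Defs "HOL-Real_Asymp.Real_Asymp"
begin

text \<open>The chain has one state \<open>0\<close> and, for every level \<open>j \<ge> 1\<close>, two states with values \<open>x\<^sub>j\<close> and
\<open>-x\<^sub>j\<close>. In a state of level \<open>j\<close> it stays with probability \<open>1 - p\<^sub>j\<close> and otherwise draws a
fresh state from one fixed law, always the same. If the fresh law is proportional to
\<open>\<pi>(s) p(s)\<close>, then \<open>\<pi>\<close> satisfies detailed balance, so every such chain is reversible. Here
\<open>p\<^sub>j = 2^(-j\<^sup>2)\<close>, the level \<open>j\<close> has stationary probability \<open>q\<^sub>j\<close>, and \<open>x\<^sub>j\<close> is chosen such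
that \<open>q\<^sub>j x\<^sub>j\<^sup>2 = 2^(-j)\<close>. The numbers \<open>q\<^sub>j\<close> remain free, except for being very small.

Mixing. Only sojourns carry memory: the difference between two starting points dies
when the slower one is refreshed, unless the refresh leads to a still slower level, which is
unlikely (\<open>oscillation_bound\<close>). This gives \<open>\<beta>(n) \<le> 10 (\<Sum>j. q\<^sub>j (1 - p\<^sub>j)^n)\<close>
(\<open>mixing_coefficients\<close>). As \<open>\<zeta>\<close> decays more slowly than every exponential, the \<open>j\<close>-th summand is at
most \<open>2^(-j) \<zeta>\<^sub>n\<close> for all \<open>n\<close> once \<open>q\<^sub>j\<close> is small enough (\<open>level_parameters_exist\<close>).

Partial sums. A sojourn at level \<open>j\<close> adds a random sign times \<open>x\<^sub>j\<close> times a geometric time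
\<open>G\<^sub>j\<close> with mean \<open>1/p\<^sub>j\<close>, and in each step one such sojourn starts with probability \<open>q\<^sub>j p\<^sub>j\<close>. Hence the
characteristic function of \<open>S\<^sub>n\<close> at \<open>\<theta>\<close> should be close to \<open>(1 - \<delta>(\<theta>))^n\<close>, where
\<open>\<delta>(\<theta>) = (\<Sum>j. q\<^sub>j p\<^sub>j (1 - E cos (\<theta> x\<^sub>j G\<^sub>j)))\<close>. An approximate left eigenvector of the transition
operator twisted by \<open>e^(i \<theta> x)\<close> shows that the error is at most a constant times \<open>\<bar>\<theta>\<bar>\<close>,
uniformly in \<open>n\<close> (\<open>cf_partial_sum\<close>). Both limit statements are then about \<open>\<delta>\<close>:

For fixed \<open>t \<noteq> 0\<close> the single level \<open>m\<close> contributes to \<open>n \<delta>(t / sqrt n)\<close> at least a multiple of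
\<open>q\<^sub>m x\<^sub>m\<^sup>2 / p\<^sub>m = 2^(m\<^sup>2 - m)\<close>, which is unbounded in \<open>m\<close>. So the characteristic function of
\<open>S\<^sub>n / sqrt n\<close> tends to \<open>0\<close> off the origin (\<open>normalized_cf_vanishes\<close>), which spreads the
mass out (\<open>concentration_tendsto_0\<close>) and forces the variance of \<open>S\<^sub>n / sqrt n\<close> to infinity.

At time \<open>J(m) \<approx> 1 / (q\<^sub>m p\<^sub>m)\<close>, about one sojourn at level \<open>m\<close> has started on average. On the scale
\<open>b\<^sub>m = x\<^sub>m / p\<^sub>m\<close> its contribution is a random sign times an exponential variable, that is,
Laplace distributed; the lower levels are negligible on this scale and the higher ones have not
been visited. Accordingly \<open>J(m) \<delta>(t / b\<^sub>m)\<close> tends to \<open>t\<^sup>2 / (1 + t\<^sup>2) = 1 - 1 / (1 + t\<^sup>2)\<close>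
(\<open>horizon_decay\<close>), the exponent of the compound Poisson law.\<close>

abbreviation mean where "mean \<equiv> measure_pmf.expectation"

section \<open>Bounded functions on probability mass functions\<close>

lemma integrable_pmf_bounded:
  fixes u :: "'b \<Rightarrow> 'c::{banach, second_countable_topology}"
  assumes "\<And>x. norm (u x) \<le> B"
  shows "integrable (measure_pmf q) u"
  by (rule measure_pmf.integrable_const_bound[where B=B]) (use assms in auto)

lemma norm_expectation_pmf_le:
  fixes u :: "'b \<Rightarrow> 'c::{banach, second_countable_topology}"
  assumes "\<And>x. norm (u x) \<le> B"
  shows "norm (mean q u) \<le> B"
proof -
  have "norm (mean q u) \<le> mean q (\<lambda>x. norm (u x))"
    by (rule integral_norm_bound)
  also have "\<dots> \<le> mean q (\<lambda>_. B)"
    by (intro integral_mono integrable_pmf_bounded[of _ B]) (use assms in \<open>auto intro: order_trans[OF norm_ge_zero]\<close>)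
  finally show ?thesis by simp
qed

text \<open>Taking coordinates reduces this to real integrands; complex ones occur in the characteristic
functions below.\<close>

lemma integral_bind_pmf_bounded:
  fixes u :: "'b \<Rightarrow> 'c::euclidean_space"
  assumes bd: "\<And>x. norm (u x) \<le> B"
  shows "mean (bind_pmf q k) u = mean q (\<lambda>x. mean (k x) u)"
proof (rule euclidean_eqI)
  fix b :: 'c assume b: "b \<in> Basis"
  have bd': "\<bar>u x \<bullet> b\<bar> \<le> B" for x
    using Basis_le_norm[OF b, of "u x"] bd[of x] by linarith
  have inner: "mean r v \<bullet> b = mean r (\<lambda>x. v x \<bullet> b)"
    if "\<And>x. norm (v x) \<le> B" for r :: "'d pmf" and v :: "'d \<Rightarrow> 'c"
    by (rule integral_inner_left[symmetric]) (rule integrable_pmf_bounded[OF that])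
  have "mean (bind_pmf q k) (\<lambda>x. u x \<bullet> b)
      = mean q (\<lambda>x. mean (k x) (\<lambda>x. u x \<bullet> b))"
    unfolding measure_pmf_bind
    by (rule integral_bind[where K="count_space UNIV" and B=B and B'=1])
       (use bd' measurable_measure_pmf[of k] in
         \<open>auto simp: measure_pmf.finite_measure_axioms measure_pmf.emeasure_space_1\<close>)
  then show "mean (bind_pmf q k) u \<bullet> b
      = mean q (\<lambda>x. mean (k x) u) \<bullet> b"
    using norm_expectation_pmf_le[of u B] bd by (simp add: inner)
qed

lemma expectation_indicator_single: "mean q (\<lambda>s. indicator {t} s * c) = pmf q t * (c::real)"
proof -
  have "mean q (indicator {t}) = pmf q t"
    using measure_pmf_single[of q t] by simp
  then show ?thesis by (subst integral_mult_left_zero) simp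
qed

section \<open>Chains that stay or are refreshed\<close>

text \<open>The stationary law \<open>\<pi>\<close> and the refresh probabilities \<open>p\<close> are the data; the law of a fresh state is
derived from them, as the one for which \<open>\<pi>\<close> is stationary.\<close>

locale refresh_chain =
  fixes \<pi> :: "'s pmf" and p :: "'s \<Rightarrow> real"
  assumes p_pos: "0 < p s" and p_le_1: "p s \<le> 1"
begin

definition rate :: real where "rate = mean \<pi> p"

definition fresh :: "'s pmf" where
  "fresh = embed_pmf (\<lambda>s. pmf \<pi> s * p s / rate)"

definition step :: "'s \<Rightarrow> 's pmf" where
  "step s = bind_pmf (bernoulli_pmf (p s)) (\<lambda>b. if b then fresh else return_pmf s)"

text \<open>The law of \<open>n + 1\<close> consecutive states of the stationary chain, most recent state first, so that a
step of the chain prepends an element.\<close>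

primrec history :: "nat \<Rightarrow> 's list pmf" where
  "history 0 = map_pmf (\<lambda>s. [s]) \<pi>"
| "history (Suc n) = bind_pmf (history n) (\<lambda>l. map_pmf (\<lambda>t. t # l) (step (hd l)))"

text \<open>The law of \<open>n\<close> further states after \<open>s\<close>, again most recent first. The state \<open>s\<close> itself is left out,
so that the result can be put in front of a history that begins with \<open>s\<close>.\<close>

primrec continuation :: "'s \<Rightarrow> nat \<Rightarrow> 's list pmf" where
  "continuation s 0 = return_pmf []"
| "continuation s (Suc n) =
     bind_pmf (continuation s n) (\<lambda>l. map_pmf (\<lambda>t. t # l) (step (hd (l @ [s]))))"

lemma p_nonneg: "0 \<le> p s" and p_abs: "\<bar>p s\<bar> \<le> 1"
  using p_pos[of s] p_le_1[of s] by auto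

lemma integrable_p: "integrable \<pi> p"
  using p_abs by (intro integrable_pmf_bounded[of _ 1]) auto

lemma rate_pos: "0 < rate"
proof -
  have "rate \<ge> 0" unfolding rate_def by (intro integral_nonneg_AE) (auto simp: p_nonneg)
  moreover have "rate \<noteq> 0"
  proof
    assume "rate = 0"
    then have "AE s in measure_pmf \<pi>. p s = 0"
      using integral_nonneg_eq_0_iff_AE[OF integrable_p] by (auto simp: rate_def p_nonneg)
    then have "\<forall>s\<in>set_pmf \<pi>. p s = 0" by (simp add: AE_measure_pmf_iff)
    moreover obtain s where "s \<in> set_pmf \<pi>" using set_pmf_not_empty[of \<pi>] by auto
    ultimately show False using p_pos[of s] by simp
  qed
  ultimately show ?thesis by simp
qed

lemma pmf_fresh: "pmf fresh s = pmf \<pi> s * p s / rate"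
  unfolding fresh_def
proof (rule pmf_embed_pmf)
  show "0 \<le> pmf \<pi> x * p x / rate" for x using rate_pos p_nonneg by simp
  have "(\<integral>\<^sup>+x. ennreal (p x) \<partial>\<pi>) = ennreal rate"
    unfolding rate_def by (intro nn_integral_eq_integral integrable_p) (auto simp: p_nonneg)
  then have *: "(\<integral>\<^sup>+x. ennreal (pmf \<pi> x) * ennreal (p x) \<partial>count_space UNIV) = ennreal rate"
    by (simp add: nn_integral_measure_pmf)
  have "(\<integral>\<^sup>+x. ennreal (pmf \<pi> x * p x / rate) \<partial>count_space UNIV)
      = (\<integral>\<^sup>+x. (ennreal (pmf \<pi> x) * ennreal (p x)) / ennreal rate \<partial>count_space UNIV)"
    using rate_pos p_nonneg by (intro nn_integral_cong) (simp add: ennreal_mult[symmetric] divide_ennreal)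
  also have "\<dots> = 1"
  proof -
    have "(\<integral>\<^sup>+x. (ennreal (pmf \<pi> x) * ennreal (p x)) / ennreal rate \<partial>count_space UNIV) = ennreal rate / ennreal rate"
      unfolding *[symmetric] by (rule nn_integral_divide) simp
    then show ?thesis using rate_pos by (simp add: divide_ennreal)
  qed
  finally show "(\<integral>\<^sup>+x. ennreal (pmf \<pi> x * p x / rate) \<partial>count_space UNIV) = 1" .
qed

lemma expectation_fresh:
  fixes u :: "'s \<Rightarrow> 'c::{banach, second_countable_topology}"
  shows "mean fresh u = (1 / rate) *\<^sub>R mean \<pi> (\<lambda>s. p s *\<^sub>R u s)"
proof -
  have "mean fresh u = (LINT s|count_space UNIV. (1 / rate) *\<^sub>R (pmf \<pi> s *\<^sub>R p s *\<^sub>R u s))"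
    unfolding measure_pmf_eq_density[of fresh]
    by (subst integral_density) (use rate_pos p_nonneg in \<open>auto simp: pmf_fresh intro!: Bochner_Integration.integral_cong\<close>)
  also have "\<dots> = (1 / rate) *\<^sub>R (LINT s|count_space UNIV. (pmf \<pi> s *\<^sub>R p s *\<^sub>R u s))"
    by (rule integral_scaleR_right)
  also have "(LINT s|count_space UNIV. (pmf \<pi> s *\<^sub>R p s *\<^sub>R u s)) = mean \<pi> (\<lambda>s. p s *\<^sub>R u s)"
    unfolding measure_pmf_eq_density[of \<pi>] by (subst integral_density) auto
  finally show ?thesis .
qed

lemma pmf_step: "pmf (step s) t = p s * pmf fresh t + (if s = t then 1 - p s else 0)"
  unfolding step_def pmf_bind using p_nonneg p_le_1 by (auto simp: indicator_def)

text \<open>For different states both sides are \<open>\<pi>(s) p(s) \<pi>(t) p(t) / rate\<close>, which is symmetric.\<close>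

lemma detailed_balance: "pmf \<pi> s * pmf (step s) t = pmf \<pi> t * pmf (step t) s"
  by (auto simp: pmf_step pmf_fresh)

lemma bind_step: "bind_pmf \<pi> step = \<pi>"
proof (rule pmf_eqI)
  fix t
  have "pmf (bind_pmf \<pi> step) t = mean \<pi> (\<lambda>s. pmf fresh t * p s + (1 - p t) * indicator {t} s)"
    unfolding pmf_bind by (intro Bochner_Integration.integral_cong) (auto simp: pmf_step)
  also have "\<dots> = mean \<pi> (\<lambda>s. pmf fresh t * p s)
      + mean \<pi> (\<lambda>s. indicator {t} s * (1 - p t))"
    by (subst Bochner_Integration.integral_add[symmetric])
       (auto intro!: integrable_mult_right integrable_p integrable_pmf_bounded[of _ 1] simp: indicator_def p_nonneg p_le_1 mult.commute)
  also have "\<dots> = pmf fresh t * rate + pmf \<pi> t * (1 - p t)"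
    unfolding expectation_indicator_single rate_def by simp
  also have "\<dots> = pmf \<pi> t" using rate_pos by (simp add: pmf_fresh field_simps)
  finally show "pmf (bind_pmf \<pi> step) t = pmf \<pi> t" .
qed

lemma length_history: "l \<in> set_pmf (history n) \<Longrightarrow> length l = Suc n"
  by (induction n arbitrary: l) auto

lemma history_not_Nil: "l \<in> set_pmf (history n) \<Longrightarrow> l \<noteq> []"
  using length_history by fastforce

lemma length_continuation: "l \<in> set_pmf (continuation s n) \<Longrightarrow> length l = n"
  by (induction n arbitrary: l) auto

lemma map_tl_history: "map_pmf tl (history (Suc n)) = history n"
  by (simp add: map_bind_pmf pmf.map_comp o_def map_pmf_const bind_return_pmf')

text \<open>Dropping the oldest state moves the starting time forward by one step; this is
where stationarity of \<open>\<pi>\<close> enters.\<close>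

lemma map_butlast_history: "map_pmf butlast (history (Suc n)) = history n"
proof (induction n)
  case 0
  have "map_pmf butlast (history (Suc 0)) = bind_pmf \<pi> (\<lambda>s. map_pmf (\<lambda>t. [t]) (step s))"
    by (simp add: map_bind_pmf bind_map_pmf pmf.map_comp o_def)
  also have "\<dots> = map_pmf (\<lambda>t. [t]) (bind_pmf \<pi> step)"
    by (simp add: map_bind_pmf)
  finally show ?case by (simp add: bind_step)
next
  case (Suc n)
  have "map_pmf butlast (history (Suc (Suc n)))
      = bind_pmf (history (Suc n)) (\<lambda>l. map_pmf (\<lambda>t. butlast (t # l)) (step (hd l)))"
    by (simp only: history.simps(2)[of "Suc n"] map_bind_pmf pmf.map_comp o_def)
  also have "\<dots> = bind_pmf (history (Suc n)) (\<lambda>l. map_pmf (\<lambda>t. t # butlast l) (step (hd (butlast l))))"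
  proof (rule bind_pmf_cong[OF refl])
    fix l assume "l \<in> set_pmf (history (Suc n))"
    then obtain a b l' where "l = a # b # l'"
      using length_history by (metis length_Suc_conv)
    then show "map_pmf (\<lambda>t. butlast (t # l)) (step (hd l)) = map_pmf (\<lambda>t. t # butlast l) (step (hd (butlast l)))"
      by simp
  qed
  also have "\<dots> = bind_pmf (map_pmf butlast (history (Suc n))) (\<lambda>l. map_pmf (\<lambda>t. t # l) (step (hd l)))"
    by (simp only: bind_map_pmf)
  also have "\<dots> = history (Suc n)" by (subst Suc.IH) (rule history.simps(2)[symmetric])
  finally show ?case .
qed

lemma history_add:
  "history (i + j) = bind_pmf (history i) (\<lambda>l. map_pmf (\<lambda>l'. l' @ l) (continuation (hd l) j))"
proof (induction j)
  case 0
  show ?case by (simp add: map_return_pmf bind_return_pmf')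
next
  case (Suc j)
  have "history (i + Suc j) = bind_pmf (history i) (\<lambda>l. bind_pmf (continuation (hd l) j)
      (\<lambda>l'. map_pmf (\<lambda>t. t # l' @ l) (step (hd (l' @ l)))))"
    by (simp add: Suc.IH bind_assoc_pmf bind_map_pmf)
  also have "\<dots> = bind_pmf (history i) (\<lambda>l. map_pmf (\<lambda>l'. l' @ l) (continuation (hd l) (Suc j)))"
  proof (rule bind_pmf_cong[OF refl])
    fix l assume "l \<in> set_pmf (history i)"
    then have "l \<noteq> []" by (rule history_not_Nil)
    then have "hd (l' @ [hd l]) = hd (l' @ l)" for l' by (cases l') auto
    then show "bind_pmf (continuation (hd l) j) (\<lambda>l'. map_pmf (\<lambda>t. t # l' @ l) (step (hd (l' @ l))))
       = map_pmf (\<lambda>l'. l' @ l) (continuation (hd l) (Suc j))"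
      by (simp add: map_bind_pmf pmf.map_comp o_def)
  qed
  finally show ?case .
qed

text \<open>The probability of a path, most recent state first.\<close>

fun weight :: "'s list \<Rightarrow> real" where
  "weight [] = 0"
| "weight [s] = pmf \<pi> s"
| "weight (t # s # l) = weight (s # l) * pmf (step s) t"

lemma pmf_history: "pmf (history n) l = (if length l = Suc n then weight l else 0)"
proof (induction n arbitrary: l)
  case 0
  show ?case
  proof (cases "\<exists>s. l = [s]")
    case True
    then obtain s where "l = [s]" by auto
    then show ?thesis using pmf_map_inj'[of "\<lambda>s. [s]" \<pi> s] by (simp add: inj_def)
  next
    case False
    then have "length l \<noteq> Suc 0" "l \<notin> (\<lambda>s. [s]) ` set_pmf \<pi>" by (auto simp: length_Suc_conv)
    then show ?thesis by (simp add: pmf_map_outside)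
  qed
next
  case (Suc n)
  show ?case
  proof (cases "length l = Suc (Suc n)")
    case True
    then obtain t s l' where l: "l = t # s # l'" by (auto simp: length_Suc_conv)
    have "pmf (map_pmf (\<lambda>t. t # m) (step (hd m))) l = indicator {s # l'} m * pmf (step s) t" for m
      using pmf_map_inj'[of "\<lambda>t. t # m" "step (hd m)" t]
      by (cases "m = s # l'") (auto simp: l inj_def intro!: pmf_map_outside)
    then have "pmf (history (Suc n)) l = pmf (history n) (s # l') * pmf (step s) t"
      by (simp add: pmf_bind measure_pmf_single)
    then show ?thesis using True by (simp add: Suc.IH l)
  next
    case False
    then have "l \<notin> set_pmf (history (Suc n))" using length_history by blast
    then show ?thesis using False by (simp add: pmf_eq_0_set_pmf)
  qed
qed

text \<open>Detailed balance moves the factor \<open>\<pi>\<close> from the oldest state to the next one, along the whole path.\<close>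

lemma weight_snoc: "l \<noteq> [] \<Longrightarrow> weight (l @ [s]) = weight l * pmf (step (last l)) s"
proof (induction l rule: weight.induct)
  case (2 a)
  then show ?case using detailed_balance[of s a] by simp
next
  case (3 t a l)
  have "weight ((t # a # l) @ [s]) = weight ((a # l) @ [s]) * pmf (step a) t" by simp
  also have "\<dots> = weight (a # l) * pmf (step (last (a # l))) s * pmf (step a) t"
    by (subst "3.IH") auto
  finally show ?case by simp
qed simp

lemma weight_rev: "weight (rev l) = weight l"
proof (induction l rule: weight.induct)
  case (3 t s l)
  have "weight (rev (t # s # l)) = weight (rev (s # l) @ [t])" by simp
  also have "\<dots> = weight (rev (s # l)) * pmf (step s) t"
    by (subst weight_snoc) (auto simp: last_rev)
  finally show ?case by (simp only: "3.IH" weight.simps)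
qed simp_all

lemma map_rev_history: "map_pmf rev (history n) = history n"
proof (rule pmf_eqI)
  fix l :: "'s list"
  have "pmf (map_pmf rev (history n)) (rev (rev l)) = pmf (history n) (rev l)"
    by (rule pmf_map_inj') (auto simp: inj_def)
  then show "pmf (map_pmf rev (history n)) l = pmf (history n) l"
    by (simp add: pmf_history weight_rev)
qed

text \<open>The transition operator of the chain.\<close>

definition avg :: "('s \<Rightarrow> 'c::euclidean_space) \<Rightarrow> 's \<Rightarrow> 'c" where
  "avg u s = mean (step s) u"

lemma avg_bounded: "(\<And>x. norm (u x) \<le> B) \<Longrightarrow> norm (avg u s) \<le> B"
  unfolding avg_def by (rule norm_expectation_pmf_le)

lemma avg_eq:
  assumes "\<And>x. norm (u x) \<le> B"
  shows "avg u s = (1 - p s) *\<^sub>R u s + p s *\<^sub>R mean fresh u"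
  unfolding avg_def step_def
  by (subst integral_bind_pmf_bounded[OF assms])
     (subst integral_measure_pmf[of UNIV], auto simp: UNIV_bool p_nonneg p_le_1)

lemma expectation_avg:
  assumes "\<And>x. norm (u x) \<le> B"
  shows "mean \<pi> (avg u) = mean \<pi> u"
  unfolding avg_def integral_bind_pmf_bounded[OF assms, symmetric] bind_step ..

lemma expectation_history_Suc:
  assumes "\<And>l. norm (w l) \<le> B"
  shows "mean (history (Suc n)) w
    = mean (history n) (\<lambda>l. avg (\<lambda>t. w (t # l)) (hd l))"
  by (simp add: integral_bind_pmf_bounded[OF assms] avg_def)

lemma avg_funpow_bounded: "(\<And>x. norm (u x) \<le> B) \<Longrightarrow> norm ((avg ^^ n) u s) \<le> B"
  by (induction n arbitrary: s) (auto intro: avg_bounded)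

text \<open>The joint law of the first and the last state of a path, through the powers of the transition
operator.\<close>

lemma expectation_history_last_hd:
  fixes u :: "'s \<Rightarrow> real"
  assumes "\<And>x. \<bar>u x\<bar> \<le> B"
  shows "mean (history n) (\<lambda>l. indicator {x} (last l) * u (hd l)) = pmf \<pi> x * (avg ^^ n) u x"
  using assms
proof (induction n arbitrary: u)
  case 0
  have "mean (history 0) (\<lambda>l. indicator {x} (last l) * u (hd l))
     = mean \<pi> (\<lambda>s. indicator {x} s * u x)"
    unfolding history.simps integral_map_pmf
    by (intro Bochner_Integration.integral_cong) (auto simp: indicator_def)
  then show ?case unfolding expectation_indicator_single by simp
next
  case (Suc n)
  have "B \<ge> 0" using Suc.prems[of x] by linarith
  then have bd: "norm (indicator {x} (last l) * u (hd l)) \<le> B" for l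
    using Suc.prems by (auto simp: indicator_def)
  have "mean (history (Suc n)) (\<lambda>l. indicator {x} (last l) * u (hd l))
     = mean (history n) (\<lambda>l. avg (\<lambda>t. indicator {x} (last (t # l)) * u (hd (t # l))) (hd l))"
    by (rule expectation_history_Suc[OF bd])
  also have "\<dots> = mean (history n) (\<lambda>l. indicator {x} (last l) * avg u (hd l))"
    by (rule integral_cong_AE) (auto simp: AE_measure_pmf_iff history_not_Nil avg_def)
  also have "\<dots> = pmf \<pi> x * (avg ^^ n) (avg u) x"
    using avg_bounded[of u B] Suc.prems by (intro Suc.IH) auto
  finally show ?case by (simp add: funpow_swap1)
qed

end

section \<open>The two-sided stationary process\<close>

text \<open>The states at the times \<open>a, \<dots>, a + n\<close>, most recent first as in \<open>history\<close>.\<close>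

definition window :: "(int \<Rightarrow> 'a \<Rightarrow> 's) \<Rightarrow> int \<Rightarrow> nat \<Rightarrow> 'a \<Rightarrow> 's list" where
  "window Y a n \<omega> = map (\<lambda>i. Y (a + int n - int i) \<omega>) [0..<Suc n]"

lemma length_window: "length (window Y a n \<omega>) = Suc n"
  by (simp add: window_def)

lemma nth_window: "i \<le> n \<Longrightarrow> window Y a n \<omega> ! i = Y (a + int n - int i) \<omega>"
  by (auto simp: window_def simp del: upt_Suc)

lemma hd_window: "hd (window Y a n \<omega>) = Y (a + int n) \<omega>"
  using nth_window[of 0 n Y a \<omega>] length_window[of Y a n \<omega>] by (metis hd_conv_nth bot_nat_0.extremum diff_zero length_0_conv nat.distinct(1) of_nat_0)

lemma last_window: "last (window Y a n \<omega>) = Y a \<omega>"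
  using nth_window[of n n Y a \<omega>] length_window[of Y a n \<omega>]
  by (subst last_conv_nth) (auto simp: window_def)

lemma drop_window: "drop j (window Y a (i + j) \<omega>) = window Y a i \<omega>"
  by (rule nth_equalityI) (auto simp: length_window nth_window algebra_simps)

lemma take_window: "take (Suc j) (window Y a (i + j) \<omega>) = window Y (a + int i) j \<omega>"
  by (rule nth_equalityI) (auto simp: length_window nth_window algebra_simps)

context refresh_chain
begin

lemma map_drop_history: "map_pmf (drop j) (history (j + n)) = history n"
proof (induction j)
  case (Suc j)
  have "map_pmf (drop (Suc j)) (history (Suc j + n)) = map_pmf (drop j) (map_pmf tl (history (Suc (j + n))))"
    unfolding pmf.map_comp by (rule map_pmf_cong) (simp_all add: drop_Suc)
  then show ?case by (simp only: map_tl_history Suc.IH)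
qed (simp add: pmf.map_ident)

lemma map_take_history: "map_pmf (take (Suc n)) (history (n + k)) = history n"
proof (induction k)
  case 0
  have "map_pmf (take (Suc n)) (history n) = map_pmf (\<lambda>l. l) (history n)"
    by (rule map_pmf_cong) (auto dest: length_history)
  then show ?case by (simp add: pmf.map_ident)
next
  case (Suc k)
  have "map_pmf (take (Suc n)) (history (n + Suc k)) = map_pmf (\<lambda>l. take (Suc n) (butlast l)) (history (Suc (n + k)))"
    unfolding add_Suc_right by (rule map_pmf_cong) (auto dest!: length_history simp: take_butlast)
  also have "\<dots> = map_pmf (take (Suc n)) (map_pmf butlast (history (Suc (n + k))))"
    by (simp only: pmf.map_comp o_def)
  finally show ?case by (simp only: map_butlast_history Suc.IH)
qed

lemma map_nth_history:
  assumes "\<And>k. k \<in> J \<Longrightarrow> pos k \<le> n"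
  shows "map_pmf (\<lambda>l. \<lambda>k\<in>J. l ! (j + pos k)) (history (j + n + i)) = map_pmf (\<lambda>l. \<lambda>k\<in>J. l ! pos k) (history n)"
proof -
  have "map_pmf (\<lambda>l. \<lambda>k\<in>J. l ! (j + pos k)) (history (j + n + i))
      = map_pmf (\<lambda>l. \<lambda>k\<in>J. take (Suc n) (drop j l) ! pos k) (history (j + n + i))"
    using assms by (intro map_pmf_cong refl restrict_ext) (auto dest!: length_history simp: le_imp_less_Suc)
  also have "\<dots> = map_pmf (\<lambda>l. \<lambda>k\<in>J. l ! pos k) (map_pmf (take (Suc n)) (map_pmf (drop j) (history (j + (n + i)))))"
    by (simp only: pmf.map_comp o_def add.assoc)
  finally show ?thesis by (simp only: map_drop_history map_take_history)
qed

end

text \<open>The stationary chain on the whole time axis, described only through the laws of its windows.\<close>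

locale refresh_process = refresh_chain \<pi> p + prob_space M
  for \<pi> :: "'s::countable pmf" and p :: "'s \<Rightarrow> real" and M :: "'a measure" +
  fixes Y :: "int \<Rightarrow> 'a \<Rightarrow> 's"
  assumes Y_measurable[measurable]: "Y k \<in> M \<rightarrow>\<^sub>M count_space UNIV"
    and distr_window: "distr M (count_space UNIV) (window Y a n) = measure_pmf (history n)"

text \<open>This is Kolmogorov's extension theorem. The states are coded as integers within the Polish space
of the reals, and the law prescribed for the coordinates in a finite set \<open>J\<close> is read off from a
history over a time interval around \<open>0\<close> that contains \<open>J\<close>. The choice of the interval is
irrelevant because shorter histories are marginals of longer ones.\<close>

theorem refresh_process_exists:
  fixes \<pi> :: "'s::countable pmf"
  assumes "refresh_chain p"
  shows "\<exists>(M :: (int \<Rightarrow> real) measure) Y. refresh_process \<pi> p M Y"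
proof -
  interpret refresh_chain \<pi> p by fact
  define e :: "'s \<Rightarrow> int" where "e s = int (to_nat s)" for s
  have inj: "inj e" by (auto simp: e_def inj_def)
  \<comment> \<open>In a history over the times \<open>-N, \<dots>, N\<close>, most recent first, time \<open>k\<close> has the index \<open>N - k\<close>.\<close>
  define pos :: "nat \<Rightarrow> int \<Rightarrow> nat" where "pos N k = nat (int N - k)" for N k
  define val :: "nat \<Rightarrow> int set \<Rightarrow> 's list \<Rightarrow> int \<Rightarrow> real" where
    "val N J l = (\<lambda>k\<in>J. real_of_int (e (l ! pos N k)))" for N J l
  define bound :: "int set \<Rightarrow> nat" where "bound J = Max (insert 0 ((\<lambda>k. nat \<bar>k\<bar>) ` J))" for J
  define P where "P J = distr (measure_pmf (history (2 * bound J))) (PiM J (\<lambda>_. borel)) (val (bound J) J)" for J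
  have bound: "\<bar>k\<bar> \<le> int (bound J)" if "finite J" "k \<in> J" for k J
  proof -
    have "nat \<bar>k\<bar> \<le> bound J" unfolding bound_def by (rule Max_ge) (use that in auto)
    then show ?thesis by linarith
  qed
  have bound_mono: "bound J \<le> bound H" if "J \<subseteq> H" "finite H" for J H
    unfolding bound_def by (rule Max_mono) (use that in auto)
  have val_space: "val N J l \<in> space (PiM J (\<lambda>_. borel))" for N J l
    by (auto simp: val_def space_PiM)
  have transport: "distr (measure_pmf (history (j + n + i))) (PiM J (\<lambda>_. borel)) (val N J)
        = distr (measure_pmf (history n)) (PiM J (\<lambda>_. borel)) (val N' J)"
    if "\<And>k. k \<in> J \<Longrightarrow> pos N' k \<le> n \<and> pos N k = j + pos N' k" for i j n J N N'
  proof -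
    let ?r = "\<lambda>g. \<lambda>k\<in>J. real_of_int (e (g k))"
    have "distr (measure_pmf (history (j + n + i))) (PiM J (\<lambda>_. borel)) (val N J)
       = distr (measure_pmf (map_pmf (\<lambda>l. \<lambda>k\<in>J. l ! (j + pos N' k)) (history (j + n + i)))) (PiM J (\<lambda>_. borel)) ?r"
      unfolding map_pmf_rep_eq using that
      by (subst distr_distr) (auto simp: space_PiM val_def o_def intro!: distr_cong)
    also have "\<dots> = distr (measure_pmf (map_pmf (\<lambda>l. \<lambda>k\<in>J. l ! pos N' k) (history n))) (PiM J (\<lambda>_. borel)) ?r"
      using that by (subst map_nth_history) auto
    also have "\<dots> = distr (measure_pmf (history n)) (PiM J (\<lambda>_. borel)) (val N' J)"
      unfolding map_pmf_rep_eq using that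
      by (subst distr_distr) (auto simp: space_PiM val_def o_def intro!: distr_cong)
    finally show ?thesis .
  qed
  have P_larger: "P J = distr (measure_pmf (history (2 * N))) (PiM J (\<lambda>_. borel)) (val N J)"
    if "finite J" "bound J \<le> N" for J N
  proof -
    have N: "2 * N = (N - bound J) + 2 * bound J + (N - bound J)" using that by simp
    show ?thesis unfolding P_def by (subst N, rule transport[symmetric])
        (use that bound[of J] in \<open>fastforce simp: pos_def\<close>)
  qed
  interpret polish_projective "UNIV :: int set" P
  proof (rule polish_projective.intro, rule projective_family.intro)
    fix J H :: "int set" assume JH: "J \<subseteq> H" "finite H" "H \<subseteq> UNIV"
    then have "finite J" by (metis finite_subset)
    have "P J = distr (measure_pmf (history (2 * bound H))) (PiM J (\<lambda>_. borel)) (val (bound H) J)"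
      by (rule P_larger) (use JH \<open>finite J\<close> bound_mono in auto)
    also have "\<dots> = distr (P H) (PiM J (\<lambda>_. borel)) (\<lambda>f. restrict f J)"
      unfolding P_def using JH
      by (subst distr_distr) (auto simp: space_PiM val_def o_def Int_absorb1 intro!: distr_cong measurable_restrict_subset)
    finally show "P J = distr (P H) (PiM J (\<lambda>_. borel)) (\<lambda>f. restrict f J)" .
  next
    fix J :: "int set" assume "finite J"
    show "prob_space (P J)"
      unfolding P_def by (rule measure_pmf.prob_space_distr) (auto simp: val_space)
  qed
  \<comment> \<open>The floor and the total inverse of the coding assign a state to every real path, also to those
    outside the support of the limit measure.\<close>
  define Y :: "int \<Rightarrow> (int \<Rightarrow> real) \<Rightarrow> 's" where "Y k \<omega> = inv e \<lfloor>\<omega> k\<rfloor>" for k \<omega>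
  have Ym[measurable]: "Y k \<in> lim \<rightarrow>\<^sub>M count_space UNIV" for k
  proof -
    have [measurable]: "(\<lambda>\<omega>. \<omega> k) \<in> borel_measurable lim"
      by (subst measurable_cong_sets[OF sets_lim refl]) (rule measurable_component_singleton, simp)
    show ?thesis unfolding Y_def by measurable
  qed
  have rm[measurable]: "(\<lambda>\<omega>. restrict \<omega> J) \<in> lim \<rightarrow>\<^sub>M PiM J (\<lambda>_. borel)" for J
    by (subst measurable_cong_sets[OF sets_lim refl]) (rule measurable_restrict_subset, simp)
  have restr: "distr lim (PiM J (\<lambda>_. borel)) (\<lambda>\<omega>. restrict \<omega> J) = P J" if "finite J" for J
  proof (rule measure_eqI)
    show "sets (distr lim (PiM J (\<lambda>_. borel)) (\<lambda>\<omega>. restrict \<omega> J)) = sets (P J)" by (simp add: P_def)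
    fix A assume "A \<in> sets (distr lim (PiM J (\<lambda>_. borel)) (\<lambda>\<omega>. restrict \<omega> J))"
    then have A: "A \<in> sets (PiM J (\<lambda>_. borel))" by simp
    have "emeasure (distr lim (PiM J (\<lambda>_. borel)) (\<lambda>\<omega>. restrict \<omega> J)) A = emeasure lim (emb UNIV J A)"
      using A by (subst emeasure_distr) (auto simp: prod_emb_def space_PiM)
    also have "\<dots> = emeasure (P J) A"
      using A that by (intro emeasure_lim_emb) auto
    finally show "emeasure (distr lim (PiM J (\<lambda>_. borel)) (\<lambda>\<omega>. restrict \<omega> J)) A = emeasure (P J) A" .
  qed
  have "refresh_process \<pi> p lim Y"
  proof
    fix k show "Y k \<in> lim \<rightarrow>\<^sub>M count_space UNIV" by (rule Ym)
  next
    fix a n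
    define J where "J = {a..a + int n}"
    define N where "N = bound J"
    define w :: "(int \<Rightarrow> real) \<Rightarrow> 's list" where "w = window (\<lambda>k g. inv e \<lfloor>g k\<rfloor>) a n"
    have J: "finite J" by (simp add: J_def)
    have N: "- int N \<le> a" "a + int n \<le> int N"
      using bound[OF J, of a] bound[OF J, of "a + int n"] by (auto simp: N_def J_def)
    have em: "(\<lambda>g. inv e \<lfloor>g k :: real\<rfloor>) \<in> PiM J (\<lambda>_. borel) \<rightarrow>\<^sub>M count_space UNIV" if "k \<in> J" for k
    proof -
      have [measurable]: "(\<lambda>g. g k) \<in> PiM J (\<lambda>_. borel) \<rightarrow>\<^sub>M (borel :: real measure)"
        by (rule measurable_component_singleton[OF that])
      show ?thesis by measurable
    qed
    have wm: "w \<in> PiM J (\<lambda>_. borel) \<rightarrow>\<^sub>M count_space UNIV"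
    proof (subst measurable_count_space_eq2_countable, safe)
      fix l :: "'s list"
      have "w -` {l} \<inter> space (PiM J (\<lambda>_. borel)) = (if length l = Suc n then
         {g \<in> space (PiM J (\<lambda>_. borel)). \<forall>i\<in>{..n}. inv e \<lfloor>g (a + int n - int i) :: real\<rfloor> = l ! i} else {})"
        by (auto simp: w_def list_eq_iff_nth_eq length_window nth_window less_Suc_eq_le simp flip: all_simps)
      also have "\<dots> \<in> sets (PiM J (\<lambda>_. borel))"
      proof -
        have "{g \<in> space (PiM J (\<lambda>_. borel)). \<forall>i\<in>{..n}. inv e \<lfloor>g (a + int n - int i) :: real\<rfloor> = l ! i}
           = (\<Inter>i\<in>{..n}. (\<lambda>g. inv e \<lfloor>g (a + int n - int i)\<rfloor>) -` {l ! i} \<inter> space (PiM J (\<lambda>_. borel)))"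
          by auto
        also have "\<dots> \<in> sets (PiM J (\<lambda>_. borel))"
          by (intro sets.finite_INT measurable_sets[OF em]) (auto simp: J_def)
        finally have "{g \<in> space (PiM J (\<lambda>_. borel)). \<forall>i\<in>{..n}. inv e \<lfloor>g (a + int n - int i) :: real\<rfloor> = l ! i}
          \<in> sets (PiM J (\<lambda>_. borel))" .
        then show ?thesis by auto
      qed
      finally show "w -` {l} \<inter> space (PiM J (\<lambda>_. borel)) \<in> sets (PiM J (\<lambda>_. borel))" .
    qed auto
    have "distr lim (count_space UNIV) (window Y a n) = distr lim (count_space UNIV) (\<lambda>\<omega>. w (restrict \<omega> J))"
      by (intro distr_cong) (auto simp: w_def window_def Y_def J_def)
    also have "\<dots> = distr (distr lim (PiM J (\<lambda>_. borel)) (\<lambda>\<omega>. restrict \<omega> J)) (count_space UNIV) w"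
      by (subst distr_distr) (auto simp: o_def wm)
    also have "\<dots> = distr (P J) (count_space UNIV) w" by (simp add: restr J)
    also have "\<dots> = distr (measure_pmf (history (2 * N))) (count_space UNIV) (\<lambda>l. w (val N J l))"
      unfolding P_def N_def by (subst distr_distr) (auto simp: o_def wm val_space)
    also have "\<dots> = measure_pmf (map_pmf (\<lambda>l. w (val N J l)) (history (2 * N)))"
      by (simp add: map_pmf_rep_eq)
    also have "map_pmf (\<lambda>l. w (val N J l)) (history (2 * N))
        = map_pmf (\<lambda>l. take (Suc n) (drop (nat (int N - a - int n)) l)) (history (2 * N))"
    proof (rule map_pmf_cong[OF refl])
      fix l assume "l \<in> set_pmf (history (2 * N))"
      then have l: "length l = Suc (2 * N)" by (rule length_history)
      show "w (val N J l) = take (Suc n) (drop (nat (int N - a - int n)) l)"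
      proof (rule nth_equalityI)
        show "length (w (val N J l)) = length (take (Suc n) (drop (nat (int N - a - int n)) l))"
          using N l by (auto simp: w_def length_window)
        fix i assume "i < length (w (val N J l))"
        then have i: "i \<le> n" by (simp add: w_def length_window)
        have pos: "pos N (a + int n - int i) = nat (int N - a - int n) + i" using N i by (auto simp: pos_def)
        have "w (val N J l) ! i = l ! pos N (a + int n - int i)"
          using i inj by (simp add: w_def nth_window val_def J_def)
        then show "w (val N J l) ! i = take (Suc n) (drop (nat (int N - a - int n)) l) ! i"
          using i l N by (simp add: pos)
      qed
    qed
    also have "\<dots> = map_pmf (take (Suc n)) (map_pmf (drop (nat (int N - a - int n))) (history (2 * N)))"
      by (simp only: pmf.map_comp o_def)
    also have "2 * N = nat (int N - a - int n) + (n + nat (a + int N))" using N by linarith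
    also have "map_pmf (take (Suc n)) (map_pmf (drop (nat (int N - a - int n))) (history (nat (int N - a - int n) + (n + nat (a + int N))))) = history n"
      by (simp only: map_drop_history map_take_history)
    finally show "distr lim (count_space UNIV) (window Y a n) = measure_pmf (history n)" .
  qed
  then show ?thesis by blast
qed

section \<open>Conditional independence of past and future\<close>

lemma measure_bind_pmf: "measure_pmf.prob (bind_pmf q k) A = mean q (\<lambda>x. measure_pmf.prob (k x) A)"
proof -
  have "mean (bind_pmf q k) (indicator A :: _ \<Rightarrow> real)
      = mean q (\<lambda>x. mean (k x) (indicator A))"
    by (rule integral_bind_pmf_bounded[of _ 1]) (auto simp: indicator_def)
  then show ?thesis by (simp)
qed

context refresh_process
begin

lemma window_measurable[measurable]: "window Y a n \<in> M \<rightarrow>\<^sub>M count_space UNIV"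
proof (subst measurable_count_space_eq2_countable, safe)
  fix l :: "'s list"
  have "window Y a n -` {l} \<inter> space M = (if length l = Suc n then
     {\<omega> \<in> space M. \<forall>i\<in>{..n}. Y (a + int n - int i) \<omega> = l ! i} else {})"
    by (auto simp: list_eq_iff_nth_eq length_window nth_window less_Suc_eq_le simp flip: all_simps)
  also have "\<dots> \<in> sets M" by auto
  finally show "window Y a n -` {l} \<inter> space M \<in> sets M" .
qed auto

lemma prob_window: "prob {\<omega> \<in> space M. window Y a n \<omega> \<in> L} = measure_pmf.prob (history n) L"
  unfolding distr_window[of a n, symmetric]
  by (subst measure_distr) (auto intro!: arg_cong[where f=prob])

lemma expectation_window:
  fixes u :: "'s list \<Rightarrow> 'c::{banach, second_countable_topology}"
  shows "expectation (\<lambda>\<omega>. u (window Y a n \<omega>)) = mean (history n) u"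
  unfolding distr_window[of a n, symmetric] by (subst integral_distr) auto

lemma integrable_window_iff:
  fixes u :: "'s list \<Rightarrow> 'c::{banach, second_countable_topology}"
  shows "integrable M (\<lambda>\<omega>. u (window Y a n \<omega>)) \<longleftrightarrow> integrable (history n) u"
  unfolding distr_window[of a n, symmetric] by (subst integrable_distr_eq) auto

lemma expectation_state:
  fixes u :: "'s \<Rightarrow> 'c::{banach, second_countable_topology}"
  shows "expectation (\<lambda>\<omega>. u (Y k \<omega>)) = mean \<pi> u"
  using expectation_window[of "\<lambda>l. u (hd l)" k 0] by (simp add: hd_window)

lemma integrable_state_iff:
  fixes u :: "'s \<Rightarrow> 'c::{banach, second_countable_topology}"
  shows "integrable M (\<lambda>\<omega>. u (Y k \<omega>)) \<longleftrightarrow> integrable \<pi> u"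
  using integrable_window_iff[of "\<lambda>l. u (hd l)" k 0] by (simp add: hd_window)

lemma prob_state: "prob {\<omega> \<in> space M. Y k \<omega> \<in> S} = measure_pmf.prob \<pi> S"
  using prob_window[of k 0 "{l. hd l \<in> S}"] by (simp add: hd_window vimage_def)

lemma prob_state_single: "prob {\<omega> \<in> space M. Y k \<omega> = y} = pmf \<pi> y"
  using prob_state[of k "{y}"] by (simp add: measure_pmf_single)

text \<open>The events that are visible in a window ending, respectively beginning, at time \<open>c\<close>. They are stable
under intersection and generate the \<open>\<sigma>\<close>-fields of the past and of the future of \<open>c\<close>.\<close>

definition past :: "int \<Rightarrow> 'a set set" where
  "past c = {{\<omega> \<in> space M. window Y (c - int i) i \<omega> \<in> L} | i L. True}"

definition future :: "int \<Rightarrow> 'a set set" where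
  "future c = {{\<omega> \<in> space M. window Y c j \<omega> \<in> L} | j L. True}"

lemma past_future_events: "past c \<subseteq> events" "future c \<subseteq> events"
  unfolding past_def future_def by auto

lemma Int_stable_past: "Int_stable (past c)"
proof (rule Int_stableI)
  have *: "\<exists>i'' L''. {\<omega> \<in> space M. window Y (c - int i) i \<omega> \<in> L} \<inter> {\<omega> \<in> space M. window Y (c - int i') i' \<omega> \<in> L'}
     = {\<omega> \<in> space M. window Y (c - int i'') i'' \<omega> \<in> L''}" if "i \<le> i'" for i i' L L'
  proof -
    have "window Y (c - int i) i \<omega> = take (Suc i) (window Y (c - int i') i' \<omega>)" for \<omega>
      using take_window[of i Y "c - int i'" "i' - i" \<omega>] that by (simp add: algebra_simps of_nat_diff)
    then show ?thesis
      by (intro exI[of _ i'] exI[of _ "L' \<inter> take (Suc i) -` L"]) auto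
  qed
  fix A B assume "A \<in> past c" "B \<in> past c"
  then obtain i L i' L' where AB: "A = {\<omega> \<in> space M. window Y (c - int i) i \<omega> \<in> L}"
    "B = {\<omega> \<in> space M. window Y (c - int i') i' \<omega> \<in> L'}" by (auto simp: past_def)
  show "A \<inter> B \<in> past c"
  proof (cases "i \<le> i'")
    case True then show ?thesis using *[of i i' L L'] unfolding AB past_def by blast
  next
    case False
    then have "i' \<le> i" by simp
    from *[OF this, of L' L] show ?thesis unfolding AB past_def by (subst Int_commute) blast
  qed
qed

lemma Int_stable_future: "Int_stable (future c)"
proof (rule Int_stableI)
  have *: "\<exists>i'' L''. {\<omega> \<in> space M. window Y c i \<omega> \<in> L} \<inter> {\<omega> \<in> space M. window Y c i' \<omega> \<in> L'}
     = {\<omega> \<in> space M. window Y c i'' \<omega> \<in> L''}" if "i \<le> i'" for i i' L L'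
  proof -
    have "window Y c i \<omega> = drop (i' - i) (window Y c i' \<omega>)" for \<omega>
      using drop_window[of "i' - i" Y c i \<omega>] that by simp
    then show ?thesis
      by (intro exI[of _ i'] exI[of _ "L' \<inter> drop (i' - i) -` L"]) auto
  qed
  fix A B assume "A \<in> future c" "B \<in> future c"
  then obtain i L i' L' where AB: "A = {\<omega> \<in> space M. window Y c i \<omega> \<in> L}"
    "B = {\<omega> \<in> space M. window Y c i' \<omega> \<in> L'}" by (auto simp: future_def)
  show "A \<inter> B \<in> future c"
  proof (cases "i \<le> i'")
    case True then show ?thesis using *[of i i' L L'] unfolding AB future_def by blast
  next
    case False
    then have "i' \<le> i" by simp
    from *[OF this, of L' L] show ?thesis unfolding AB future_def by (subst Int_commute) blast
  qed
qed

text \<open>Whatever happened up to time \<open>c\<close>, if the chain is then in \<open>y\<close>, its further states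
follow the law of a continuation of \<open>y\<close>.\<close>

lemma cond_indep_windows:
  "prob {\<omega> \<in> space M. window Y (c - int i) i \<omega> \<in> L \<and> window Y c j \<omega> \<in> L' \<and> Y c \<omega> = y} * pmf \<pi> y
   = prob {\<omega> \<in> space M. window Y (c - int i) i \<omega> \<in> L \<and> Y c \<omega> = y} * prob {\<omega> \<in> space M. window Y c j \<omega> \<in> L' \<and> Y c \<omega> = y}"
proof -
  define g where "g = measure_pmf.prob (continuation y j) {l. l @ [y] \<in> L'}"
  have joint: "prob {\<omega> \<in> space M. window Y (c - int i) i \<omega> \<in> L \<and> window Y c j \<omega> \<in> L' \<and> Y c \<omega> = y}
      = g * prob {\<omega> \<in> space M. window Y (c - int i) i \<omega> \<in> L \<and> Y c \<omega> = y}" for i L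
  proof -
    define A where "A = {l. drop j l \<in> L \<and> take (Suc j) l \<in> L' \<and> l ! j = y}"
    have "{\<omega> \<in> space M. window Y (c - int i) i \<omega> \<in> L \<and> window Y c j \<omega> \<in> L' \<and> Y c \<omega> = y}
       = {\<omega> \<in> space M. window Y (c - int i) (i + j) \<omega> \<in> A}"
      by (auto simp: A_def drop_window take_window nth_window)
    then have "prob {\<omega> \<in> space M. window Y (c - int i) i \<omega> \<in> L \<and> window Y c j \<omega> \<in> L' \<and> Y c \<omega> = y}
      = measure_pmf.prob (history (i + j)) A" by (simp add: prob_window)
    also have "\<dots> = mean (history i) (\<lambda>l. measure_pmf.prob (continuation (hd l) j) {l'. l' @ l \<in> A})"
      by (simp add: history_add measure_bind_pmf vimage_def)
    also have "\<dots> = mean (history i) (\<lambda>l. indicator {l. l \<in> L \<and> hd l = y} l * g)"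
    proof (rule integral_cong_AE)
      show "AE l in measure_pmf (history i). measure_pmf.prob (continuation (hd l) j) {l'. l' @ l \<in> A}
         = indicator {l. l \<in> L \<and> hd l = y} l * g"
      proof (unfold AE_measure_pmf_iff, safe)
        fix l assume l: "l \<in> set_pmf (history i)"
        then obtain a l0 where l0: "l = a # l0" using history_not_Nil by (cases l) auto
        have "measure_pmf.prob (continuation (hd l) j) {l'. l' @ l \<in> A}
            = measure_pmf.prob (continuation (hd l) j) {l'. l \<in> L \<and> l' @ [hd l] \<in> L' \<and> hd l = y}"
          by (rule measure_pmf.finite_measure_eq_AE)
             (auto simp: AE_measure_pmf_iff A_def l0 nth_append dest!: length_continuation)
        also have "\<dots> = indicator {l. l \<in> L \<and> hd l = y} l * g"
          by (cases "l \<in> L \<and> hd l = y") (auto simp: g_def)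
        finally show "measure_pmf.prob (continuation (hd l) j) {l'. l' @ l \<in> A} = indicator {l. l \<in> L \<and> hd l = y} l * g" .
      qed
    qed auto
    also have "\<dots> = g * measure_pmf.prob (history i) {l. l \<in> L \<and> hd l = y}"
      by (simp add: mult.commute)
    also have "measure_pmf.prob (history i) {l. l \<in> L \<and> hd l = y}
        = prob {\<omega> \<in> space M. window Y (c - int i) i \<omega> \<in> L \<and> Y c \<omega> = y}"
      using prob_window[of "c - int i" i "{l. l \<in> L \<and> hd l = y}"] by (simp add: hd_window)
    finally show ?thesis .
  qed
  have "prob {\<omega> \<in> space M. window Y c j \<omega> \<in> L' \<and> Y c \<omega> = y} = g * pmf \<pi> y"
    using joint[of 0 UNIV] by (simp add: prob_state_single)
  then show ?thesis using joint[of i L] by simp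
qed

text \<open>Under the conditional measure given \<open>Y\<^sub>c = y\<close> the statement is independence, which passes from
intersection-stable generators to \<open>\<sigma>\<close>-fields. It is written without quotients so that it covers
states of probability \<open>0\<close> as well.\<close>

lemma cond_indep_past_future:
  assumes "A \<in> sigma_sets (space M) (past c)" "B \<in> sigma_sets (space M) (future c)"
  shows "prob (A \<inter> B \<inter> {\<omega> \<in> space M. Y c \<omega> = y}) * pmf \<pi> y
    = prob (A \<inter> {\<omega> \<in> space M. Y c \<omega> = y}) * prob (B \<inter> {\<omega> \<in> space M. Y c \<omega> = y})"
proof (cases "pmf \<pi> y = 0")
  case True
  have "prob (A \<inter> {\<omega> \<in> space M. Y c \<omega> = y}) \<le> prob {\<omega> \<in> space M. Y c \<omega> = y}"
    by (rule finite_measure_mono) auto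
  then show ?thesis using True by (simp add: prob_state_single measure_le_0_iff)
next
  case False
  define E where "E = {\<omega> \<in> space M. Y c \<omega> = y}"
  have E[measurable]: "E \<in> events" by (simp add: E_def)
  have pE: "prob E = pmf \<pi> y" "pmf \<pi> y > 0" using False by (auto simp: E_def prob_state_single less_le)
  have eE: "emeasure M E \<noteq> 0" "emeasure M E \<noteq> \<infinity>" using pE by (auto simp: emeasure_eq_measure)
  define Q where "Q = uniform_measure M E"
  interpret Q: prob_space Q unfolding Q_def by (rule prob_space_uniform_measure[OF eE])
  have spQ: "space Q = space M" "sets Q = events" by (auto simp: Q_def)
  have mQ: "measure Q C = prob (E \<inter> C) / pmf \<pi> y" if "C \<in> events" for C
    unfolding Q_def using measure_uniform_measure[OF eE that] by (simp add: pE Int_commute)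
  have "Q.indep_set (past c) (future c)"
  proof (rule Q.indep_setI)
    show "past c \<subseteq> sets Q" "future c \<subseteq> sets Q" using past_future_events by (auto simp: spQ)
    fix a b assume ab: "a \<in> past c" "b \<in> future c"
    then obtain i L j L' where *: "a = {\<omega> \<in> space M. window Y (c - int i) i \<omega> \<in> L}"
       "b = {\<omega> \<in> space M. window Y c j \<omega> \<in> L'}" by (auto simp: past_def future_def)
    have ev: "a \<in> events" "b \<in> events" using ab past_future_events by auto
    have eqs: "E \<inter> (a \<inter> b) = {\<omega> \<in> space M. window Y (c - int i) i \<omega> \<in> L \<and> window Y c j \<omega> \<in> L' \<and> Y c \<omega> = y}"
      "E \<inter> a = {\<omega> \<in> space M. window Y (c - int i) i \<omega> \<in> L \<and> Y c \<omega> = y}"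
      "E \<inter> b = {\<omega> \<in> space M. window Y c j \<omega> \<in> L' \<and> Y c \<omega> = y}"
      by (auto simp: * E_def)
    have "prob (E \<inter> (a \<inter> b)) * pmf \<pi> y = prob (E \<inter> a) * prob (E \<inter> b)"
      unfolding eqs by (rule cond_indep_windows)
    then show "Q.prob (a \<inter> b) = Q.prob a * Q.prob b"
      using pE ev by (simp add: mQ field_simps)
  qed
  then have ind: "Q.indep_set (sigma_sets (space Q) (past c)) (sigma_sets (space Q) (future c))"
    by (rule Q.indep_set_sigma_sets[OF _ Int_stable_past Int_stable_future])
  have ev: "A \<in> events" "B \<in> events"
    using assms sets.sigma_sets_subset[OF past_future_events(1)[of c]] sets.sigma_sets_subset[OF past_future_events(2)[of c]] by auto
  have "Q.prob (A \<inter> B) = Q.prob A * Q.prob B"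
    using Q.indep_setD[OF ind] assms by (simp add: spQ)
  then show ?thesis
    using pE ev by (simp add: mQ field_simps E_def[symmetric] Int_ac)
qed

text \<open>Summation of the conditional statement over the countably many states.\<close>

lemma prob_Int_eq_expectation:
  fixes h :: "'s \<Rightarrow> real"
  assumes [measurable]: "A \<in> events" "D \<in> events" and h: "\<And>y. 0 \<le> h y" "\<And>y. h y \<le> 1"
    and eq: "\<And>y. prob (A \<inter> D \<inter> {\<omega> \<in> space M. Y c \<omega> = y}) = h y * prob (A \<inter> {\<omega> \<in> space M. Y c \<omega> = y})"
  shows "prob (A \<inter> D) = expectation (\<lambda>\<omega>. indicator A \<omega> * h (Y c \<omega>))"
proof -
  let ?E = "\<lambda>y. {\<omega> \<in> space M. Y c \<omega> = y}"
  have "emeasure M (A \<inter> D) = emeasure M (\<Union>y\<in>UNIV. A \<inter> D \<inter> ?E y)"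
    using sets.sets_into_space[OF assms(1)] by (intro arg_cong[where f="emeasure M"]) auto
  also have "\<dots> = (\<integral>\<^sup>+y. emeasure M (A \<inter> D \<inter> ?E y) \<partial>count_space UNIV)"
    by (rule emeasure_UN_countable) (auto simp: disjoint_family_on_def)
  also have "\<dots> = (\<integral>\<^sup>+y. \<integral>\<^sup>+\<omega>. ennreal (h y) * indicator (A \<inter> ?E y) \<omega> \<partial>M \<partial>count_space UNIV)"
    by (intro nn_integral_cong) (simp add: emeasure_eq_measure eq ennreal_mult h nn_integral_cmult_indicator)
  also have "\<dots> = (\<integral>\<^sup>+\<omega>. \<integral>\<^sup>+y. ennreal (h y) * indicator (A \<inter> ?E y) \<omega> \<partial>count_space UNIV \<partial>M)"
    by (rule nn_integral_count_space_nn_integral[symmetric]) auto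
  also have "\<dots> = (\<integral>\<^sup>+\<omega>. ennreal (indicator A \<omega> * h (Y c \<omega>)) \<partial>M)"
  proof (rule nn_integral_cong)
    fix \<omega> assume "\<omega> \<in> space M"
    then have "(\<integral>\<^sup>+y. ennreal (h y) * indicator (A \<inter> ?E y) \<omega> \<partial>count_space UNIV)
       = (\<integral>\<^sup>+y. ennreal (indicator A \<omega> * h y) * indicator {Y c \<omega>} y \<partial>count_space UNIV)"
      by (intro nn_integral_cong) (auto simp: indicator_def)
    then show "(\<integral>\<^sup>+y. ennreal (h y) * indicator (A \<inter> ?E y) \<omega> \<partial>count_space UNIV) = ennreal (indicator A \<omega> * h (Y c \<omega>))"
      by (simp add: nn_integral_count_space_indicator)
  qed
  also have "\<dots> = ennreal (expectation (\<lambda>\<omega>. indicator A \<omega> * h (Y c \<omega>)))"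
    by (intro nn_integral_eq_integral integrable_const_bound[where B=1])
       (auto simp: h indicator_def)
  finally show ?thesis
    by (subst (asm) emeasure_eq_measure, subst (asm) ennreal_inj) (auto simp: h intro!: integral_nonneg_AE)
qed

end

section \<open>Contraction of the transition operator\<close>

context refresh_chain
begin

lemma expectation_avg_funpow:
  assumes "\<And>x. norm (u x) \<le> B"
  shows "mean \<pi> ((avg ^^ n) u) = mean \<pi> u"
  by (induction n) (use assms in \<open>auto simp: expectation_avg[OF avg_funpow_bounded[of u B]]\<close>)

lemma avg_funpow_nonneg:
  fixes u :: "'s \<Rightarrow> real"
  shows "(\<And>x. 0 \<le> u x) \<Longrightarrow> 0 \<le> (avg ^^ n) u x"
  by (induction n arbitrary: x) (auto simp: avg_def intro!: integral_nonneg_AE)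

lemma avg_funpow_sum:
  fixes h :: "'b \<Rightarrow> 's \<Rightarrow> real"
  assumes "finite Q" "\<And>B x. B \<in> Q \<Longrightarrow> \<bar>h B x\<bar> \<le> 1"
  shows "(avg ^^ n) (\<lambda>x. \<Sum>B\<in>Q. c B * h B x) y = (\<Sum>B\<in>Q. c B * (avg ^^ n) (h B) y)"
proof (induction n arbitrary: y)
  case (Suc n)
  have "(avg ^^ Suc n) (\<lambda>x. \<Sum>B\<in>Q. c B * h B x) y = avg (\<lambda>y. \<Sum>B\<in>Q. c B * (avg ^^ n) (h B) y) y"
    by (simp add: Suc.IH[abs_def])
  also have "\<dots> = (\<Sum>B\<in>Q. c B * avg ((avg ^^ n) (h B)) y)"
    unfolding avg_def[of "\<lambda>y. \<Sum>B\<in>Q. c B * (avg ^^ n) (h B) y"]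
    using assms avg_funpow_bounded[of "h _" 1 n]
    by (subst Bochner_Integration.integral_sum)
       (auto simp: avg_def intro!: integrable_mult_right integrable_pmf_bounded[of _ 1])
  finally show ?case by simp
qed simp

text \<open>The probability of a stationary start in a state slower than \<open>x\<close> that is not left within \<open>n\<close> steps.\<close>

definition tail :: "'s \<Rightarrow> nat \<Rightarrow> real" where
  "tail x n = mean \<pi> (\<lambda>y. indicator {y. p y < p x} y * (1 - p y) ^ n)"

text \<open>A bound for the memory of a start in \<open>x\<close> after \<open>n\<close> steps: either no refresh has occurred
yet, or a refresh has led to a slower state, where the chain may have remained since.\<close>

definition osc :: "nat \<Rightarrow> 's \<Rightarrow> real" where
  "osc n x = (1 - p x) ^ n + 4 * tail x n"

lemma survive_bounds: "0 \<le> (1 - p y) ^ n" "(1 - p y) ^ n \<le> 1"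
  using p_nonneg[of y] p_le_1[of y] by (auto intro!: power_le_one)

lemma tail_nonneg: "0 \<le> tail x n"
  unfolding tail_def by (intro integral_nonneg_AE) (auto simp: survive_bounds)

lemma tail_mono:
  assumes "p y \<le> p x" shows "tail y n \<le> tail x n"
  unfolding tail_def
  by (intro integral_mono integrable_pmf_bounded[of _ 1])
     (use survive_bounds assms in \<open>auto simp: indicator_def abs_mult\<close>)

lemma tail_le: "tail x n \<le> mean \<pi> (\<lambda>y. (1 - p y) ^ n)"
  unfolding tail_def
  by (intro integral_mono integrable_pmf_bounded[of _ 1])
     (use survive_bounds in \<open>auto simp: indicator_def abs_mult\<close>)

lemma tail_le_1: "tail x n \<le> 1"
proof -
  have "mean \<pi> (\<lambda>y. (1 - p y) ^ n) \<le> mean \<pi> (\<lambda>_. 1)"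
    by (intro integral_mono integrable_pmf_bounded[of _ 1]) (use survive_bounds in auto)
  then show ?thesis using tail_le[of x n] by simp
qed

lemma osc_nonneg: "0 \<le> osc n x"
  unfolding osc_def using survive_bounds tail_nonneg by simp

lemma osc_bounded: "\<bar>osc n x\<bar> \<le> 5"
  using osc_nonneg[of n x] survive_bounds[of x n] tail_le_1[of x n] by (simp add: osc_def)

end

text \<open>Refresh probabilities that differ do so by a factor of at least two, and most of the mass is on
states that are left at once. The latter makes it unlikely that a refresh leads to a slow state.\<close>

locale separated_refresh_chain = refresh_chain \<pi> p for \<pi> :: "'s pmf" and p +
  assumes halving: "p y < p x \<Longrightarrow> 2 * p y \<le> p x"
    and mostly_refreshing: "3 / 4 \<le> measure_pmf.prob \<pi> {s. p s = 1}"
begin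

lemma prob_slow_le: "measure_pmf.prob \<pi> {y. p y < p x} \<le> 1 / 4"
proof -
  have "measure_pmf.prob \<pi> {y. p y < p x} \<le> measure_pmf.prob \<pi> (- {s. p s = 1})"
    by (rule measure_pmf.finite_measure_mono) (use p_le_1[of x] in auto)
  also have "\<dots> = 1 - measure_pmf.prob \<pi> {s. p s = 1}"
    using measure_pmf.prob_compl[of "{s. p s = 1}" \<pi>] by (simp add: Compl_eq_Diff_UNIV)
  finally show ?thesis using mostly_refreshing by simp
qed

lemma rate_ge: "3 / 4 \<le> rate"
proof -
  have "measure_pmf.prob \<pi> {s. p s = 1} = mean \<pi> (indicator {s. p s = 1})"
    by simp
  also have "\<dots> \<le> rate"
    unfolding rate_def using p_nonneg
    by (intro integral_mono integrable_p integrable_pmf_bounded[of _ 1]) (auto simp: indicator_def)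
  finally show ?thesis using mostly_refreshing by simp
qed

text \<open>The recursion behind \<open>oscillation_bound\<close>: from \<open>x\<close>, either nothing happens or a refresh leads to a
slower state \<open>y\<close>. The latter is paid for by the gap between \<open>(1 - p(y))^n\<close> and
\<open>(1 - p(x))^n\<close>, since \<open>p(x) - p(y) \<ge> p(x) / 2\<close>; the factor \<open>4\<close> in \<open>osc\<close> is what makes this
come out.\<close>

lemma fresh_osc_le:
  "mean fresh (\<lambda>y. indicator {y. p y < p x} y * osc n y) + (1 - p x) * osc n x
    \<le> osc (Suc n) x"
proof -
  let ?I = "\<lambda>y. indicator {y. p y < p x} y :: real"
  define Z where "Z = mean \<pi> (\<lambda>y. p y * (?I y * (1 - p y) ^ n))"
  define a where "a = mean \<pi> (\<lambda>y. p y * ?I y)"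
  have int: "integrable \<pi> (\<lambda>y. p y * (?I y * (1 - p y) ^ n))" "integrable \<pi> (\<lambda>y. p y * ?I y)"
    "integrable \<pi> (\<lambda>y. ?I y * (1 - p y) ^ m)" for m
    using survive_bounds p_nonneg p_le_1
    by (auto intro!: integrable_pmf_bounded[of _ 1] simp: indicator_def abs_mult mult_le_one)
  have int4: "integrable \<pi> (\<lambda>y. p y * (?I y * osc n y))"
  proof (rule integrable_pmf_bounded[of _ 5])
    fix y
    have "p y * \<bar>osc n y\<bar> \<le> 1 * 5" by (intro mult_mono p_le_1 osc_bounded) auto
    then show "norm (p y * (?I y * osc n y)) \<le> 5"
      using p_nonneg[of y] by (auto simp: indicator_def abs_mult)
  qed
  have Z0: "0 \<le> Z" and a0: "0 \<le> a"
    unfolding Z_def a_def by (auto intro!: integral_nonneg_AE simp: p_nonneg survive_bounds)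
  have pw: "p y * ?I y \<le> (p x / 2) * ?I y" for y
    using halving[of y x] by (auto simp: indicator_def)
  have Z: "2 * Z \<le> p x * tail x n"
  proof -
    have "Z \<le> mean \<pi> (\<lambda>y. (p x / 2) * (?I y * (1 - p y) ^ n))"
      unfolding Z_def
    proof (intro integral_mono int integrable_mult_right)
      fix y
      show "p y * (?I y * (1 - p y) ^ n) \<le> (p x / 2) * (?I y * (1 - p y) ^ n)"
        using mult_right_mono[OF pw[of y] survive_bounds(1)[of y n]] by (simp add: mult.assoc)
    qed
    then show ?thesis by (simp add: tail_def)
  qed
  have a: "8 * a \<le> p x"
  proof -
    have "a \<le> mean \<pi> (\<lambda>y. (p x / 2) * ?I y)"
      unfolding a_def
      by (intro integral_mono int integrable_mult_right integrable_pmf_bounded[of _ 1] pw) (auto simp: indicator_def)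
    also have "\<dots> = (p x / 2) * measure_pmf.prob \<pi> {y. p y < p x}"
      by simp
    also have "\<dots> \<le> (p x / 2) * (1 / 4)" using prob_slow_le p_nonneg by (intro mult_left_mono) auto
    finally show ?thesis by simp
  qed
  have "mean fresh (\<lambda>y. ?I y * osc n y) = (1 / rate) * mean \<pi> (\<lambda>y. p y * (?I y * osc n y))"
    by (simp add: expectation_fresh)
  also have "\<dots> \<le> 2 * mean \<pi> (\<lambda>y. p y * (?I y * osc n y))"
    using rate_ge by (intro mult_right_mono integral_nonneg_AE) (auto simp: p_nonneg osc_nonneg field_simps)
  also have "mean \<pi> (\<lambda>y. p y * (?I y * osc n y))
     \<le> mean \<pi> (\<lambda>y. p y * (?I y * (1 - p y) ^ n) + 4 * tail x n * (p y * ?I y))"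
    by (intro integral_mono int int4 Bochner_Integration.integrable_add integrable_mult_right)
       (auto simp: indicator_def osc_def algebra_simps intro!: mult_left_mono tail_mono p_nonneg)
  also have "\<dots> = Z + 4 * tail x n * a"
    unfolding Z_def a_def by (subst Bochner_Integration.integral_add) (auto intro!: int integrable_mult_right)
  also have "\<dots> \<le> Z + tail x n * (p x / 2)"
    using mult_left_mono[OF a tail_nonneg[of x n]] by (simp add: algebra_simps)
  finally have R: "mean fresh (\<lambda>y. ?I y * osc n y) \<le> 2 * Z + tail x n * p x"
    by simp
  have "tail x n - Z = mean \<pi> (\<lambda>y. ?I y * (1 - p y) ^ n - p y * (?I y * (1 - p y) ^ n))"
    unfolding tail_def Z_def by (rule Bochner_Integration.integral_diff[symmetric]) (rule int)+
  also have "\<dots> = tail x (Suc n)"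
    unfolding tail_def by (intro Bochner_Integration.integral_cong) (auto simp: algebra_simps)
  finally have "tail x (Suc n) = tail x n - Z" by simp
  then show ?thesis using R Z by (simp add: osc_def algebra_simps)
qed

text \<open>If \<open>x\<close> is the slower state, then \<open>x'\<close> is refreshed with probability \<open>p(x) + (p(x') - p(x))\<close>, and the
part \<open>p(x)\<close> cancels against the refresh of \<open>x\<close>. What remains are the event that \<open>x'\<close> stays put,
when \<open>x\<close> may be taken to stay put too, and the event of probability \<open>p(x') - p(x)\<close> that only
\<open>x'\<close> is replaced by a fresh state. If that state is faster than \<open>x\<close>, the same bound applies
again; if it is slower, it takes over the role of \<open>x\<close>.\<close>

lemma oscillation_bound:
  fixes u :: "'s \<Rightarrow> real"
  assumes u: "\<And>x. \<bar>u x\<bar> \<le> 1" and "p x \<le> p x'"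
  shows "\<bar>(avg ^^ n) u x - (avg ^^ n) u x'\<bar> \<le> 2 * osc n x"
  using assms(2)
proof (induction n arbitrary: x x')
  case 0
  then show ?case using u[of x] u[of x'] tail_nonneg[of x 0] by (simp add: osc_def)
next
  case (Suc n)
  let ?I = "\<lambda>y. indicator {y. p y < p x} y :: real"
  define v where "v = (avg ^^ n) u"
  define R where "R = mean fresh (\<lambda>y. ?I y * osc n y)"
  have v: "\<bar>v y\<bar> \<le> 1" for y unfolding v_def using avg_funpow_bounded[of u 1] u by simp
  have R0: "0 \<le> R" unfolding R_def by (intro integral_nonneg_AE) (auto simp: osc_nonneg)
  have int: "integrable (measure_pmf fresh) (\<lambda>y. ?I y * osc n y)"
    using osc_bounded by (intro integrable_pmf_bounded[of _ 5]) (auto simp: indicator_def)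
  have intv: "integrable (measure_pmf fresh) v" by (rule integrable_pmf_bounded[of _ 1]) (use v in auto)
  have "\<bar>v x - mean fresh v\<bar> = \<bar>mean fresh (\<lambda>y. v x - v y)\<bar>"
    using intv by simp
  also have "\<dots> \<le> mean fresh (\<lambda>y. \<bar>v x - v y\<bar>)"
    using integral_abs_bound by blast
  also have "\<dots> \<le> mean fresh (\<lambda>y. 2 * osc n x + 2 * (?I y * osc n y))"
  proof (intro integral_mono)
    show "integrable (measure_pmf fresh) (\<lambda>y. \<bar>v x - v y\<bar>)" using intv by auto
    show "integrable (measure_pmf fresh) (\<lambda>y. 2 * osc n x + 2 * (?I y * osc n y))" using int by auto
    fix y
    show "\<bar>v x - v y\<bar> \<le> 2 * osc n x + 2 * (?I y * osc n y)"
    proof (cases "p y < p x")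
      case True
      then have "\<bar>v y - v x\<bar> \<le> 2 * osc n y" using Suc.IH[of y x] by (simp add: v_def)
      then show ?thesis using True osc_nonneg[of n x] by simp
    next
      case False
      then show ?thesis using Suc.IH[of x y] by (simp add: v_def)
    qed
  qed
  also have "\<dots> = 2 * osc n x + 2 * R"
    unfolding R_def using int by simp
  finally have *: "\<bar>v x - mean fresh v\<bar> \<le> 2 * osc n x + 2 * R" .
  have eq: "avg v y = (1 - p y) * v y + p y * mean fresh v" for y
    using avg_eq[of v 1 y] v by simp
  have "avg v x - avg v x' = (1 - p x') * (v x - v x') + (p x' - p x) * (v x - mean fresh v)"
    unfolding eq by (simp add: algebra_simps)
  also have "\<bar>\<dots>\<bar> \<le> (1 - p x') * \<bar>v x - v x'\<bar> + (p x' - p x) * \<bar>v x - mean fresh v\<bar>"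
    using p_le_1[of x'] Suc.prems by (intro order_trans[OF abs_triangle_ineq]) (simp add: abs_mult)
  also have "\<dots> \<le> (1 - p x') * (2 * osc n x) + (p x' - p x) * (2 * osc n x + 2 * R)"
    using Suc.IH[OF Suc.prems] * p_le_1[of x'] Suc.prems
    by (intro add_mono mult_left_mono) (auto simp: v_def)
  also have "\<dots> = 2 * ((1 - p x) * osc n x + (p x' - p x) * R)" by (simp add: algebra_simps)
  also have "\<dots> \<le> 2 * ((1 - p x) * osc n x + R)"
    using R0 p_le_1[of x'] p_nonneg[of x] mult_right_mono[of "p x' - p x" 1 R] by simp
  also have "\<dots> \<le> 2 * osc (Suc n) x" using fresh_osc_le[of x n] by (simp add: R_def)
  finally show ?case by (simp add: v_def)
qed

text \<open>Integration of the other starting point with respect to the stationary law.\<close>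

lemma mixing_bound:
  fixes u :: "'s \<Rightarrow> real"
  assumes u: "\<And>x. \<bar>u x\<bar> \<le> 1"
  shows "\<bar>(avg ^^ n) u x - mean \<pi> u\<bar> \<le> 2 * osc n x + 2 * mean \<pi> (osc n)"
proof -
  define v where "v = (avg ^^ n) u"
  have v: "\<bar>v y\<bar> \<le> 1" for y unfolding v_def using avg_funpow_bounded[of u 1] u by simp
  have int: "integrable (measure_pmf \<pi>) (osc n)"
    using osc_bounded by (intro integrable_pmf_bounded[of _ 5]) auto
  have intv: "integrable (measure_pmf \<pi>) v" by (rule integrable_pmf_bounded[of _ 1]) (use v in auto)
  have ob: "\<bar>v a - v b\<bar> \<le> 2 * osc n a" if "p a \<le> p b" for a b
    unfolding v_def by (rule oscillation_bound) (use u that in auto)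
  have "\<bar>v x - mean \<pi> v\<bar> = \<bar>mean \<pi> (\<lambda>y. v x - v y)\<bar>"
    using intv by simp
  also have "\<dots> \<le> mean \<pi> (\<lambda>y. \<bar>v x - v y\<bar>)"
    using integral_abs_bound by blast
  also have "\<dots> \<le> mean \<pi> (\<lambda>y. 2 * osc n x + 2 * osc n y)"
  proof (intro integral_mono)
    show "integrable (measure_pmf \<pi>) (\<lambda>y. \<bar>v x - v y\<bar>)" using intv by auto
    show "integrable (measure_pmf \<pi>) (\<lambda>y. 2 * osc n x + 2 * osc n y)" using int by auto
    fix y
    show "\<bar>v x - v y\<bar> \<le> 2 * osc n x + 2 * osc n y"
      using ob[of x y] ob[of y x] osc_nonneg[of n x] osc_nonneg[of n y]
      by (cases "p x \<le> p y") auto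
  qed
  also have "\<dots> = 2 * osc n x + 2 * mean \<pi> (osc n)"
    using int by simp
  finally show ?thesis using expectation_avg_funpow[of u 1 n] u by (simp add: v_def)
qed

lemma expectation_osc_le: "mean \<pi> (osc n) \<le> 5 * mean \<pi> (\<lambda>y. (1 - p y) ^ n)"
proof -
  let ?s = "mean \<pi> (\<lambda>y. (1 - p y) ^ n)"
  have int: "integrable (measure_pmf \<pi>) (\<lambda>y. (1 - p y) ^ n)"
    using survive_bounds by (intro integrable_pmf_bounded[of _ 1]) auto
  have "mean \<pi> (osc n) \<le> mean \<pi> (\<lambda>y. (1 - p y) ^ n + 4 * ?s)"
    using osc_bounded int tail_le
    by (intro integral_mono integrable_pmf_bounded[of "osc n" 5]) (auto simp: osc_def)
  also have "\<dots> = 5 * ?s" using int by simp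
  finally show ?thesis .
qed

end

section \<open>Stationarity, reversibility and the Markov property\<close>

context refresh_process
begin

lemma state_function_measurable: "(\<lambda>\<omega>. f (Y k \<omega>)) \<in> borel_measurable M"
  by (rule measurable_compose[OF Y_measurable]) simp

lemma ex_bound_int_set: "finite J \<Longrightarrow> \<exists>N. \<forall>j\<in>J. \<bar>j\<bar> \<le> int N"
proof (induction J rule: finite_induct)
  case (insert x J)
  then obtain N where "\<forall>j\<in>J. \<bar>j\<bar> \<le> int N" by blast
  then show ?case by (intro exI[of _ "max N (nat \<bar>x\<bar>)"]) auto
qed auto

lemma prob_cylinder_shift:
  assumes "\<And>j. j \<in> J \<Longrightarrow> \<bar>j\<bar> \<le> int N"
  shows "prob {\<omega> \<in> space M. \<forall>j\<in>J. Y (j + h) \<omega> \<in> A j}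
    = measure_pmf.prob (history (2 * N)) {l. \<forall>j\<in>J. l ! nat (int N - j) \<in> A j}"
proof -
  have "window Y (h - int N) (2 * N) \<omega> ! nat (int N - j) = Y (j + h) \<omega>" if "j \<in> J" for j \<omega>
    using assms[OF that] by (subst nth_window) (auto simp: add.commute)
  then have "{\<omega> \<in> space M. \<forall>j\<in>J. Y (j + h) \<omega> \<in> A j}
     = {\<omega> \<in> space M. window Y (h - int N) (2 * N) \<omega> \<in> {l. \<forall>j\<in>J. l ! nat (int N - j) \<in> A j}}"
    by auto
  then show ?thesis by (simp only: prob_window)
qed

text \<open>Reflection of time at \<open>0\<close> reverses the window from \<open>-N\<close> to \<open>N\<close>, whose law is
invariant under list reversal.\<close>

lemma prob_cylinder_reverse:
  assumes "finite J"
  shows "prob {\<omega> \<in> space M. \<forall>j\<in>J. Y (- j) \<omega> \<in> A j} = prob {\<omega> \<in> space M. \<forall>j\<in>J. Y j \<omega> \<in> A j}"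
proof -
  obtain N where N: "\<And>j. j \<in> J \<Longrightarrow> \<bar>j\<bar> \<le> int N" using ex_bound_int_set[OF assms] by auto
  have "prob {\<omega> \<in> space M. \<forall>j\<in>J. Y (- j) \<omega> \<in> A j} = prob {\<omega> \<in> space M. \<forall>j\<in>uminus ` J. Y (j + 0) \<omega> \<in> A (- j)}"
    by simp
  also have "\<dots> = measure_pmf.prob (history (2 * N)) {l. \<forall>j\<in>uminus ` J. l ! nat (int N - j) \<in> A (- j)}"
    by (rule prob_cylinder_shift) (use N in auto)
  also have "\<dots> = measure_pmf.prob (map_pmf rev (history (2 * N))) {l. \<forall>j\<in>J. l ! nat (int N + j) \<in> A j}"
    by (simp add: map_rev_history)
  also have "\<dots> = measure_pmf.prob (history (2 * N)) {l. \<forall>j\<in>J. rev l ! nat (int N + j) \<in> A j}"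
    by (simp add: vimage_def)
  also have "\<dots> = measure_pmf.prob (history (2 * N)) {l. \<forall>j\<in>J. l ! nat (int N - j) \<in> A j}"
  proof (rule measure_pmf.finite_measure_eq_AE)
    show "AE l in measure_pmf (history (2 * N)). (l \<in> {l. \<forall>j\<in>J. rev l ! nat (int N + j) \<in> A j})
       = (l \<in> {l. \<forall>j\<in>J. l ! nat (int N - j) \<in> A j})"
    proof (unfold AE_measure_pmf_iff, rule ballI)
      fix l assume "l \<in> set_pmf (history (2 * N))"
      then have l: "length l = Suc (2 * N)" by (rule length_history)
      have "rev l ! nat (int N + j) = l ! nat (int N - j)" if "j \<in> J" for j
      proof -
        have "rev l ! nat (int N + j) = l ! (length l - Suc (nat (int N + j)))"
          using l N[OF that] by (intro rev_nth) auto
        also have "length l - Suc (nat (int N + j)) = nat (int N - j)" using l N[OF that] by auto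
        finally show ?thesis .
      qed
      then show "(l \<in> {l. \<forall>j\<in>J. rev l ! nat (int N + j) \<in> A j}) = (l \<in> {l. \<forall>j\<in>J. l ! nat (int N - j) \<in> A j})"
        by auto
    qed
  qed auto
  also have "\<dots> = prob {\<omega> \<in> space M. \<forall>j\<in>J. Y (j + 0) \<omega> \<in> A j}"
    by (rule prob_cylinder_shift[symmetric]) (use N in auto)
  finally show ?thesis by simp
qed

lemma process_law_eqI:
  fixes g g' :: "int \<Rightarrow> int" and f :: "'s \<Rightarrow> real"
  assumes "\<And>J A. finite J \<Longrightarrow> prob {\<omega> \<in> space M. \<forall>j\<in>J. Y (g j) \<omega> \<in> A j} = prob {\<omega> \<in> space M. \<forall>j\<in>J. Y (g' j) \<omega> \<in> A j}"
  shows "process_law M (\<lambda>k \<omega>. f (Y (g k) \<omega>)) = process_law M (\<lambda>k \<omega>. f (Y (g' k) \<omega>))"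
proof (rule measure_eqI_PiM_infinite)
  have m: "(\<lambda>\<omega> k. f (Y (g k) \<omega>)) \<in> M \<rightarrow>\<^sub>M (\<Pi>\<^sub>M k\<in>UNIV. borel)" for g :: "int \<Rightarrow> int"
    by (rule measurable_PiM_single') (simp_all add: state_function_measurable)
  show "sets (process_law M (\<lambda>k \<omega>. f (Y (g k) \<omega>))) = sets (\<Pi>\<^sub>M k\<in>UNIV. borel)"
    "sets (process_law M (\<lambda>k \<omega>. f (Y (g' k) \<omega>))) = sets (\<Pi>\<^sub>M k\<in>UNIV. borel)"
    by (simp_all add: process_law_def)
  show "finite_measure (process_law M (\<lambda>k \<omega>. f (Y (g k) \<omega>)))"
    unfolding process_law_def by (rule finite_measure_distr[OF m])
  fix A :: "int \<Rightarrow> real set" and J :: "int set"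
  assume J: "finite J" and A: "\<And>i. i \<in> J \<Longrightarrow> A i \<in> sets borel"
  have C: "prod_emb UNIV (\<lambda>_. borel) J (Pi\<^sub>E J A) \<in> sets (\<Pi>\<^sub>M k\<in>UNIV. borel)"
    using J A by (intro sets_PiM_I) auto
  have "emeasure (process_law M (\<lambda>k \<omega>. f (Y (g k) \<omega>))) (prod_emb UNIV (\<lambda>_. borel) J (Pi\<^sub>E J A))
     = prob {\<omega> \<in> space M. \<forall>j\<in>J. Y (g j) \<omega> \<in> f -` A j}" for g
  proof -
    have "(\<lambda>\<omega> k. f (Y (g k) \<omega>)) -` prod_emb UNIV (\<lambda>_. borel) J (Pi\<^sub>E J A) \<inter> space M
       = {\<omega> \<in> space M. \<forall>j\<in>J. Y (g j) \<omega> \<in> f -` A j}"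
      by (auto simp: prod_emb_def PiE_iff)
    then show ?thesis
      unfolding process_law_def by (simp only: emeasure_distr[OF m C] emeasure_eq_measure)
  qed
  then show "emeasure (process_law M (\<lambda>k \<omega>. f (Y (g k) \<omega>))) (prod_emb UNIV (\<lambda>_. borel) J (Pi\<^sub>E J A))
     = emeasure (process_law M (\<lambda>k \<omega>. f (Y (g' k) \<omega>))) (prod_emb UNIV (\<lambda>_. borel) J (Pi\<^sub>E J A))"
    using assms[OF J, of "\<lambda>j. f -` A j"] by simp
qed

theorem stationary: "strictly_stationary M (\<lambda>k \<omega>. f (Y k \<omega>))"
  unfolding strictly_stationary_def
proof
  fix h
  show "process_law M (\<lambda>k \<omega>. f (Y (k + h) \<omega>)) = process_law M (\<lambda>k \<omega>. f (Y k \<omega>))"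
  proof (rule process_law_eqI)
    fix J :: "int set" and A :: "int \<Rightarrow> 's set" assume "finite J"
    then obtain N where N: "\<And>j. j \<in> J \<Longrightarrow> \<bar>j\<bar> \<le> int N" using ex_bound_int_set by meson
    show "prob {\<omega> \<in> space M. \<forall>j\<in>J. Y (j + h) \<omega> \<in> A j} = prob {\<omega> \<in> space M. \<forall>j\<in>J. Y j \<omega> \<in> A j}"
      using prob_cylinder_shift[OF N, of J h A] prob_cylinder_shift[OF N, of J 0 A] by simp
  qed
qed

theorem time_reversible: "reversible M (\<lambda>k \<omega>. f (Y k \<omega>))"
  unfolding reversible_def by (rule process_law_eqI) (rule prob_cylinder_reverse)

lemma sets_generated_sigma_past:
  assumes "I \<subseteq> {..c}"
  shows "sets (generated_sigma M (\<lambda>k \<omega>. f (Y k \<omega>)) I) \<subseteq> sigma_sets (space M) (past c)"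
  unfolding generated_sigma_def
proof (subst sets_measure_of, safe)
  fix A assume "A \<in> sigma_sets (space M) {(\<lambda>\<omega>. f (Y i \<omega>)) -` B \<inter> space M |i B. i \<in> I \<and> B \<in> sets borel}"
  then show "A \<in> sigma_sets (space M) (past c)"
  proof (rule sigma_sets_mono[THEN subsetD, rotated], safe)
    fix i B assume i: "i \<in> I"
    then have "i \<le> c" using assms by auto
    then have "(\<lambda>\<omega>. f (Y i \<omega>)) -` B \<inter> space M
       = {\<omega> \<in> space M. window Y (c - int (nat (c - i))) (nat (c - i)) \<omega> \<in> {l. f (last l) \<in> B}}"
      by (auto simp: last_window)
    also have "\<dots> \<in> past c" unfolding past_def by blast
    finally show "(\<lambda>\<omega>. f (Y i \<omega>)) -` B \<inter> space M \<in> sigma_sets (space M) (past c)" by (rule sigma_sets.Basic)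
  qed
qed

lemma sets_generated_sigma_future:
  assumes "I \<subseteq> {c..}"
  shows "sets (generated_sigma M (\<lambda>k \<omega>. f (Y k \<omega>)) I) \<subseteq> sigma_sets (space M) (future c)"
  unfolding generated_sigma_def
proof (subst sets_measure_of, safe)
  fix A assume "A \<in> sigma_sets (space M) {(\<lambda>\<omega>. f (Y i \<omega>)) -` B \<inter> space M |i B. i \<in> I \<and> B \<in> sets borel}"
  then show "A \<in> sigma_sets (space M) (future c)"
  proof (rule sigma_sets_mono[THEN subsetD, rotated], safe)
    fix i B assume i: "i \<in> I"
    then have "c \<le> i" using assms by auto
    then have "(\<lambda>\<omega>. f (Y i \<omega>)) -` B \<inter> space M
       = {\<omega> \<in> space M. window Y c (nat (i - c)) \<omega> \<in> {l. f (hd l) \<in> B}}"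
      by (auto simp: hd_window)
    also have "\<dots> \<in> future c" unfolding future_def by blast
    finally show "(\<lambda>\<omega>. f (Y i \<omega>)) -` B \<inter> space M \<in> sigma_sets (space M) (future c)" by (rule sigma_sets.Basic)
  qed
qed

lemma sigma_past_events: "sigma_sets (space M) (past c) \<subseteq> events"
  and sigma_future_events: "sigma_sets (space M) (future c) \<subseteq> events"
  using sets.sigma_sets_subset[OF past_future_events(1)[of c]] sets.sigma_sets_subset[OF past_future_events(2)[of c]] by auto

text \<open>A function \<open>h\<close> with \<open>P(D \<inter> {Y\<^sub>c = y}) = h(y) \<pi>(y)\<close> is a version of the conditional probability of
the future event \<open>D\<close> given the whole past.\<close>

lemma prob_past_future:
  assumes A: "A \<in> sigma_sets (space M) (past c)" and D: "D \<in> sigma_sets (space M) (future c)"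
    and h: "\<And>y. 0 \<le> h y" "\<And>y. h y \<le> 1"
    and eq: "\<And>y. prob (D \<inter> {\<omega> \<in> space M. Y c \<omega> = y}) = h y * pmf \<pi> y"
  shows "prob (A \<inter> D) = expectation (\<lambda>\<omega>. indicator A \<omega> * h (Y c \<omega>))"
proof (rule prob_Int_eq_expectation[OF _ _ h])
  show "A \<in> events" "D \<in> events" using A D sigma_past_events sigma_future_events by auto
  fix y
  show "prob (A \<inter> D \<inter> {\<omega> \<in> space M. Y c \<omega> = y}) = h y * prob (A \<inter> {\<omega> \<in> space M. Y c \<omega> = y})"
  proof (cases "pmf \<pi> y = 0")
    case True
    then have "prob {\<omega> \<in> space M. Y c \<omega> = y} = 0" by (simp add: prob_state_single)
    then have "prob (S \<inter> {\<omega> \<in> space M. Y c \<omega> = y}) = 0" for S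
      using finite_measure_mono[of "S \<inter> {\<omega> \<in> space M. Y c \<omega> = y}" "{\<omega> \<in> space M. Y c \<omega> = y}"]
      by (simp add: measure_le_0_iff)
    then show ?thesis by simp
  next
    case False
    then show ?thesis using cond_indep_past_future[OF A D, of y] by (simp add: eq)
  qed
qed

text \<open>Both conditional probabilities are \<open>h(Y\<^sub>k)\<close>, where \<open>h(y)\<close> is the probability that a step from \<open>y\<close>
leads into \<open>f -` B\<close>. Injectivity of \<open>f\<close> makes \<open>Y\<^sub>k\<close> measurable with respect to \<open>f(Y\<^sub>k)\<close>.\<close>

theorem markov:
  fixes f :: "'s \<Rightarrow> real"
  assumes "inj f"
  shows "countable_state_markov_chain M (\<lambda>k \<omega>. f (Y k \<omega>))"
  unfolding countable_state_markov_chain_def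
proof (intro conjI allI)
  let ?X = "\<lambda>k \<omega>. f (Y k \<omega>)"
  show "?X k \<in> borel_measurable M" for k by (rule state_function_measurable)
  show "\<exists>S. countable S \<and> (\<forall>k. ?X k \<in> space M \<rightarrow> S)"
    by (intro exI[of _ "range f"]) auto
  show "markov_property M ?X"
    unfolding markov_property_def
  proof (intro allI ballI)
    fix k and B :: "real set" assume B: "B \<in> sets borel"
    define D where "D = {\<omega> \<in> space M. ?X (k + 1) \<omega> \<in> B}"
    define h where "h y = measure_pmf.prob (step y) (f -` B)" for y
    have D: "D \<in> sigma_sets (space M) (future k)"
    proof -
      have "D = {\<omega> \<in> space M. window Y k 1 \<omega> \<in> {l. f (hd l) \<in> B}}" by (auto simp: D_def hd_window)
      also have "\<dots> \<in> future k" unfolding future_def by blast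
      finally show ?thesis by (rule sigma_sets.Basic)
    qed
    have D_ev[measurable]: "D \<in> events" using D sigma_future_events by auto
    have h: "0 \<le> h y" "h y \<le> 1" for y by (auto simp: h_def)
    have eq: "prob (D \<inter> {\<omega> \<in> space M. Y k \<omega> = y}) = h y * pmf \<pi> y" for y
    proof -
      have "D \<inter> {\<omega> \<in> space M. Y k \<omega> = y} = {\<omega> \<in> space M. window Y k 1 \<omega> \<in> {l. last l = y \<and> f (hd l) \<in> B}}"
        by (auto simp: D_def hd_window last_window)
      then have "prob (D \<inter> {\<omega> \<in> space M. Y k \<omega> = y}) = mean (history 1) (indicator {l. last l = y \<and> f (hd l) \<in> B})"
        by (simp only: prob_window) simp
      also have "\<dots> = mean (history 1) (\<lambda>l. indicator {y} (last l) * indicator (f -` B) (hd l))"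
        by (intro Bochner_Integration.integral_cong) (auto simp: indicator_def)
      also have "\<dots> = pmf \<pi> y * (avg ^^ 1) (indicator (f -` B)) y"
        by (rule expectation_history_last_hd[of _ 1]) (auto simp: indicator_def)
      finally show ?thesis by (simp add: avg_def h_def)
    qed
    have ce: "AE \<omega> in M. real_cond_exp M (generated_sigma M ?X I) (indicator D) \<omega> = h (Y k \<omega>)"
      if I: "I \<subseteq> {..k}" "k \<in> I" for I
    proof -
      let ?F = "generated_sigma M ?X I"
      have sp: "space ?F = space M" by (simp add: generated_sigma_def space_measure_of_conv)
      have sub: "sets ?F \<subseteq> sigma_sets (space M) (past k)" by (rule sets_generated_sigma_past[OF I(1)])
      interpret finite_measure_subalgebra M ?F
        by unfold_locales (use sp sub sigma_past_events in \<open>auto simp: subalgebra_def\<close>)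
      have Ym: "Y k \<in> ?F \<rightarrow>\<^sub>M count_space UNIV"
      proof (subst measurable_count_space_eq2_countable, safe)
        fix y
        have "Y k -` {y} \<inter> space ?F = ?X k -` {f y} \<inter> space M"
          using assms by (auto simp: sp dest: injD)
        also have "\<dots> \<in> sets ?F"
          unfolding generated_sigma_def using I(2)
            by (subst sets_measure_of) (auto intro!: sigma_sets.Basic exI[of _ k] exI[of _ "{f y}"])
        finally show "Y k -` {y} \<inter> space ?F \<in> sets ?F" .
      qed auto
      show ?thesis
      proof (rule real_cond_exp_charact)
        fix A assume A: "A \<in> sets ?F"
        then have A': "A \<in> sigma_sets (space M) (past k)" "A \<in> events" using sub sigma_past_events by auto
        have "(\<integral>\<omega>\<in>A. indicat_real D \<omega> \<partial>M) = expectation (\<lambda>\<omega>. indicator (A \<inter> D) \<omega>)"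
          by (auto simp: set_lebesgue_integral_def indicator_def intro!: Bochner_Integration.integral_cong)
        also have "\<dots> = prob (A \<inter> D)" using A' by simp
        also have "\<dots> = expectation (\<lambda>\<omega>. indicator A \<omega> * h (Y k \<omega>))"
          by (rule prob_past_future[OF A'(1) D h eq])
        finally show "(\<integral>\<omega>\<in>A. indicat_real D \<omega> \<partial>M) = (\<integral>\<omega>\<in>A. h (Y k \<omega>) \<partial>M)"
          by (simp add: set_lebesgue_integral_def)
      next
        show "integrable M (indicat_real D)" by (rule integrable_const_bound[of _ 1]) auto
        show "integrable M (\<lambda>\<omega>. h (Y k \<omega>))"
          by (rule integrable_const_bound[of _ 1]) (use h state_function_measurable in auto)
        show "(\<lambda>\<omega>. h (Y k \<omega>)) \<in> borel_measurable ?F"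
          by (rule measurable_compose[OF Ym]) simp
      qed
    qed
    show "AE \<omega> in M. real_cond_exp M (generated_sigma M ?X {..k}) (indicator {\<omega> \<in> space M. ?X (k + 1) \<omega> \<in> B}) \<omega>
       = real_cond_exp M (generated_sigma M ?X {k}) (indicator {\<omega> \<in> space M. ?X (k + 1) \<omega> \<in> B}) \<omega>"
      using ce[of "{..k}"] ce[of "{k}"] unfolding D_def[symmetric] by fastforce
  qed
qed

end

section \<open>Dependence coefficients\<close>

text \<open>The partitions of the space into \<open>A\<close>, \<open>B\<close> and their complements have four equal summands
\<open>\<bar>P(A \<inter> B) - P(A) P(B)\<bar>\<close>, so that \<open>\<beta>\<close> is in fact at least \<open>2 \<alpha>\<close>. The empty set and the
whole space give no such partition, but a vanishing difference. The bound \<open>K\<close>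
serves to make the supremum in \<open>\<beta>\<close> a genuine one.\<close>

lemma (in prob_space) alpha_coeff_le_beta_coeff:
  assumes sub: "sets \<A> \<subseteq> events" "sets \<B> \<subseteq> events" "space \<A> = space M" "space \<B> = space M"
    and bdd: "\<And>P Q. finite P \<Longrightarrow> partition_on (space M) P \<Longrightarrow> P \<subseteq> sets \<A> \<Longrightarrow>
      finite Q \<Longrightarrow> partition_on (space M) Q \<Longrightarrow> Q \<subseteq> sets \<B> \<Longrightarrow>
      1 / 2 * (\<Sum>A\<in>P. \<Sum>B\<in>Q. \<bar>prob (A \<inter> B) - prob A * prob B\<bar>) \<le> K"
  shows "alpha_coeff M \<A> \<B> \<le> beta_coeff M \<A> \<B>" "beta_coeff M \<A> \<B> \<le> K"
proof -
  define T where "T = {1 / 2 * (\<Sum>A\<in>P. \<Sum>B\<in>Q. \<bar>prob (A \<inter> B) - prob A * prob B\<bar>) | P Q.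
            finite P \<and> partition_on (space M) P \<and> P \<subseteq> sets \<A> \<and>
            finite Q \<and> partition_on (space M) Q \<and> Q \<subseteq> sets \<B>}"
  have T: "beta_coeff M \<A> \<B> = Sup T" unfolding beta_coeff_def T_def ..
  have Tbdd: "bdd_above T" unfolding T_def bdd_above_def using bdd by blast
  have split: "finite {C, space M - C} \<and> partition_on (space M) {C, space M - C}"
    if "C \<in> events" "C \<noteq> {}" "C \<noteq> space M" for C
    using that sets.sets_into_space[OF that(1)] by (auto simp: partition_on_def disjoint_def)
  have triv: "finite {space M} \<and> partition_on (space M) {space M}"
    using not_empty by (auto simp: partition_on_def)
  have "1 / 2 * (\<Sum>A\<in>{space M}. \<Sum>B\<in>{space M}. \<bar>prob (A \<inter> B) - prob A * prob B\<bar>) \<in> T"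
    unfolding T_def mem_Collect_eq
    by (intro exI[of _ "{space M}"] conjI refl) (use triv sub(3,4) sets.top[of \<A>] sets.top[of \<B>] in auto)
  then have T0: "0 \<in> T" by (simp add: prob_space)
  show "beta_coeff M \<A> \<B> \<le> K"
    unfolding T
  proof (rule cSup_least)
    show "T \<noteq> {}" using T0 by auto
    show "x \<le> K" if "x \<in> T" for x using that bdd unfolding T_def by blast
  qed
  have Sup0: "0 \<le> Sup T" using cSup_upper[OF T0 Tbdd] .
  show "alpha_coeff M \<A> \<B> \<le> beta_coeff M \<A> \<B>"
    unfolding alpha_coeff_def T
  proof (rule cSup_least, blast, safe)
    fix A B assume AB: "A \<in> sets \<A>" "B \<in> sets \<B>"
    then have ev[measurable]: "A \<in> events" "B \<in> events" using sub by auto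
    let ?d = "\<lambda>A B. \<bar>prob (A \<inter> B) - prob A * prob B\<bar>"
    show "?d A B \<le> Sup T"
    proof (cases "A = {} \<or> A = space M \<or> B = {} \<or> B = space M")
      case True
      then have "?d A B = 0" using sets.sets_into_space[OF ev(1)] sets.sets_into_space[OF ev(2)]
        by (auto simp: prob_space Int_absorb1 Int_absorb2)
      then show ?thesis using Sup0 by simp
    next
      case False
      have compl_right: "?d A (space M - B) = ?d A B" if [measurable]: "A \<in> events" "B \<in> events" for A B
      proof -
        have "prob (A \<inter> (space M - B)) = prob A - prob (A \<inter> B)"
        proof -
          have "A \<inter> (space M - B) = A - A \<inter> B" using sets.sets_into_space[OF that(1)] by auto
          then show ?thesis by (simp add: finite_measure_Diff)
        qed
        then show ?thesis by (simp add: prob_compl algebra_simps)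
      qed
      have compl_left: "?d (space M - A) B = ?d A B" if "A \<in> events" "B \<in> events" for A B
        using compl_right[OF that(2,1)] by (simp add: Int_commute mult.commute)
      have neq: "A \<noteq> space M - A" "B \<noteq> space M - B" using False by blast+
      have "1 / 2 * (\<Sum>A\<in>{A, space M - A}. \<Sum>B\<in>{B, space M - B}. ?d A B) \<in> T"
        unfolding T_def mem_Collect_eq
        by (intro exI[of _ "{A, space M - A}"] exI[of _ "{B, space M - B}"] conjI refl)
           (use split[OF ev(1)] split[OF ev(2)] False AB sub(3,4) sets.compl_sets[OF AB(1)] sets.compl_sets[OF AB(2)] in simp_all)
      moreover have "(\<Sum>A\<in>{A, space M - A}. \<Sum>B\<in>{B, space M - B}. ?d A B) = 4 * ?d A B"
        using neq by (simp add: compl_right compl_left)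
      ultimately have "2 * ?d A B \<in> T" by simp
      then have "2 * ?d A B \<le> Sup T" by (rule cSup_upper[OF _ Tbdd])
      have "?d A B \<le> 2 * ?d A B" by simp
      then show ?thesis using \<open>2 * ?d A B \<le> Sup T\<close> by (rule order_trans)
    qed
  qed
qed

locale separated_refresh_process = refresh_process \<pi> p M Y + separated_refresh_chain \<pi> p
  for \<pi> :: "'s::countable pmf" and p and M :: "'a measure" and Y
begin

text \<open>With the signs \<open>\<epsilon>\<close> of the differences and the conditional probabilities \<open>h\<^sub>B\<close> of \<open>B\<close> given \<open>Y\<^sub>n\<close>, the
row of \<open>A\<close> is the integral over \<open>A\<close> of \<open>(P^n u)(Y\<^sub>0) - \<pi>(u)\<close>, where \<open>u = (\<Sum>B. \<epsilon>\<^sub>B h\<^sub>B)\<close>. Since the \<open>h\<^sub>B\<close>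
are nonnegative with sum at most \<open>1\<close>, \<open>u\<close> is bounded by \<open>1\<close> and \<open>mixing_bound\<close> applies. The
signs have disappeared from the resulting bound for the integrand, so the integrals over the cells
\<open>A\<close> add up to one over the whole space.\<close>

lemma partition_sum_le:
  assumes P: "finite P" "partition_on (space M) P" "P \<subseteq> sigma_sets (space M) (past 0)"
    and Q: "finite Q" "partition_on (space M) Q" "Q \<subseteq> sigma_sets (space M) (future (int n))"
      "Q \<subseteq> sigma_sets (space M) (future 0)"
  shows "(\<Sum>A\<in>P. \<Sum>B\<in>Q. \<bar>prob (A \<inter> B) - prob A * prob B\<bar>) \<le> 20 * mean \<pi> (\<lambda>y. (1 - p y) ^ n)"
proof -
  define E where "E k y = {\<omega> \<in> space M. Y k \<omega> = y}" for k y
  have E[measurable]: "E k y \<in> events" for k y by (simp add: E_def)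
  have Qev: "B \<in> events" if "B \<in> Q" for B using that Q(3) sigma_future_events by auto
  have Pev: "A \<in> events" if "A \<in> P" for A using that P(3) sigma_past_events by auto
  have Qdisj: "B \<inter> B' = {}" if "B \<in> Q" "B' \<in> Q" "B \<noteq> B'" for B B'
    using partition_onD2[OF Q(2)] that by (auto simp: disjoint_def)
  have Pdisj: "disjoint_family_on (\<lambda>A. A) P"
    unfolding disjoint_family_on_def using partition_onD2[OF P(2)] unfolding disjoint_def by blast
  define h where "h B y = prob (B \<inter> E (int n) y) / pmf \<pi> y" for B y
  have h0: "0 \<le> h B y" for B y by (simp add: h_def)
  have hsum: "(\<Sum>B\<in>Q. h B y) \<le> 1" for y
  proof (cases "pmf \<pi> y = 0")
    case False
    have "(\<Sum>B\<in>Q. prob (B \<inter> E (int n) y)) = prob (\<Union>B\<in>Q. B \<inter> E (int n) y)"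
    proof (rule finite_measure_finite_Union[symmetric])
      show "disjoint_family_on (\<lambda>B. B \<inter> E (int n) y) Q"
        unfolding disjoint_family_on_def using Qdisj by blast
    qed (use Q(1) Qev in auto)
    also have "\<dots> \<le> prob (E (int n) y)" by (rule finite_measure_mono) auto
    finally show ?thesis using False
      by (simp add: h_def sum_divide_distrib[symmetric] E_def prob_state_single)
  qed (simp add: h_def)
  have h1: "h B y \<le> 1" if "B \<in> Q" for B y
  proof -
    have "h B y \<le> (\<Sum>B\<in>Q. h B y)" by (rule member_le_sum[OF that]) (use h0 Q(1) in auto)
    then show ?thesis using hsum[of y] by linarith
  qed
  have habs: "\<bar>h B y\<bar> \<le> 1" if "B \<in> Q" for B y using h0 h1[OF that] by simp
  define g where "g B = (avg ^^ n) (h B)" for B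
  have g0: "0 \<le> g B y" for B y unfolding g_def by (rule avg_funpow_nonneg) (rule h0)
  have gabs: "\<bar>g B y\<bar> \<le> 1" if "B \<in> Q" for B y
    unfolding g_def using avg_funpow_bounded[of "h B" 1 n y] habs[OF that] by simp
  have g1: "g B y \<le> 1" if "B \<in> Q" for B y using gabs[OF that, of y] by simp
  have hE: "prob (B \<inter> E (int n) y) = h B y * pmf \<pi> y" for B y
  proof (cases "pmf \<pi> y = 0")
    case True
    then show ?thesis using finite_measure_mono[of "B \<inter> E (int n) y" "E (int n) y"]
      by (simp add: E_def prob_state_single measure_le_0_iff)
  qed (simp add: h_def)
  have pastn: "E 0 y \<in> sigma_sets (space M) (past (int n))" for y
  proof -
    have "E 0 y = {\<omega> \<in> space M. window Y (int n - int n) n \<omega> \<in> {l. last l = y}}"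
      by (auto simp: E_def last_window)
    also have "\<dots> \<in> past (int n)" unfolding past_def by blast
    finally show ?thesis by (rule sigma_sets.Basic)
  qed
  have gE: "prob (B \<inter> E 0 y) = g B y * pmf \<pi> y" if B: "B \<in> Q" for B y
  proof -
    have "prob (E 0 y \<inter> B) = expectation (\<lambda>\<omega>. indicator (E 0 y) \<omega> * h B (Y (int n) \<omega>))"
      by (rule prob_past_future[OF pastn _ h0 h1[OF B]]) (use B Q(3) hE in \<open>auto simp: E_def\<close>)
    also have "\<dots> = expectation (\<lambda>\<omega>. (\<lambda>l. indicator {y} (last l) * h B (hd l)) (window Y 0 n \<omega>))"
      by (intro Bochner_Integration.integral_cong) (auto simp: hd_window last_window E_def indicator_def)
    also have "\<dots> = mean (history n) (\<lambda>l. indicator {y} (last l) * h B (hd l))"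
      by (rule expectation_window)
    also have "\<dots> = pmf \<pi> y * g B y"
      unfolding g_def by (rule expectation_history_last_hd[of _ 1]) (rule habs[OF B])
    finally show ?thesis by (simp add: Int_commute mult.commute)
  qed
  have joint: "prob (A \<inter> B) = expectation (\<lambda>\<omega>. indicator A \<omega> * g B (Y 0 \<omega>))" if "A \<in> P" "B \<in> Q" for A B
    by (rule prob_past_future[OF _ _ g0 g1[OF that(2)]]) (use that P(3) Q(4) gE in \<open>auto simp: E_def\<close>)
  have margin: "prob B = mean \<pi> (h B)" if "B \<in> Q" for B
  proof -
    have sp: "space M \<in> sigma_sets (space M) (past (int n))" by (rule sigma_sets_top)
    have "prob (space M \<inter> B) = expectation (\<lambda>\<omega>. indicator (space M) \<omega> * h B (Y (int n) \<omega>))"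
      by (rule prob_past_future[OF sp _ h0 h1[OF that]]) (use that Q(3) hE in \<open>auto simp: E_def\<close>)
    also have "\<dots> = expectation (\<lambda>\<omega>. h B (Y (int n) \<omega>))"
      by (intro Bochner_Integration.integral_cong) auto
    finally show ?thesis
      using sets.sets_into_space[OF Qev[OF that]] by (simp add: expectation_state Int_absorb1)
  qed
  define W where "W y = 2 * osc n y + 2 * mean \<pi> (osc n)" for y
  have W0: "0 \<le> W y" for y
    unfolding W_def by (intro add_nonneg_nonneg mult_nonneg_nonneg integral_nonneg_AE) (auto simp: osc_nonneg)
  have intosc: "integrable \<pi> (osc n)" using osc_bounded by (intro integrable_pmf_bounded[of _ 5]) auto
  have intW: "integrable M (\<lambda>\<omega>. W (Y 0 \<omega>))"
    unfolding integrable_state_iff[of W 0] unfolding W_def[abs_def] using intosc by simp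
  have row: "(\<Sum>B\<in>Q. \<bar>prob (A \<inter> B) - prob A * prob B\<bar>) \<le> expectation (\<lambda>\<omega>. indicator A \<omega> * W (Y 0 \<omega>))"
    if A: "A \<in> P" for A
  proof -
    have [measurable]: "A \<in> events" using Pev[OF A] .
    \<comment> \<open>The signs vary with the row, but \<open>mixing_bound\<close> is uniform in them.\<close>
    define \<epsilon> :: "'a set \<Rightarrow> real" where "\<epsilon> B = (if prob (A \<inter> B) - prob A * prob B \<ge> 0 then 1 else -1)" for B
    define u where "u y = (\<Sum>B\<in>Q. \<epsilon> B * h B y)" for y
    have u: "\<bar>u y\<bar> \<le> 1" for y
    proof -
      have "\<bar>u y\<bar> \<le> (\<Sum>B\<in>Q. \<bar>\<epsilon> B * h B y\<bar>)" unfolding u_def by (rule sum_abs)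
      also have "\<dots> = (\<Sum>B\<in>Q. h B y)" by (rule sum.cong) (auto simp: \<epsilon>_def h0)
      finally show ?thesis using hsum[of y] by simp
    qed
    have intA: "integrable M (\<lambda>\<omega>. indicator A \<omega> * v (Y 0 \<omega>))" if "\<And>y. \<bar>v y\<bar> \<le> 1" for v :: "'s \<Rightarrow> real"
      by (rule integrable_const_bound[of _ 1])
         (use that state_function_measurable in \<open>auto simp: abs_mult indicator_def\<close>)
    have un: "(avg ^^ n) u y = (\<Sum>B\<in>Q. \<epsilon> B * g B y)" for y
      unfolding u_def[abs_def] g_def by (rule avg_funpow_sum) (use Q(1) habs in auto)
    have "(\<Sum>B\<in>Q. \<bar>prob (A \<inter> B) - prob A * prob B\<bar>) = (\<Sum>B\<in>Q. \<epsilon> B * prob (A \<inter> B)) - prob A * (\<Sum>B\<in>Q. \<epsilon> B * prob B)"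
      by (auto simp: \<epsilon>_def sum_distrib_left sum_subtractf[symmetric] intro!: sum.cong)
    also have "(\<Sum>B\<in>Q. \<epsilon> B * prob (A \<inter> B)) = (\<Sum>B\<in>Q. expectation (\<lambda>\<omega>. \<epsilon> B * (indicator A \<omega> * g B (Y 0 \<omega>))))"
      using A by (intro sum.cong) (simp_all add: joint)
    also have "\<dots> = expectation (\<lambda>\<omega>. \<Sum>B\<in>Q. \<epsilon> B * (indicator A \<omega> * g B (Y 0 \<omega>)))"
      by (rule Bochner_Integration.integral_sum[symmetric]) (intro integrable_mult_right intA gabs)
    also have "\<dots> = expectation (\<lambda>\<omega>. indicator A \<omega> * (avg ^^ n) u (Y 0 \<omega>))"
      by (intro Bochner_Integration.integral_cong) (auto simp: un sum_distrib_left algebra_simps)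
    also have "(\<Sum>B\<in>Q. \<epsilon> B * prob B) = mean \<pi> u"
      unfolding u_def using habs by (subst Bochner_Integration.integral_sum)
        (auto intro!: integrable_mult_right integrable_pmf_bounded[of _ 1] sum.cong simp: margin)
    also have "prob A * mean \<pi> u = expectation (\<lambda>\<omega>. indicator A \<omega> * mean \<pi> u)"
      by simp
    also have "expectation (\<lambda>\<omega>. indicator A \<omega> * (avg ^^ n) u (Y 0 \<omega>)) - expectation (\<lambda>\<omega>. indicator A \<omega> * mean \<pi> u)
       = expectation (\<lambda>\<omega>. indicator A \<omega> * (avg ^^ n) u (Y 0 \<omega>) - indicator A \<omega> * mean \<pi> u)"
      using avg_funpow_bounded[of u 1 n] norm_expectation_pmf_le[of u 1 \<pi>] u by (intro Bochner_Integration.integral_diff[symmetric] intA) auto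
    also have "\<dots> \<le> expectation (\<lambda>\<omega>. indicator A \<omega> * W (Y 0 \<omega>))"
    proof (intro integral_mono)
      show "integrable M (\<lambda>\<omega>. indicator A \<omega> * (avg ^^ n) u (Y 0 \<omega>) - indicator A \<omega> * mean \<pi> u)"
        using avg_funpow_bounded[of u 1 n] norm_expectation_pmf_le[of u 1 \<pi>] u by (intro Bochner_Integration.integrable_diff intA) auto
      show "integrable M (\<lambda>\<omega>. indicator A \<omega> * W (Y 0 \<omega>))"
        using integrable_mult_indicator[OF _ intW, of A] by simp
      fix \<omega>
      show "indicator A \<omega> * (avg ^^ n) u (Y 0 \<omega>) - indicator A \<omega> * mean \<pi> u \<le> indicator A \<omega> * W (Y 0 \<omega>)"
        using mixing_bound[of u n "Y 0 \<omega>"] u by (auto simp: indicator_def W_def)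
    qed
    finally show ?thesis .
  qed
  have "(\<Sum>A\<in>P. \<Sum>B\<in>Q. \<bar>prob (A \<inter> B) - prob A * prob B\<bar>) \<le> (\<Sum>A\<in>P. expectation (\<lambda>\<omega>. indicator A \<omega> * W (Y 0 \<omega>)))"
    by (rule sum_mono) (rule row)
  also have "\<dots> = expectation (\<lambda>\<omega>. \<Sum>A\<in>P. indicator A \<omega> * W (Y 0 \<omega>))"
    using integrable_mult_indicator[OF Pev intW] by (intro Bochner_Integration.integral_sum[symmetric]) auto
  also have "\<dots> = expectation (\<lambda>\<omega>. W (Y 0 \<omega>))"
  proof (intro Bochner_Integration.integral_cong refl)
    fix \<omega> assume "\<omega> \<in> space M"
    have "(\<Sum>A\<in>P. indicator A \<omega>) = (indicator (\<Union>A\<in>P. A) \<omega> :: real)"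
      by (rule indicator_UN_disjoint[OF P(1) Pdisj, symmetric])
    also have "\<dots> = 1" using \<open>\<omega> \<in> space M\<close> partition_onD1[OF P(2)] by simp
    finally have "(\<Sum>A\<in>P. indicator A \<omega>) = (1::real)" .
    then show "(\<Sum>A\<in>P. indicator A \<omega> * W (Y 0 \<omega>)) = W (Y 0 \<omega>)"
      by (simp add: sum_distrib_right[symmetric])
  qed
  also have "\<dots> = 4 * mean \<pi> (osc n)"
    unfolding expectation_state[of W 0] unfolding W_def[abs_def] using intosc by simp
  also have "\<dots> \<le> 20 * mean \<pi> (\<lambda>y. (1 - p y) ^ n)"
    using expectation_osc_le[of n] by simp
  finally show ?thesis .
qed

theorem mixing_coefficients:
  fixes f :: "'s \<Rightarrow> real"
  shows "alpha_mix M (\<lambda>k \<omega>. f (Y k \<omega>)) n \<le> beta_mix M (\<lambda>k \<omega>. f (Y k \<omega>)) n"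
    and "beta_mix M (\<lambda>k \<omega>. f (Y k \<omega>)) n \<le> 10 * mean \<pi> (\<lambda>y. (1 - p y) ^ n)"
proof -
  let ?X = "\<lambda>k \<omega>. f (Y k \<omega>)"
  have sub: "sets (generated_sigma M ?X {..0}) \<subseteq> sigma_sets (space M) (past 0)"
    "sets (generated_sigma M ?X {int n..}) \<subseteq> sigma_sets (space M) (future (int n))"
    "sets (generated_sigma M ?X {int n..}) \<subseteq> sigma_sets (space M) (future 0)"
    by (intro sets_generated_sigma_past sets_generated_sigma_future; simp)+
  have bd: "1 / 2 * (\<Sum>A\<in>P. \<Sum>B\<in>Q. \<bar>prob (A \<inter> B) - prob A * prob B\<bar>) \<le> 10 * mean \<pi> (\<lambda>y. (1 - p y) ^ n)"
    if "finite P" "partition_on (space M) P" "P \<subseteq> sets (generated_sigma M ?X {..0})"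
      "finite Q" "partition_on (space M) Q" "Q \<subseteq> sets (generated_sigma M ?X {int n..})" for P Q
  proof -
    have "(\<Sum>A\<in>P. \<Sum>B\<in>Q. \<bar>prob (A \<inter> B) - prob A * prob B\<bar>) \<le> 20 * mean \<pi> (\<lambda>y. (1 - p y) ^ n)"
      by (rule partition_sum_le[OF that(1,2) order_trans[OF that(3) sub(1)] that(4,5)
          order_trans[OF that(6) sub(2)] order_trans[OF that(6) sub(3)]])
    then show ?thesis by simp
  qed
  have ev: "sets (generated_sigma M ?X {..0}) \<subseteq> events" "sets (generated_sigma M ?X {int n..}) \<subseteq> events"
    using order_trans[OF sub(1) sigma_past_events] order_trans[OF sub(2) sigma_future_events] .
  have sp: "space (generated_sigma M ?X I) = space M" for I
    by (simp add: generated_sigma_def space_measure_of_conv)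
  show "alpha_mix M ?X n \<le> beta_mix M ?X n"
    unfolding alpha_mix_def beta_mix_def by (rule alpha_coeff_le_beta_coeff(1)[OF ev sp sp bd])
  show "beta_mix M ?X n \<le> 10 * mean \<pi> (\<lambda>y. (1 - p y) ^ n)"
    unfolding beta_mix_def by (rule alpha_coeff_le_beta_coeff(2)[OF ev sp sp bd])
qed

end

section \<open>Geometric sojourns\<close>

text \<open>The real part of \<open>q (1 - \<phi>(\<tau>))\<close> for the characteristic function \<open>\<phi>\<close> of a geometric sojourn time
with success probability \<open>q\<close>, see \<open>escape_eq\<close>.\<close>

definition escape :: "real \<Rightarrow> real \<Rightarrow> real" where
  "escape q \<tau> = q * (2 - q) * (1 - cos \<tau>) / (q\<^sup>2 + 2 * (1 - q) * (1 - cos \<tau>))"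

text \<open>The characteristic function of a geometric variable on \<open>{1, 2, \<dots>}\<close> with success probability \<open>q\<close>.\<close>

definition sojourn_cf :: "real \<Rightarrow> real \<Rightarrow> complex" where
  "sojourn_cf q \<tau> = of_real q * cis \<tau> / (1 - of_real (1 - q) * cis \<tau>)"

lemma cmod_cis_minus_one_le: "cmod (cis \<tau> - 1) \<le> \<bar>\<tau>\<bar>"
  using iexp_approx1[of \<tau> 0] by (simp add: cis_conv_exp)

lemma one_minus_cos_le: "1 - cos \<tau> \<le> \<tau>\<^sup>2 / 2" for \<tau> :: real
proof -
  have "\<bar>sin (\<tau> / 2)\<bar> \<le> \<bar>\<tau> / 2\<bar>" by (rule abs_sin_x_le_abs_x)
  then have "(sin (\<tau> / 2))\<^sup>2 \<le> (\<tau> / 2)\<^sup>2" using abs_le_square_iff by blast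
  then show ?thesis using cos_double_sin[of "\<tau> / 2"] by (simp add: power_divide)
qed

context
  fixes q \<tau> :: real
  assumes q: "0 < q" "q \<le> 1"
begin

lemma sojourn_denominator: "q \<le> cmod (1 - of_real (1 - q) * cis \<tau>)"
proof -
  have "cmod 1 - cmod (of_real (1 - q) * cis \<tau>) \<le> cmod (1 - of_real (1 - q) * cis \<tau>)"
    by (rule norm_triangle_ineq2)
  then show ?thesis using q unfolding norm_mult norm_of_real norm_cis by simp
qed

lemma sojourn_denominator_nz: "1 - of_real (1 - q) * cis \<tau> \<noteq> 0"
  using sojourn_denominator q by (metis norm_zero not_le)

lemma sojourn_cf_eq: "sojourn_cf q \<tau> * (1 - of_real (1 - q) * cis \<tau>) = of_real q * cis \<tau>"
  using sojourn_denominator_nz by (simp add: sojourn_cf_def)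

lemma cmod_sojourn_cf_le: "cmod (sojourn_cf q \<tau>) \<le> 1"
  using sojourn_denominator q by (simp add: sojourn_cf_def norm_divide norm_mult divide_le_eq_1)

lemma one_minus_sojourn_cf: "1 - sojourn_cf q \<tau> = (1 - cis \<tau>) / (1 - of_real (1 - q) * cis \<tau>)"
  using sojourn_denominator_nz by (simp add: sojourn_cf_def field_simps)

lemma cmod_one_minus_sojourn_cf: "cmod (1 - sojourn_cf q \<tau>) \<le> \<bar>\<tau>\<bar> / q"
proof -
  have "cmod (1 - sojourn_cf q \<tau>) \<le> cmod (1 - cis \<tau>) / q"
    unfolding one_minus_sojourn_cf norm_divide
    using sojourn_denominator q by (intro divide_left_mono) (auto intro!: mult_pos_pos)
  also have "\<dots> \<le> \<bar>\<tau>\<bar> / q"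
    using cmod_cis_minus_one_le[of \<tau>] q by (intro divide_right_mono) (auto simp: norm_minus_commute)
  finally show ?thesis .
qed

lemma escape_denominator_pos: "0 < q\<^sup>2 + 2 * (1 - q) * (1 - cos \<tau>)"
proof -
  have "0 \<le> (1 - q) * (1 - cos \<tau>)" "0 < q\<^sup>2" using q by auto
  then show ?thesis unfolding mult.assoc by linarith
qed

lemma escape_eq: "escape q \<tau> = Re (of_real q * (1 - sojourn_cf q \<tau>))"
proof -
  have s: "(sin \<tau>)\<^sup>2 = 1 - (cos \<tau>)\<^sup>2" by (simp add: sin_squared_eq)
  have d: "(1 - (1 - q) * cos \<tau>)\<^sup>2 + ((1 - q) * sin \<tau>)\<^sup>2 = q\<^sup>2 + 2 * (1 - q) * (1 - cos \<tau>)"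
    unfolding power_mult_distrib s by (simp add: power2_eq_square algebra_simps)
  have n: "(1 - cos \<tau>) * (1 - (1 - q) * cos \<tau>) + sin \<tau> * ((1 - q) * sin \<tau>) = (2 - q) * (1 - cos \<tau>)"
  proof -
    have "sin \<tau> * ((1 - q) * sin \<tau>) = (1 - q) * (sin \<tau>)\<^sup>2" by (simp add: power2_eq_square)
    then show ?thesis unfolding s by (simp add: power2_eq_square algebra_simps)
  qed
  have "Re (1 - sojourn_cf q \<tau>) = (2 - q) * (1 - cos \<tau>) / (q\<^sup>2 + 2 * (1 - q) * (1 - cos \<tau>))"
    unfolding one_minus_sojourn_cf Re_divide by (simp add: d n)
  then show ?thesis by (simp add: escape_def)
qed

lemma escape_nonneg: "0 \<le> escape q \<tau>"
  unfolding escape_def using q escape_denominator_pos by (intro divide_nonneg_pos mult_nonneg_nonneg) auto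

lemma escape_le: "escape q \<tau> \<le> \<bar>\<tau>\<bar>"
proof -
  have "escape q \<tau> \<le> cmod (of_real q * (1 - sojourn_cf q \<tau>))" unfolding escape_eq by (rule complex_Re_le_cmod)
  also have "\<dots> = q * cmod (1 - sojourn_cf q \<tau>)" using q by (simp add: norm_mult)
  also have "\<dots> \<le> q * (\<bar>\<tau>\<bar> / q)" using q cmod_one_minus_sojourn_cf by (intro mult_left_mono) auto
  finally show ?thesis using q by simp
qed

lemma escape_le_2q: "escape q \<tau> \<le> 2 * q"
proof -
  have "escape q \<tau> \<le> cmod (of_real q * (1 - sojourn_cf q \<tau>))" unfolding escape_eq by (rule complex_Re_le_cmod)
  also have "\<dots> = q * cmod (1 - sojourn_cf q \<tau>)" using q by (simp add: norm_mult)
  also have "cmod (1 - sojourn_cf q \<tau>) \<le> 2"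
    using norm_triangle_ineq4[of 1 "sojourn_cf q \<tau>"] cmod_sojourn_cf_le by simp
  finally show ?thesis using q by simp
qed

lemma escape_le_square: "escape q \<tau> \<le> \<tau>\<^sup>2 / q"
proof -
  have "escape q \<tau> \<le> q * (2 - q) * (1 - cos \<tau>) / q\<^sup>2"
    unfolding escape_def
    by (intro divide_left_mono mult_pos_pos escape_denominator_pos) (use q in auto)
  also have "\<dots> = (2 - q) * (1 - cos \<tau>) / q" using q by (simp add: power2_eq_square)
  also have "\<dots> \<le> 2 * (\<tau>\<^sup>2 / 2) / q"
    using q one_minus_cos_le[of \<tau>] by (intro divide_right_mono mult_mono) auto
  finally show ?thesis by simp
qed

end

text \<open>The cancellation that leaves only \<open>residual\<close> in \<open>approx_eigen\<close>: there \<open>S\<close> is \<open>sojourn_cf\<close>,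
\<open>r = 1 / p\<close> and \<open>d\<close> is the decay rate.\<close>

lemma eigen_identity:
  fixes S a b d r :: complex
  assumes "S * (1 - a) = b"
  shows "(S + d * r) * a + b - (1 - d) * (S + d * r) - d * (S + (a - 1) * r + d * r) = 0"
  unfolding assms[symmetric] by (simp add: algebra_simps)

section \<open>Characteristic functions of partial sums\<close>

context refresh_chain
begin

text \<open>The transition operator with an additional factor \<open>e^(i \<theta> f)\<close> for the state that is entered; its
powers generate the characteristic functions of the partial sums.\<close>

definition twisted_avg :: "('s \<Rightarrow> real) \<Rightarrow> real \<Rightarrow> ('s \<Rightarrow> complex) \<Rightarrow> 's \<Rightarrow> complex" where
  "twisted_avg f \<theta> u = avg (\<lambda>t. cis (\<theta> * f t) * u t)"

lemma twisted_avg_funpow_bounded: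
  assumes "\<And>s. cmod (u s) \<le> 1" shows "cmod ((twisted_avg f \<theta> ^^ n) u s) \<le> 1"
  by (induction n arbitrary: s)
     (use assms in \<open>auto simp: twisted_avg_def norm_mult intro!: avg_bounded[where B=1, simplified]\<close>)

lemma expectation_history_cis:
  assumes "\<And>s. cmod (u s) \<le> 1"
  shows "mean (history n) (\<lambda>l. cis (\<theta> * sum_list (map f l)) * u (hd l))
    = mean \<pi> ((twisted_avg f \<theta> ^^ Suc n) u)"
  using assms
proof (induction n arbitrary: u)
  case 0
  have "mean \<pi> (avg (\<lambda>t. cis (\<theta> * f t) * u t)) = mean \<pi> (\<lambda>t. cis (\<theta> * f t) * u t)"
    by (rule expectation_avg[of _ 1]) (simp add: norm_mult 0)
  then show ?case by (simp add: twisted_avg_def)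
next
  case (Suc n)
  have "mean (history (Suc n)) (\<lambda>l. cis (\<theta> * sum_list (map f l)) * u (hd l))
    = mean (history n) (\<lambda>l. avg (\<lambda>t. cis (\<theta> * sum_list (map f (t # l))) * u (hd (t # l))) (hd l))"
    by (rule expectation_history_Suc[of _ 1]) (simp add: norm_mult Suc.prems)
  also have "\<dots> = mean (history n) (\<lambda>l. cis (\<theta> * sum_list (map f l)) * twisted_avg f \<theta> u (hd l))"
  proof (intro Bochner_Integration.integral_cong refl)
    fix l
    have "avg (\<lambda>t. cis (\<theta> * sum_list (map f (t # l))) * u (hd (t # l))) (hd l)
      = avg (\<lambda>t. cis (\<theta> * sum_list (map f l)) * (cis (\<theta> * f t) * u t)) (hd l)"
      by (simp add: distrib_left cis_mult[symmetric] mult_ac)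
    then show "avg (\<lambda>t. cis (\<theta> * sum_list (map f (t # l))) * u (hd (t # l))) (hd l)
      = cis (\<theta> * sum_list (map f l)) * twisted_avg f \<theta> u (hd l)"
      by (simp add: avg_def twisted_avg_def)
  qed
  also have "\<dots> = mean \<pi> ((twisted_avg f \<theta> ^^ Suc n) (twisted_avg f \<theta> u))"
    using twisted_avg_funpow_bounded[where u=u and f=f and \<theta>=\<theta> and n=1] Suc.prems by (intro Suc.IH) simp
  finally show ?case by (simp only: funpow_Suc_right o_def)
qed

end

text \<open>The involution \<open>flip\<close> changes the sign of the values and nothing else. Integrability of \<open>1 / p\<close> and
\<open>\<bar>f\<bar> / p\<close> says that the sojourn in progress at a stationary time has finite mean
length and contribution.\<close>

locale symmetric_refresh_chain = refresh_chain \<pi> p for \<pi> :: "'s pmf" and p +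
  fixes f :: "'s \<Rightarrow> real" and flip :: "'s \<Rightarrow> 's"
  assumes flip_invariant: "map_pmf flip \<pi> = \<pi>"
    and p_flip: "p (flip s) = p s" and f_flip: "f (flip s) = - f s"
    and integrable_inverse: "integrable \<pi> (\<lambda>s. 1 / p s)"
    and integrable_ratio: "integrable \<pi> (\<lambda>s. \<bar>f s\<bar> / p s)"
begin

lemma expectation_odd:
  assumes "\<And>s. g (flip s) = - g s"
  shows "mean \<pi> g = (0 :: real)"
proof -
  have "mean \<pi> g = mean (map_pmf flip \<pi>) g" by (simp add: flip_invariant)
  also have "\<dots> = - mean \<pi> g" by (simp add: assms)
  finally show ?thesis by simp
qed

definition moment :: real where
  "moment = mean \<pi> (\<lambda>s. 1 / p s) + mean \<pi> (\<lambda>s. \<bar>f s\<bar> / p s)"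

text \<open>In a time unit the modulus of the characteristic function at \<open>\<theta>\<close> shrinks by the factor
\<open>1 - decay \<theta>\<close>, up to an error that does not accumulate.\<close>

definition decay :: "real \<Rightarrow> real" where
  "decay \<theta> = mean \<pi> (\<lambda>s. escape (p s) (\<theta> * f s))"

lemma moment_ge: "mean \<pi> (\<lambda>s. 1 / p s) \<le> moment" "mean \<pi> (\<lambda>s. \<bar>f s\<bar> / p s) \<le> moment"
  "0 \<le> moment"
proof -
  have "0 \<le> mean \<pi> (\<lambda>s. 1 / p s)" "0 \<le> mean \<pi> (\<lambda>s. \<bar>f s\<bar> / p s)"
    by (auto intro!: integral_nonneg_AE simp: p_nonneg)
  then show "mean \<pi> (\<lambda>s. 1 / p s) \<le> moment" "mean \<pi> (\<lambda>s. \<bar>f s\<bar> / p s) \<le> moment"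
    "0 \<le> moment" by (auto simp: moment_def)
qed

lemma escape_bounds: "0 \<le> escape (p s) \<tau>" "escape (p s) \<tau> \<le> 2"
  using escape_nonneg[OF p_pos p_le_1] escape_le_2q[OF p_pos[of s] p_le_1[of s], of \<tau>] p_le_1[of s] by auto

lemma integrable_escape: "integrable \<pi> (\<lambda>s. escape (p s) (\<theta> * f s))"
  using escape_bounds by (intro integrable_pmf_bounded[of _ 2]) auto

lemma decay_nonneg: "0 \<le> decay \<theta>"
  unfolding decay_def by (intro integral_nonneg_AE) (simp add: escape_bounds)

lemma decay_le: "decay \<theta> \<le> \<bar>\<theta>\<bar> * moment"
proof -
  have "decay \<theta> \<le> mean \<pi> (\<lambda>s. \<bar>\<theta>\<bar> * (\<bar>f s\<bar> / p s))"
    unfolding decay_def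
  proof (intro integral_mono integrable_escape integrable_mult_right integrable_ratio)
    fix s
    have "escape (p s) (\<theta> * f s) \<le> \<bar>\<theta>\<bar> * \<bar>f s\<bar>" using escape_le[OF p_pos p_le_1, of s "\<theta> * f s"] by (simp add: abs_mult)
    also have "\<dots> \<le> \<bar>\<theta>\<bar> * (\<bar>f s\<bar> / p s)"
      using p_pos[of s] p_le_1[of s] by (intro mult_left_mono) (auto simp: le_divide_eq mult_left_le)
    finally show "escape (p s) (\<theta> * f s) \<le> \<bar>\<theta>\<bar> * (\<bar>f s\<bar> / p s)" .
  qed
  also have "\<dots> = \<bar>\<theta>\<bar> * mean \<pi> (\<lambda>s. \<bar>f s\<bar> / p s)" by (rule integral_mult_right_zero)
  also have "\<dots> \<le> \<bar>\<theta>\<bar> * moment" using moment_ge by (intro mult_left_mono) auto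
  finally show ?thesis .
qed

context
  fixes \<theta> :: real
begin

text \<open>The density with respect to \<open>\<pi>\<close> of an approximate left eigenvector of \<open>twisted_avg\<close> for the
eigenvalue \<open>1 - decay \<theta>\<close>. The exact eigenvector has \<open>p e / (1 - decay \<theta> - (1 - p) e)\<close> with
\<open>e = e^(i \<theta> f)\<close>, which may blow up in states with small \<open>p\<close>; its expansion to first order in
\<open>decay \<theta>\<close>, with \<open>e\<close> replaced by \<open>1\<close> in the linear term, is integrable.\<close>

definition eigen :: "'s \<Rightarrow> complex" where
  "eigen s = sojourn_cf (p s) (\<theta> * f s) + of_real (decay \<theta> / p s)"

definition residual :: "'s \<Rightarrow> complex" where
  "residual s = of_real (decay \<theta>) * (sojourn_cf (p s) (\<theta> * f s)
      + (of_real (1 - p s) * cis (\<theta> * f s) - 1) / of_real (p s) + of_real (decay \<theta> / p s))"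

lemma cmod_eigen_le: "cmod (eigen s) \<le> 1 + decay \<theta> / p s"
  unfolding eigen_def using cmod_sojourn_cf_le[OF p_pos p_le_1, of s "\<theta> * f s"] decay_nonneg p_pos[of s]
  by (intro order_trans[OF norm_triangle_ineq]) (simp add: norm_divide)

lemma cmod_eigen_minus_one: "cmod (eigen s - 1) \<le> \<bar>\<theta>\<bar> * (\<bar>f s\<bar> / p s) + decay \<theta> * (1 / p s)"
proof -
  have "cmod (eigen s - 1) \<le> cmod (sojourn_cf (p s) (\<theta> * f s) - 1) + cmod (of_real (decay \<theta> / p s))"
    unfolding eigen_def by (metis add_diff_eq add.commute norm_triangle_ineq)
  then show ?thesis
    using cmod_one_minus_sojourn_cf[OF p_pos p_le_1, of s "\<theta> * f s"] decay_nonneg p_pos[of s]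
    by (simp add: norm_minus_commute abs_mult norm_divide)
qed

lemma cmod_residual: "cmod (residual s) \<le> decay \<theta> * (2 * \<bar>\<theta>\<bar> * (\<bar>f s\<bar> / p s) + decay \<theta> * (1 / p s))"
proof -
  let ?e = "cis (\<theta> * f s)" and ?S = "sojourn_cf (p s) (\<theta> * f s)"
  have eq: "?S + (of_real (1 - p s) * ?e - 1) / of_real (p s) = (?S - 1) + of_real ((1 - p s) / p s) * (?e - 1)"
    using p_pos[of s] by (simp add: field_simps)
  have "cmod (?S + (of_real (1 - p s) * ?e - 1) / of_real (p s)) \<le> cmod (?S - 1) + cmod (of_real ((1 - p s) / p s) * (?e - 1))"
    unfolding eq by (rule norm_triangle_ineq)
  also have "cmod (?S - 1) \<le> \<bar>\<theta>\<bar> * (\<bar>f s\<bar> / p s)"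
    using cmod_one_minus_sojourn_cf[OF p_pos p_le_1, of s "\<theta> * f s"] by (simp add: norm_minus_commute abs_mult)
  also have "cmod (of_real ((1 - p s) / p s) * (?e - 1)) \<le> (1 / p s) * \<bar>\<theta> * f s\<bar>"
    unfolding norm_mult norm_of_real using p_pos[of s] p_le_1[of s] cmod_cis_minus_one_le[of "\<theta> * f s"]
    by (intro mult_mono) (auto simp: divide_right_mono)
  finally have "cmod (?S + (of_real (1 - p s) * ?e - 1) / of_real (p s)) \<le> 2 * \<bar>\<theta>\<bar> * (\<bar>f s\<bar> / p s)"
    by (simp add: abs_mult)
  moreover have "cmod (of_real (decay \<theta> / p s)) = decay \<theta> * (1 / p s)"
    using decay_nonneg p_pos[of s] by (simp add: norm_divide)
  ultimately have "cmod (?S + (of_real (1 - p s) * ?e - 1) / of_real (p s) + of_real (decay \<theta> / p s))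
     \<le> 2 * \<bar>\<theta>\<bar> * (\<bar>f s\<bar> / p s) + decay \<theta> * (1 / p s)"
    by (intro order_trans[OF norm_triangle_ineq]) simp
  then show ?thesis unfolding residual_def norm_mult using decay_nonneg[of \<theta>] by (simp add: mult_left_mono)
qed

lemma integrable_eigen:
  assumes "\<And>s. cmod (u s) \<le> B"
  shows "integrable \<pi> (\<lambda>s. eigen s * u s)"
proof (rule Bochner_Integration.integrable_bound)
  show "integrable \<pi> (\<lambda>s. (1 + decay \<theta> * (1 / p s)) * B)"
    by (intro integrable_mult_left Bochner_Integration.integrable_add integrable_mult_right integrable_inverse) simp
  have "cmod (eigen s) * cmod (u s) \<le> (1 + decay \<theta> / p s) * B" for s
    using assms[of s] cmod_eigen_le[of s] by (intro mult_mono) (auto intro: order_trans[OF norm_ge_zero])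
  then show "AE s in measure_pmf \<pi>. norm (eigen s * u s) \<le> norm ((1 + decay \<theta> * (1 / p s)) * B)"
    by (auto simp: norm_mult intro!: AE_I2 intro: order_trans[OF _ abs_ge_self])
qed simp

text \<open>The mass that is refreshed in one step has to equal \<open>rate\<close>, as it does without twisting. This
equation determines \<open>decay \<theta>\<close>; the symmetry under \<open>flip\<close> makes it real.\<close>

lemma expectation_p_eigen: "mean \<pi> (\<lambda>s. of_real (p s) * eigen s) = of_real rate"
proof -
  let ?S = "\<lambda>s. sojourn_cf (p s) (\<theta> * f s)"
  let ?L = "\<lambda>s. of_real (p s) * (1 - ?S s)"
  have bd: "cmod (?L s) \<le> 2" for s
  proof -
    have "cmod (1 - ?S s) \<le> 2"
      using norm_triangle_ineq4[of 1 "?S s"] cmod_sojourn_cf_le[OF p_pos p_le_1, of s "\<theta> * f s"] by simp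
    then have "p s * cmod (1 - ?S s) \<le> 1 * 2" using p_le_1[of s] by (intro mult_mono) auto
    then show ?thesis using p_nonneg[of s] by (simp add: norm_mult)
  qed
  have int: "integrable \<pi> ?L" by (rule integrable_pmf_bounded[OF bd])
  have "mean \<pi> ?L = of_real (decay \<theta>)"
  proof (rule complex_eqI)
    show "Re (mean \<pi> ?L) = Re (of_real (decay \<theta>))"
      unfolding integral_Re[OF int, symmetric] decay_def
      by (simp add: escape_eq[OF p_pos p_le_1])
    have "sojourn_cf (p (flip s)) (\<theta> * f (flip s)) = cnj (?S s)" for s
      by (simp add: sojourn_cf_def p_flip f_flip cis_cnj)
    then have "mean \<pi> (\<lambda>s. Im (?L s)) = 0"
      by (intro expectation_odd) (simp add: p_flip)
    then show "Im (mean \<pi> ?L) = Im (of_real (decay \<theta>))"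
      unfolding integral_Im[OF int, symmetric] by simp
  qed
  moreover have "mean \<pi> (\<lambda>s. of_real (p s) * eigen s)
     = mean \<pi> (\<lambda>s. of_real (p s) - ?L s + of_real (decay \<theta>))"
  proof (intro Bochner_Integration.integral_cong refl)
    fix s show "of_real (p s) * eigen s = of_real (p s) - ?L s + of_real (decay \<theta>)"
      using p_pos[of s] by (simp add: eigen_def algebra_simps)
  qed
  moreover have "\<dots> = of_real rate - mean \<pi> ?L + of_real (decay \<theta>)"
    using int integrable_p by (simp add: rate_def)
  ultimately show ?thesis by simp
qed

lemma integrable_residual_bound:
  "integrable \<pi> (\<lambda>s. decay \<theta> * (2 * \<bar>\<theta>\<bar> * (\<bar>f s\<bar> / p s) + decay \<theta> * (1 / p s)))"
  by (intro integrable_mult_right Bochner_Integration.integrable_add integrable_ratio integrable_inverse)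

lemma cmod_residual_mult:
  assumes "cmod (u s) \<le> 1"
  shows "cmod (residual s * u s) \<le> decay \<theta> * (2 * \<bar>\<theta>\<bar> * (\<bar>f s\<bar> / p s) + decay \<theta> * (1 / p s))"
proof -
  have "cmod (residual s) * cmod (u s) \<le> cmod (residual s) * 1" using assms by (intro mult_left_mono) auto
  then show ?thesis using cmod_residual[of s] by (simp add: norm_mult)
qed

lemma integrable_residual:
  assumes "\<And>s. cmod (u s) \<le> 1"
  shows "integrable \<pi> (\<lambda>s. residual s * u s)"
proof (rule Bochner_Integration.integrable_bound[OF integrable_residual_bound])
  show "AE s in measure_pmf \<pi>. norm (residual s * u s)
      \<le> norm (decay \<theta> * (2 * \<bar>\<theta>\<bar> * (\<bar>f s\<bar> / p s) + decay \<theta> * (1 / p s)))"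
    unfolding real_norm_def by (rule AE_I2, rule order_trans[OF cmod_residual_mult[OF assms] abs_ge_self])
qed simp

lemma residual_le:
  assumes "\<And>s. cmod (u s) \<le> 1"
  shows "cmod (mean \<pi> (\<lambda>s. residual s * u s)) \<le> decay \<theta> * (\<bar>\<theta>\<bar> * (2 * moment + moment\<^sup>2))"
proof -
  have "cmod (mean \<pi> (\<lambda>s. residual s * u s)) \<le> mean \<pi> (\<lambda>s. cmod (residual s * u s))"
    by (rule integral_norm_bound)
  also have "\<dots> \<le> mean \<pi> (\<lambda>s. decay \<theta> * (2 * \<bar>\<theta>\<bar> * (\<bar>f s\<bar> / p s) + decay \<theta> * (1 / p s)))"
    by (intro integral_mono integrable_norm integrable_residual integrable_residual_bound cmod_residual_mult assms)
  also have "\<dots> = decay \<theta> * (2 * \<bar>\<theta>\<bar> * mean \<pi> (\<lambda>s. \<bar>f s\<bar> / p s)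
      + decay \<theta> * mean \<pi> (\<lambda>s. 1 / p s))"
    by (subst integral_mult_right_zero, subst Bochner_Integration.integral_add)
       (intro integrable_mult_right integrable_ratio integrable_inverse | simp only: integral_mult_right_zero)+
  also have "\<dots> \<le> decay \<theta> * (2 * \<bar>\<theta>\<bar> * moment + (\<bar>\<theta>\<bar> * moment) * moment)"
    using moment_ge decay_nonneg[of \<theta>] decay_le[of \<theta>]
    by (intro mult_left_mono add_mono mult_mono) (auto intro!: integral_nonneg_AE simp: p_nonneg)
  finally show ?thesis by (simp add: algebra_simps power2_eq_square)
qed

lemma eigen_minus_one_le:
  assumes u: "\<And>s. cmod (u s) \<le> 1"
  shows "cmod (mean \<pi> (\<lambda>s. eigen s * u s) - mean \<pi> u) \<le> \<bar>\<theta>\<bar> * (moment + moment\<^sup>2)"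
proof -
  have int: "integrable \<pi> (\<lambda>s. eigen s * u s)" "integrable \<pi> u"
    by (rule integrable_eigen[OF u], rule integrable_pmf_bounded[OF u])
  have "cmod (mean \<pi> (\<lambda>s. eigen s * u s) - mean \<pi> u)
     = cmod (mean \<pi> (\<lambda>s. eigen s * u s - u s))"
    using int by simp
  also have "\<dots> \<le> mean \<pi> (\<lambda>s. cmod (eigen s * u s - u s))"
    by (rule integral_norm_bound)
  also have "\<dots> \<le> mean \<pi> (\<lambda>s. \<bar>\<theta>\<bar> * (\<bar>f s\<bar> / p s) + decay \<theta> * (1 / p s))"
  proof (intro integral_mono integrable_norm Bochner_Integration.integrable_diff Bochner_Integration.integrable_add
      integrable_mult_right integrable_ratio integrable_inverse int)
    fix s
    have "eigen s * u s - u s = (eigen s - 1) * u s" by (simp add: algebra_simps)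
    then have "cmod (eigen s * u s - u s) = cmod (eigen s - 1) * cmod (u s)" by (simp add: norm_mult)
    also have "\<dots> \<le> cmod (eigen s - 1) * 1" using u[of s] by (intro mult_left_mono) auto
    finally show "cmod (eigen s * u s - u s) \<le> \<bar>\<theta>\<bar> * (\<bar>f s\<bar> / p s) + decay \<theta> * (1 / p s)"
      using cmod_eigen_minus_one[of s] by simp
  qed
  also have "\<dots> = \<bar>\<theta>\<bar> * mean \<pi> (\<lambda>s. \<bar>f s\<bar> / p s) + decay \<theta> * mean \<pi> (\<lambda>s. 1 / p s)"
    by (subst Bochner_Integration.integral_add)
       (intro integrable_mult_right integrable_ratio integrable_inverse | simp only: integral_mult_right_zero)+
  also have "\<dots> \<le> \<bar>\<theta>\<bar> * moment + (\<bar>\<theta>\<bar> * moment) * moment"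
    using moment_ge decay_nonneg[of \<theta>] decay_le[of \<theta>]
    by (intro add_mono mult_mono mult_left_mono) (auto intro!: integral_nonneg_AE simp: p_nonneg)
  finally show ?thesis by (simp add: algebra_simps power2_eq_square)
qed

lemma approx_eigen:
  assumes u: "\<And>s. cmod (u s) \<le> 1"
  shows "mean \<pi> (\<lambda>s. eigen s * twisted_avg f \<theta> u s)
     = of_real (1 - decay \<theta>) * mean \<pi> (\<lambda>s. eigen s * u s)
       + mean \<pi> (\<lambda>s. residual s * u s)"
proof -
  let ?e = "\<lambda>s. cis (\<theta> * f s)"
  define N where "N = mean fresh (\<lambda>s. ?e s * u s)"
  have N: "N = of_real (1 / rate) * mean \<pi> (\<lambda>s. of_real (p s) * (?e s * u s))"
    unfolding N_def expectation_fresh by (simp add: scaleR_conv_of_real)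
  have tw: "twisted_avg f \<theta> u s = of_real (1 - p s) * (?e s * u s) + of_real (p s) * N" for s
    unfolding twisted_avg_def N_def
    by (subst avg_eq[of _ 1]) (auto simp: norm_mult u scaleR_conv_of_real)
  have b1: "cmod (of_real (1 - p s) * (?e s * u s)) \<le> 1" "cmod (of_real (p s) * (?e s * u s)) \<le> 1" for s
  proof -
    have "\<bar>1 - p s\<bar> * cmod (u s) \<le> 1 * 1" "\<bar>p s\<bar> * cmod (u s) \<le> 1 * 1"
      using u[of s] p_nonneg[of s] p_le_1[of s] by (intro mult_mono; simp)+
    then show "cmod (of_real (1 - p s) * (?e s * u s)) \<le> 1" "cmod (of_real (p s) * (?e s * u s)) \<le> 1"
      unfolding norm_mult norm_of_real norm_cis by simp_all
  qed
  have b2: "cmod (of_real (p s) :: complex) \<le> 1" for s using p_abs by simp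
  have i1: "integrable \<pi> (\<lambda>s. eigen s * (of_real (1 - p s) * (?e s * u s)))"
    by (rule integrable_eigen[OF b1(1)])
  have i2: "integrable \<pi> (\<lambda>s. of_real (p s) * eigen s * N)"
    using integrable_eigen[OF b2] by (intro integrable_mult_left) (simp add: mult.commute)
  have i3: "integrable \<pi> (\<lambda>s. of_real (p s) * (?e s * u s))"
    by (rule integrable_pmf_bounded[OF b1(2)])
  have i4: "integrable \<pi> (\<lambda>s. eigen s * u s)" by (rule integrable_eigen[OF u])
  have "mean \<pi> (\<lambda>s. eigen s * twisted_avg f \<theta> u s)
     = mean \<pi> (\<lambda>s. eigen s * (of_real (1 - p s) * (?e s * u s)) + of_real (p s) * eigen s * N)"
    by (intro Bochner_Integration.integral_cong) (auto simp: tw algebra_simps)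
  also have "\<dots> = mean \<pi> (\<lambda>s. eigen s * (of_real (1 - p s) * (?e s * u s))) + of_real rate * N"
    using i1 i2 expectation_p_eigen by simp
  also have "of_real rate * N = mean \<pi> (\<lambda>s. of_real (p s) * (?e s * u s))"
    unfolding N using rate_pos by simp
  also have "mean \<pi> (\<lambda>s. eigen s * (of_real (1 - p s) * (?e s * u s))) + \<dots>
     = mean \<pi> (\<lambda>s. eigen s * (of_real (1 - p s) * (?e s * u s)) + of_real (p s) * (?e s * u s))"
    using i1 i3 by simp
  also have "\<dots> = mean \<pi> (\<lambda>s. of_real (1 - decay \<theta>) * (eigen s * u s) + residual s * u s)"
  proof (intro Bochner_Integration.integral_cong refl)
    fix s
    let ?S = "sojourn_cf (p s) (\<theta> * f s)" and ?d = "of_real (decay \<theta>) :: complex" and ?p = "of_real (p s) :: complex"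
    have "eigen s * (of_real (1 - p s) * ?e s) + ?p * ?e s - of_real (1 - decay \<theta>) * eigen s - residual s = 0"
      using eigen_identity[of ?S "of_real (1 - p s) * ?e s" "?p * ?e s" ?d "1 / ?p"]
        sojourn_cf_eq[OF p_pos p_le_1, of s "\<theta> * f s"]
      by (simp add: eigen_def residual_def)
    then have "eigen s * (of_real (1 - p s) * ?e s) + ?p * ?e s = of_real (1 - decay \<theta>) * eigen s + residual s"
      by (simp add: algebra_simps)
    then have "(eigen s * (of_real (1 - p s) * ?e s) + ?p * ?e s) * u s = (of_real (1 - decay \<theta>) * eigen s + residual s) * u s"
      by simp
    then show "eigen s * (of_real (1 - p s) * (?e s * u s)) + ?p * (?e s * u s)
       = of_real (1 - decay \<theta>) * (eigen s * u s) + residual s * u s"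
      by (simp only: distrib_right mult.assoc)
  qed
  also have "\<dots> = of_real (1 - decay \<theta>) * mean \<pi> (\<lambda>s. eigen s * u s)
       + mean \<pi> (\<lambda>s. residual s * u s)"
  proof (subst Bochner_Integration.integral_add)
    show "integrable \<pi> (\<lambda>s. of_real (1 - decay \<theta>) * (eigen s * u s))" using i4 by (rule integrable_mult_right)
    show "integrable \<pi> (\<lambda>s. residual s * u s)" by (rule integrable_residual[OF u])
  qed simp
  finally show ?thesis .
qed

text \<open>Each step adds an error of at most \<open>decay \<theta>\<close> times a constant, and all earlier errors are damped by
\<open>1 - decay \<theta>\<close>. The geometric sum is at most the constant, for every number of steps.\<close>

lemma eigen_iterate:
  assumes small: "\<bar>\<theta>\<bar> * moment \<le> 1" and u: "\<And>s. cmod (u s) \<le> 1"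
  shows "cmod (mean \<pi> (\<lambda>s. eigen s * (twisted_avg f \<theta> ^^ n) u s)
      - of_real ((1 - decay \<theta>) ^ n) * mean \<pi> (\<lambda>s. eigen s * u s))
    \<le> (1 - (1 - decay \<theta>) ^ n) * (\<bar>\<theta>\<bar> * (2 * moment + moment\<^sup>2))"
proof (induction n)
  case (Suc n)
  define v where "v = (twisted_avg f \<theta> ^^ n) u"
  define I where "I u = mean \<pi> (\<lambda>s. eigen s * u s)" for u
  define R where "R = mean \<pi> (\<lambda>s. residual s * v s)"
  define r where "r = 1 - decay \<theta>"
  define C where "C = \<bar>\<theta>\<bar> * (2 * moment + moment\<^sup>2)"
  have r: "0 \<le> r" using decay_le[of \<theta>] small by (simp add: r_def)
  have v: "cmod (v s) \<le> 1" for s unfolding v_def by (rule twisted_avg_funpow_bounded[OF u])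
  have R: "cmod R \<le> decay \<theta> * C" unfolding R_def C_def by (rule residual_le[OF v])
  have IH: "cmod (I v - of_real (r ^ n) * I u) \<le> (1 - r ^ n) * C"
    using Suc.IH unfolding I_def C_def r_def v_def .
  have "I ((twisted_avg f \<theta> ^^ Suc n) u) = of_real r * I v + R"
    using approx_eigen[of v] v unfolding I_def R_def r_def v_def by simp
  then have "I ((twisted_avg f \<theta> ^^ Suc n) u) - of_real (r ^ Suc n) * I u = of_real r * (I v - of_real (r ^ n) * I u) + R"
    by (simp add: algebra_simps)
  then have "cmod (I ((twisted_avg f \<theta> ^^ Suc n) u) - of_real (r ^ Suc n) * I u)
      \<le> cmod (of_real r * (I v - of_real (r ^ n) * I u)) + cmod R"
    by (simp only: norm_triangle_ineq)
  also have "\<dots> \<le> r * ((1 - r ^ n) * C) + decay \<theta> * C"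
    unfolding norm_mult norm_of_real using r IH R by (intro add_mono mult_mono) auto
  also have "\<dots> = (1 - r ^ Suc n) * C" by (simp add: r_def algebra_simps)
  finally show ?case unfolding I_def C_def r_def .
qed simp

lemma characteristic_approx:
  assumes small: "\<bar>\<theta>\<bar> * moment \<le> 1"
  shows "cmod (mean \<pi> ((twisted_avg f \<theta> ^^ n) (\<lambda>_. 1)) - of_real ((1 - decay \<theta>) ^ n))
    \<le> \<bar>\<theta>\<bar> * (4 * moment + 3 * moment\<^sup>2)"
proof -
  define u :: "'s \<Rightarrow> complex" where "u = (\<lambda>_. 1)"
  define v where "v = (twisted_avg f \<theta> ^^ n) u"
  define I where "I u = mean \<pi> (\<lambda>s. eigen s * u s)" for u
  define r where "r = 1 - decay \<theta>"
  have u: "cmod (u s) \<le> 1" for s by (simp add: u_def)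
  have v: "cmod (v s) \<le> 1" for s unfolding v_def by (rule twisted_avg_funpow_bounded[OF u])
  have r: "0 \<le> r" "r \<le> 1" using decay_le[of \<theta>] small decay_nonneg[of \<theta>] by (simp_all add: r_def)
  have rn: "0 \<le> r ^ n" "r ^ n \<le> 1" using r by (auto intro: power_le_one)
  have a: "cmod (I v - mean \<pi> v) \<le> \<bar>\<theta>\<bar> * (moment + moment\<^sup>2)"
    unfolding I_def by (rule eigen_minus_one_le[OF v])
  have b: "cmod (I u - 1) \<le> \<bar>\<theta>\<bar> * (moment + moment\<^sup>2)"
    using eigen_minus_one_le[OF u] unfolding I_def by (simp add: u_def)
  have "cmod (I v - of_real (r ^ n) * I u) \<le> (1 - r ^ n) * (\<bar>\<theta>\<bar> * (2 * moment + moment\<^sup>2))"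
    using eigen_iterate[OF small u] unfolding I_def r_def v_def .
  also have "\<dots> \<le> 1 * (\<bar>\<theta>\<bar> * (2 * moment + moment\<^sup>2))"
    using rn moment_ge(3) by (intro mult_right_mono) auto
  finally have c: "cmod (I v - of_real (r ^ n) * I u) \<le> \<bar>\<theta>\<bar> * (2 * moment + moment\<^sup>2)" by simp
  have "cmod (of_real (r ^ n) * (I u - 1)) \<le> 1 * cmod (I u - 1)"
    unfolding norm_mult norm_of_real using rn by (intro mult_right_mono) auto
  then have d: "cmod (of_real (r ^ n) * (I u - 1)) \<le> \<bar>\<theta>\<bar> * (moment + moment\<^sup>2)" using b by simp
  have "mean \<pi> v - of_real (r ^ n)
     = - (I v - mean \<pi> v) + ((I v - of_real (r ^ n) * I u) + of_real (r ^ n) * (I u - 1))"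
    by (simp add: algebra_simps)
  then have "cmod (mean \<pi> v - of_real (r ^ n))
     \<le> cmod (I v - mean \<pi> v) + (cmod (I v - of_real (r ^ n) * I u) + cmod (of_real (r ^ n) * (I u - 1)))"
    by (metis norm_triangle_ineq norm_minus_cancel add_left_mono order_trans)
  also have "\<dots> \<le> \<bar>\<theta>\<bar> * (moment + moment\<^sup>2) + (\<bar>\<theta>\<bar> * (2 * moment + moment\<^sup>2) + \<bar>\<theta>\<bar> * (moment + moment\<^sup>2))"
    using a c d by simp
  finally show ?thesis unfolding v_def u_def r_def by (simp add: algebra_simps)
qed

end

end

locale symmetric_refresh_process = refresh_process \<pi> p M Y + symmetric_refresh_chain \<pi> p f flip
  for \<pi> :: "'s::countable pmf" and p and M :: "'a measure" and Y f flip
begin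

definition partial_sum :: "nat \<Rightarrow> 'a \<Rightarrow> real" where
  "partial_sum n \<omega> = (\<Sum>k = 1..n. f (Y (int k) \<omega>))"

lemma partial_sum_measurable[measurable]: "partial_sum n \<in> borel_measurable M"
  unfolding partial_sum_def[abs_def] by (intro borel_measurable_sum state_function_measurable)

lemma partial_sum_eq_window: "partial_sum (Suc m) \<omega> = sum_list (map f (window Y 1 m \<omega>))"
proof -
  have "sum_list (map f (window Y 1 m \<omega>)) = (\<Sum>i<Suc m. f (Y (1 + int m - int i) \<omega>))"
    by (simp add: sum_list_sum_nth length_window nth_window atLeast0LessThan less_Suc_eq_le del: sum.lessThan_Suc)
  also have "\<dots> = partial_sum (Suc m) \<omega>"
    unfolding partial_sum_def
    by (rule sum.reindex_bij_witness[where i="\<lambda>k. Suc m - k" and j="\<lambda>i. Suc m - i"]) (auto simp: of_nat_diff)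
  finally show ?thesis ..
qed

lemma cf_partial_sum:
  assumes "\<bar>\<theta>\<bar> * moment \<le> 1" "n \<ge> 1"
  shows "cmod (expectation (\<lambda>\<omega>. cis (\<theta> * partial_sum n \<omega>)) - of_real ((1 - decay \<theta>) ^ n))
    \<le> \<bar>\<theta>\<bar> * (4 * moment + 3 * moment\<^sup>2)"
proof -
  obtain m where n: "n = Suc m" using assms(2) by (cases n) auto
  have "expectation (\<lambda>\<omega>. cis (\<theta> * partial_sum n \<omega>)) = expectation (\<lambda>\<omega>. (\<lambda>l. cis (\<theta> * sum_list (map f l))) (window Y 1 m \<omega>))"
    by (simp add: n partial_sum_eq_window)
  also have "\<dots> = mean (history m) (\<lambda>l. cis (\<theta> * sum_list (map f l)))"
    by (rule expectation_window)
  also have "\<dots> = mean \<pi> ((twisted_avg f \<theta> ^^ n) (\<lambda>_. 1))"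
    using expectation_history_cis[of "\<lambda>_. 1" m \<theta> f] by (simp only: n) simp
  finally show ?thesis using characteristic_approx[OF assms(1), of n] by simp
qed

end

section \<open>The Laplace law and the compound Poisson law\<close>

text \<open>The antiderivative of \<open>e^(z x)\<close> with \<open>z = i t - 1\<close> is \<open>e^(z x) / z\<close>, which vanishes at infinity.\<close>

lemma exponential_half_line:
  "set_integrable lborel {0<..} (\<lambda>x. exp (- x) *\<^sub>R iexp (t * x))"
  "(CLBINT x:{0<..}. exp (- x) *\<^sub>R iexp (t * x)) = 1 / (1 - \<i> * of_real t)"
proof -
  define z where "z = \<i> * of_real t - 1"
  have z: "z \<noteq> 0" by (auto simp: z_def complex_eq_iff)
  \<comment> \<open>A single complex exponential has an obvious antiderivative.\<close>
  have eq: "exp (- x) *\<^sub>R iexp (t * x) = exp (of_real x * z)" for x :: real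
    by (simp add: z_def scaleR_conv_of_real exp_of_real[symmetric] exp_add[symmetric] algebra_simps)
  have nrm: "cmod (exp (of_real x * z)) = exp (- x)" for x :: real
    by (simp add: z_def norm_exp_eq_Re)
  have int: "set_integrable lborel {0<..} (\<lambda>x. exp (of_real x * z))"
  proof (rule set_integrable_bound)
    show "set_integrable lborel {0<..} (\<lambda>x::real. exp (- (x * 1)))" by (rule integrable_I0i_exp_mscale) simp
    show "set_borel_measurable lborel {0<..} (\<lambda>x. exp (of_real x * z))" by (simp add: set_borel_measurable_def)
    show "AE x in lborel. x \<in> {0<..} \<longrightarrow> norm (exp (of_real x * z)) \<le> norm (exp (- (x * 1)))"
      unfolding nrm by simp
  qed
  then show "set_integrable lborel {0<..} (\<lambda>x. exp (- x) *\<^sub>R iexp (t * x))"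
    unfolding eq .
  have deriv: "((\<lambda>x. exp (of_real x * z) / z) has_vector_derivative exp (of_real x * z)) (at x)" for x :: real
  proof -
    have "((\<lambda>w. exp (w * z) / z) has_field_derivative exp (of_real x * z)) (at (of_real x))"
      using z by (auto intro!: derivative_eq_intros)
    from has_vector_derivative_real_field[OF this] show ?thesis .
  qed
  have E: "einterval 0 \<infinity> = {0::real<..}" by (auto simp: einterval_def)
  have "(LBINT x=0..\<infinity>. exp (of_real x * z)) = 0 - 1 / z"
  proof (rule interval_integral_FTC_integrable)
    show "((\<lambda>x. exp (of_real x * z) / z) has_vector_derivative exp (of_real x * z)) (at x)" for x :: real
      by (rule deriv)
    show "isCont (\<lambda>x. exp (of_real x * z)) x" for x :: real by (intro continuous_intros)
    show "set_integrable lborel (einterval 0 \<infinity>) (\<lambda>x. exp (of_real x * z))"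
      unfolding E by (rule int)
    have "isCont (\<lambda>x. exp (of_real x * z) / z) 0"
      by (rule has_vector_derivative_continuous) (rule deriv)
    then have "((\<lambda>x. exp (of_real x * z) / z) \<longlongrightarrow> exp (of_real 0 * z) / z) (at_right (0::real))"
      unfolding isCont_def by (rule tendsto_mono[OF at_le[OF subset_UNIV]])
    then show "(((\<lambda>x. exp (of_real x * z) / z) \<circ> real_of_ereal) \<longlongrightarrow> 1 / z) (at_right 0)"
      unfolding zero_ereal_def ereal_tendsto_simps1(2) by simp
    have "((\<lambda>x::real. exp (- x)) \<longlongrightarrow> 0) at_top"
      by (rule filterlim_compose[OF exp_at_bot filterlim_uminus_at_bot_at_top])
    then have "((\<lambda>x. exp (of_real x * z)) \<longlongrightarrow> 0) at_top"
      by (rule Lim_null_comparison[rotated]) (simp add: z_def)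
    then have "((\<lambda>x. exp (of_real x * z) / z) \<longlongrightarrow> 0 / z) at_top" using z by (rule tendsto_divide[OF _ tendsto_const])
    then show "(((\<lambda>x. exp (of_real x * z) / z) \<circ> real_of_ereal) \<longlongrightarrow> 0) (at_left \<infinity>)"
      unfolding ereal_tendsto_simps1(3) by simp
  qed simp
  moreover have "(LBINT x=0..\<infinity>. exp (of_real x * z)) = (CLBINT x:{0<..}. exp (of_real x * z))"
    by (simp add: interval_lebesgue_integral_def E)
  ultimately show "(CLBINT x:{0<..}. exp (- x) *\<^sub>R iexp (t * x)) = 1 / (1 - \<i> * of_real t)"
    unfolding eq by (simp add: z_def minus_divide_right)
qed

lemma sets_laplace_law[measurable_cong]: "sets laplace_law = sets borel"
  by (simp add: laplace_law_def)

lemma char_laplace_law: "char laplace_law t = of_real (1 / (1 + t\<^sup>2))"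
proof -
  let ?g = "\<lambda>t x. exp (- x) *\<^sub>R iexp (t * x)"
  define P where "P t x = indicat_real {0<..} x *\<^sub>R ?g t x" for t x
  have intP: "integrable lborel (P t)" for t
    using exponential_half_line(1)[of t] by (simp add: set_integrable_def P_def[abs_def])
  have valP: "integral\<^sup>L lborel (P t) = 1 / (1 - \<i> * of_real t)" for t
    using exponential_half_line(2)[of t] by (simp add: set_lebesgue_integral_def P_def[abs_def])
  have intP': "integrable lborel (\<lambda>x. P t (- x))" for t
    using lborel_integrable_real_affine[OF intP[of t], of "-1" 0] by simp
  have valP': "(CLBINT x. P t (- x)) = 1 / (1 - \<i> * of_real t)" for t
    using lborel_integral_real_affine[of "-1" "P t" 0] valP by simp
  have "char laplace_law t = (CLBINT x. (1 / 2 * exp (- \<bar>x\<bar>)) *\<^sub>R iexp (t * x))"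
    unfolding char_def laplace_law_def by (subst integral_density) auto
  also have "\<dots> = (CLBINT x. (1 / 2) *\<^sub>R (P t x + P (- t) (- x)))"
  proof (rule integral_cong_AE)
    have "AE x in lborel. x \<noteq> (0::real)" by (rule AE_lborel_singleton)
    then show "AE x in lborel. (1 / 2 * exp (- \<bar>x\<bar>)) *\<^sub>R iexp (t * x) = (1 / 2) *\<^sub>R (P t x + P (- t) (- x))"
      by eventually_elim (auto simp: P_def indicator_def abs_if)
  qed (auto simp: P_def)
  also have "\<dots> = (1 / 2) *\<^sub>R (1 / (1 - \<i> * of_real t) + 1 / (1 - \<i> * of_real (- t)))"
    by (simp only: integral_scaleR_right Bochner_Integration.integral_add[OF intP intP'] valP valP')
  also have "\<dots> = of_real (1 / (1 + t\<^sup>2))"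
  proof -
    have "1 + t\<^sup>2 > 0" by (simp add: add_pos_nonneg)
    then have "of_real (1 + t\<^sup>2) \<noteq> (0::complex)" by (simp only: of_real_eq_0_iff)
    then have nz: "1 - \<i> * of_real t \<noteq> 0" "1 + \<i> * of_real t \<noteq> 0" "1 + (of_real t)\<^sup>2 \<noteq> (0::complex)"
      by (auto simp: complex_eq_iff)
    have "(1 - \<i> * of_real t) * (1 + \<i> * of_real t) = 1 + (of_real t)\<^sup>2"
      by (simp add: algebra_simps power2_eq_square)
    then have "1 / (1 - \<i> * of_real t) + 1 / (1 + \<i> * of_real t) = 2 / (1 + (of_real t)\<^sup>2)"
      using nz by (simp add: add_frac_eq)
    then show ?thesis by (simp add: scaleR_conv_of_real)
  qed
  finally show ?thesis .
qed

text \<open>Given \<open>N\<close>, the characteristic function is \<open>z^N\<close> with \<open>z = 1 / (1 + t\<^sup>2)\<close>, and the generating function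
of the Poisson law at \<open>z\<close> is \<open>exp (z - 1)\<close>.\<close>

lemma char_mu_P1sL: "char mu_P1sL t = of_real (exp (- (t\<^sup>2 / (1 + t\<^sup>2))))"
proof -
  interpret L: product_prob_space "\<lambda>_::nat. laplace_law" "{1..}"
    by (rule product_prob_spaceI) (rule prob_space_laplace_law)
  interpret E: prob_space "\<Pi>\<^sub>M k\<in>{1::nat..}. laplace_law"
    by (rule L.prob_space_axioms)
  interpret pair: pair_prob_space "measure_pmf (poisson_pmf 1)" "\<Pi>\<^sub>M k\<in>{1::nat..}. laplace_law" ..
  define z where "z = 1 / (1 + t\<^sup>2)"
  have comp: "(\<lambda>\<eta>. \<eta> k) \<in> borel_measurable (\<Pi>\<^sub>M k\<in>J. laplace_law)" if "k \<in> J" for k and J :: "nat set"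
    using measurable_component_singleton[OF that, of "\<lambda>_. laplace_law"]
    by (simp only: measurable_cong_sets[OF refl sets_laplace_law])
  have sum_m: "(\<lambda>\<eta>. \<Sum>k = 1..N. \<eta> k) \<in> borel_measurable (\<Pi>\<^sub>M k\<in>{1::nat..}. laplace_law)" for N :: nat
    by (intro borel_measurable_sum comp) simp
  have m: "(\<lambda>(N, \<eta>). \<Sum>k = 1..N. \<eta> k) \<in>
      borel_measurable (measure_pmf (poisson_pmf 1) \<Otimes>\<^sub>M (\<Pi>\<^sub>M k\<in>{1::nat..}. laplace_law))"
  proof -
    have "(\<lambda>p. (\<lambda>(N, \<eta>). \<Sum>k = 1..N. \<eta> k) p) \<in>
      borel_measurable (count_space UNIV \<Otimes>\<^sub>M (\<Pi>\<^sub>M k\<in>{1::nat..}. laplace_law))"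
      by (intro measurable_pair_measure_countable1) (use sum_m in simp_all)
    then show ?thesis
      using measurable_cong_sets[OF sets_pair_measure_cong[OF sets_measure_pmf_count_space refl] refl] by simp
  qed
  have inner: "(CLINT \<eta>|\<Pi>\<^sub>M k\<in>{1::nat..}. laplace_law. iexp (t * (\<Sum>k = 1..N. \<eta> k))) = of_real (z ^ N)" for N :: nat
  proof -
    have J: "{1..N} \<subseteq> {1..}" by auto
    have restr: "distr (\<Pi>\<^sub>M k\<in>{1::nat..}. laplace_law) (\<Pi>\<^sub>M k\<in>{1..N}. laplace_law) (\<lambda>\<eta>. restrict \<eta> {1..N})
      = (\<Pi>\<^sub>M k\<in>{1..N}. laplace_law)"
      using L.distr_PiM_restrict_finite[OF _ J] by simp
    have "(CLINT \<eta>|\<Pi>\<^sub>M k\<in>{1::nat..}. laplace_law. iexp (t * (\<Sum>k = 1..N. \<eta> k)))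
       = (CLINT \<eta>|\<Pi>\<^sub>M k\<in>{1::nat..}. laplace_law. (\<lambda>\<eta>. \<Prod>k\<in>{1..N}. iexp (t * \<eta> k)) (restrict \<eta> {1..N}))"
      by (intro Bochner_Integration.integral_cong) (auto simp: exp_sum[symmetric] sum_distrib_left)
    also have "\<dots> = (CLINT \<eta>|\<Pi>\<^sub>M k\<in>{1..N}. laplace_law. \<Prod>k\<in>{1..N}. iexp (t * \<eta> k))"
    proof -
      have "(CLINT \<eta>|\<Pi>\<^sub>M k\<in>{1..N}. laplace_law. \<Prod>k\<in>{1..N}. iexp (t * \<eta> k))
        = (CLINT \<eta>|distr (\<Pi>\<^sub>M k\<in>{1::nat..}. laplace_law) (\<Pi>\<^sub>M k\<in>{1..N}. laplace_law) (\<lambda>\<eta>. restrict \<eta> {1..N}).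
            \<Prod>k\<in>{1..N}. iexp (t * \<eta> k))"
        by (simp only: restr)
      also have "\<dots> = (CLINT \<eta>|\<Pi>\<^sub>M k\<in>{1::nat..}. laplace_law. (\<lambda>\<eta>. \<Prod>k\<in>{1..N}. iexp (t * \<eta> k)) (restrict \<eta> {1..N}))"
      proof (rule integral_distr)
        show "(\<lambda>\<eta>. restrict \<eta> {1..N}) \<in> (\<Pi>\<^sub>M k\<in>{1..}. laplace_law) \<rightarrow>\<^sub>M (\<Pi>\<^sub>M k\<in>{1..N}. laplace_law)"
          by (rule measurable_restrict_subset[OF J])
        show "(\<lambda>\<eta>. \<Prod>k\<in>{1..N}. iexp (t * \<eta> k)) \<in> borel_measurable (\<Pi>\<^sub>M k\<in>{1..N}. laplace_law)"
        proof (rule borel_measurable_prod)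
          fix k assume "k \<in> {1..N}"
          note comp[OF this, measurable]
          show "(\<lambda>\<eta>. iexp (t * \<eta> k)) \<in> borel_measurable (\<Pi>\<^sub>M k\<in>{1..N}. laplace_law)" by measurable
        qed
      qed
      finally show ?thesis ..
    qed
    also have "\<dots> = (\<Prod>k\<in>{1..N}. CLINT x|laplace_law. iexp (t * x))"
    proof (rule L.product_integral_prod)
      show "integrable laplace_law (\<lambda>x. iexp (t * x))"
        by (rule finite_measure.integrable_const_bound[OF prob_space.axioms(1)[OF prob_space_laplace_law], of _ 1]) auto
    qed auto
    also have "\<dots> = of_real (z ^ N)"
      using char_laplace_law[of t] by (simp add: char_def z_def)
    finally show ?thesis .
  qed
  have "char mu_P1sL t = (CLINT p|measure_pmf (poisson_pmf 1) \<Otimes>\<^sub>M (\<Pi>\<^sub>M k\<in>{1::nat..}. laplace_law).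
      (\<lambda>(N, \<eta>). iexp (t * (\<Sum>k = 1..N. \<eta> k))) p)"
    unfolding char_def mu_P1sL_def by (subst integral_distr[OF m]) (auto simp: case_prod_unfold)
  also have "\<dots> = (CLINT N|measure_pmf (poisson_pmf 1). CLINT \<eta>|\<Pi>\<^sub>M k\<in>{1::nat..}. laplace_law. iexp (t * (\<Sum>k = 1..N. \<eta> k)))"
  proof (rule pair.integral_fst[symmetric])
    show "integrable (measure_pmf (poisson_pmf 1) \<Otimes>\<^sub>M (\<Pi>\<^sub>M k\<in>{1::nat..}. laplace_law)) (\<lambda>(N, \<eta>). iexp (t * (\<Sum>k = 1..N. \<eta> k)))"
    proof (rule pair.integrable_const_bound[of _ 1])
      have "(\<lambda>p. iexp (t * (case p of (N, \<eta>) \<Rightarrow> \<Sum>k = 1..N. \<eta> k))) \<in>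
        borel_measurable (measure_pmf (poisson_pmf 1) \<Otimes>\<^sub>M (\<Pi>\<^sub>M k\<in>{1::nat..}. laplace_law))"
        using m by measurable
      then show "(\<lambda>(N, \<eta>). iexp (t * (\<Sum>k = 1..N. \<eta> k))) \<in>
        borel_measurable (measure_pmf (poisson_pmf 1) \<Otimes>\<^sub>M (\<Pi>\<^sub>M k\<in>{1::nat..}. laplace_law))"
        by (simp add: case_prod_unfold)
    qed auto
  qed
  also have "\<dots> = (CLINT N|measure_pmf (poisson_pmf 1). of_real (z ^ N))"
    by (simp only: inner)
  also have "\<dots> = of_real (mean (poisson_pmf 1) (\<lambda>N. z ^ N))"
    by (rule integral_complex_of_real)
  also have "mean (poisson_pmf 1) (\<lambda>N. z ^ N) = exp (z - 1)"
  proof -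
    have "1 + t\<^sup>2 > 0" by (simp add: add_pos_nonneg)
    then have z: "0 \<le> z" "z \<le> 1" by (auto simp: z_def divide_le_eq)
    have "(\<lambda>N. z ^ N / fact N * exp (- 1)) sums (exp z * exp (-1))"
      using exp_converges[of z] by (intro sums_mult2) (simp add: divide_inverse mult.commute scaleR_conv_of_real)
    then have s: "(\<lambda>N. pmf (poisson_pmf 1) N * z ^ N) sums (exp (z - 1))"
      by (simp add: exp_diff exp_minus divide_inverse mult_ac)
    have "mean (poisson_pmf 1) (\<lambda>N. z ^ N) = (LINT N|count_space UNIV. pmf (poisson_pmf 1) N * z ^ N)"
      unfolding measure_pmf_eq_density by (subst integral_density) auto
    also have "\<dots> = (\<Sum>N. pmf (poisson_pmf 1) N * z ^ N)"
    proof (rule integral_count_space_nat)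
      show "integrable (count_space UNIV) (\<lambda>N. pmf (poisson_pmf 1) N * z ^ N)"
        unfolding integrable_count_space_nat_iff using z s by (auto simp: sums_iff)
    qed
    finally show ?thesis using s by (simp add: sums_iff)
  qed
  also have "z - 1 = - (t\<^sup>2 / (1 + t\<^sup>2))"
  proof -
    have "1 + t\<^sup>2 > 0" by (simp add: add_pos_nonneg)
    then show ?thesis unfolding z_def by (simp add: field_simps)
  qed
  finally show ?thesis .
qed

section \<open>Concentration and variance\<close>

context prob_space
begin

text \<open>The function \<open>1 / (1 + y\<^sup>2)\<close> is at least \<open>1/2\<close> for \<open>\<bar>y\<bar> \<le> 1\<close>, and it is the characteristic function of
the Laplace law. By Fubini, its mean at \<open>y = (Z - r) / b\<close> is an average of the characteristic
function of \<open>Z\<close>, and the dependence on \<open>r\<close> is only in factors of modulus \<open>1\<close>.\<close>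

lemma concentration_le:
  assumes [measurable]: "Z \<in> borel_measurable M" and b: "b > 0"
  shows "prob {\<omega> \<in> space M. r - b < Z \<omega> \<and> Z \<omega> < r + b}
    \<le> 2 * (LINT x|laplace_law. cmod (expectation (\<lambda>\<omega>. cis (x / b * Z \<omega>))))"
proof -
  interpret Lp: prob_space laplace_law by (rule prob_space_laplace_law)
  interpret pair: pair_prob_space M laplace_law ..
  define A where "A = {\<omega> \<in> space M. r - b < Z \<omega> \<and> Z \<omega> < r + b}"
  have A[measurable]: "A \<in> events" by (simp add: A_def)
  define y where "y \<omega> = (Z \<omega> - r) / b" for \<omega>
  have [measurable]: "y \<in> borel_measurable M" by (simp add: y_def[abs_def])
  have int: "integrable M (\<lambda>\<omega>. 1 / (1 + (y \<omega>)\<^sup>2))"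
  proof (rule integrable_const_bound[of _ 1])
    have "0 < 1 + (y \<omega>)\<^sup>2" for \<omega> by (simp add: add_pos_nonneg)
    then show "AE \<omega> in M. norm (1 / (1 + (y \<omega>)\<^sup>2)) \<le> 1" by (intro AE_I2) (simp add: divide_le_eq abs_of_pos)
  qed simp
  have "prob A = expectation (indicator A)" by simp
  also have "\<dots> \<le> expectation (\<lambda>\<omega>. 2 * (1 / (1 + (y \<omega>)\<^sup>2)))"
  proof (intro integral_mono)
    show "integrable M (\<lambda>\<omega>. 2 * (1 / (1 + (y \<omega>)\<^sup>2)))" using int by (rule integrable_mult_right)
    fix \<omega> assume "\<omega> \<in> space M"
    show "indicat_real A \<omega> \<le> 2 * (1 / (1 + (y \<omega>)\<^sup>2))"
    proof (cases "\<omega> \<in> A")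
      case True
      then have "\<bar>y \<omega>\<bar> \<le> 1" using b by (auto simp: A_def y_def abs_le_iff field_simps)
      then have "(y \<omega>)\<^sup>2 \<le> 1" by (simp add: abs_square_le_1)
      then show ?thesis using True by (simp add: le_divide_eq add_pos_nonneg)
    qed (simp add: add_nonneg_nonneg)
  qed (auto intro!: integrable_real_indicator simp: emeasure_eq_measure)
  finally have 1: "prob A \<le> 2 * expectation (\<lambda>\<omega>. 1 / (1 + (y \<omega>)\<^sup>2))"
    unfolding integral_mult_right_zero .
  have "expectation (\<lambda>\<omega>. 1 / (1 + (y \<omega>)\<^sup>2)) \<le> cmod (of_real (expectation (\<lambda>\<omega>. 1 / (1 + (y \<omega>)\<^sup>2))))"
    by simp
  also have "of_real (expectation (\<lambda>\<omega>. 1 / (1 + (y \<omega>)\<^sup>2))) = (CLINT \<omega>|M. CLINT x|laplace_law. cis (y \<omega> * x))"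
    unfolding integral_complex_of_real[symmetric] char_laplace_law[symmetric] char_def
    by (simp add: cis_conv_exp)
  also have "\<dots> = (CLINT x|laplace_law. CLINT \<omega>|M. cis (y \<omega> * x))"
  proof (rule pair.Fubini_integral[symmetric])
    have "(\<lambda>p. cis (y (fst p) * snd p)) \<in> borel_measurable (M \<Otimes>\<^sub>M laplace_law)"
      unfolding cis_conv_exp by measurable
    then show "integrable (M \<Otimes>\<^sub>M laplace_law) (\<lambda>(\<omega>, x). cis (y \<omega> * x))"
      by (intro pair.integrable_const_bound[of _ 1]) (auto simp: case_prod_unfold)
  qed
  also have "cmod \<dots> \<le> (LINT x|laplace_law. cmod (CLINT \<omega>|M. cis (y \<omega> * x)))"
    by (rule integral_norm_bound)
  also have "\<dots> = (LINT x|laplace_law. cmod (expectation (\<lambda>\<omega>. cis (x / b * Z \<omega>))))"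
  proof (intro Bochner_Integration.integral_cong refl)
    fix x
    have "(CLINT \<omega>|M. cis (y \<omega> * x)) = (CLINT \<omega>|M. cis (- x * r / b) * cis (x / b * Z \<omega>))"
      by (intro Bochner_Integration.integral_cong) (auto simp: cis_mult y_def field_simps diff_divide_distrib)
    also have "\<dots> = cis (- x * r / b) * expectation (\<lambda>\<omega>. cis (x / b * Z \<omega>))" by simp
    finally show "cmod (CLINT \<omega>|M. cis (y \<omega> * x)) = cmod (expectation (\<lambda>\<omega>. cis (x / b * Z \<omega>)))"
      by (simp add: norm_mult)
  qed
  finally show ?thesis using 1 unfolding A_def by simp
qed

lemma concentration_tendsto_0:
  fixes Z :: "nat \<Rightarrow> 'a \<Rightarrow> real"
  assumes meas[measurable]: "\<And>n. Z n \<in> borel_measurable M" and b: "b > 0"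
    and cf: "\<And>t. t \<noteq> 0 \<Longrightarrow> (\<lambda>n. expectation (\<lambda>\<omega>. cis (t * Z n \<omega>))) \<longlonglongrightarrow> 0"
  shows "(\<lambda>n. SUP r. prob {\<omega> \<in> space M. r - b < Z n \<omega> \<and> Z n \<omega> < r + b}) \<longlonglongrightarrow> 0"
proof -
  interpret Lp: prob_space laplace_law by (rule prob_space_laplace_law)
  let ?g = "\<lambda>n x. cmod (expectation (\<lambda>\<omega>. cis (x / b * Z n \<omega>)))"
  have g1: "?g n x \<le> 1" for n x
  proof -
    have "?g n x \<le> expectation (\<lambda>\<omega>. cmod (cis (x / b * Z n \<omega>)))" by (rule integral_norm_bound)
    then show ?thesis by (simp add: prob_space)
  qed
  have meas_g: "(\<lambda>x. ?g n x) \<in> borel_measurable laplace_law" for n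
  proof -
    have "(\<lambda>p. cis (fst p / b * Z n (snd p))) \<in> borel_measurable (laplace_law \<Otimes>\<^sub>M M)"
      unfolding cis_conv_exp by measurable
    then have "(\<lambda>x. expectation (\<lambda>\<omega>. cis (x / b * Z n \<omega>))) \<in> borel_measurable laplace_law"
      by (intro borel_measurable_lebesgue_integral) (simp add: case_prod_unfold)
    then show ?thesis by measurable
  qed
  have "(\<lambda>n. LINT x|laplace_law. ?g n x) \<longlonglongrightarrow> (LINT x|laplace_law. 0)"
  proof (rule integral_dominated_convergence[where w="\<lambda>_. 1"])
    have "AE x in lborel. x \<noteq> (0::real)" by (rule AE_lborel_singleton)
    then have "AE x in laplace_law. x \<noteq> 0"
      unfolding laplace_law_def by (subst AE_density) auto
    then show "AE x in laplace_law. (\<lambda>n. ?g n x) \<longlonglongrightarrow> 0"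
    proof eventually_elim
      case (elim x)
      then show ?case using cf[of "x / b"] b by (intro tendsto_norm_zero) simp
    qed
  qed (use g1 meas_g in auto)
  then have lim: "(\<lambda>n. 2 * (LINT x|laplace_law. ?g n x)) \<longlonglongrightarrow> 0"
    by (auto intro: tendsto_mult_right_zero)
  show ?thesis
  proof (rule tendsto_sandwich[OF _ _ tendsto_const lim])
    have "(SUP r. prob {\<omega> \<in> space M. r - b < Z n \<omega> \<and> Z n \<omega> < r + b}) \<le> 2 * (LINT x|laplace_law. ?g n x)" for n
      by (rule cSUP_least, simp, rule concentration_le[OF meas b])
    then show "\<forall>\<^sub>F n in sequentially. (SUP r. prob {\<omega> \<in> space M. r - b < Z n \<omega> \<and> Z n \<omega> < r + b}) \<le> 2 * (LINT x|laplace_law. ?g n x)"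
      by simp
    have "0 \<le> (SUP r. prob {\<omega> \<in> space M. r - b < Z n \<omega> \<and> Z n \<omega> < r + b})" for n
      by (rule cSUP_upper2[of _ _ 0]) (auto intro!: bdd_aboveI[of _ 1])
    then show "\<forall>\<^sub>F n in sequentially. 0 \<le> (SUP r. prob {\<omega> \<in> space M. r - b < Z n \<omega> \<and> Z n \<omega> < r + b})"
      by simp
  qed
qed

text \<open>If the variance of \<open>S\<^sub>n / sqrt n\<close> were at most \<open>C\<close>, then by Chebyshev's inequality an
interval of length \<open>2 sqrt (2 C)\<close> would carry at least half of its mass.\<close>

lemma variance_unbounded:
  fixes S :: "nat \<Rightarrow> 'a \<Rightarrow> real"
  assumes [measurable]: "\<And>n. S n \<in> borel_measurable M" and sq: "\<And>n. integrable M (\<lambda>\<omega>. (S n \<omega>)\<^sup>2)"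
    and conc: "\<And>b. b > 0 \<Longrightarrow> (\<lambda>n. SUP r. prob {\<omega> \<in> space M. r - b < S n \<omega> / sqrt (real n) \<and> S n \<omega> / sqrt (real n) < r + b}) \<longlonglongrightarrow> 0"
  shows "filterlim (\<lambda>n. variance (S n) / real n) at_top sequentially"
  unfolding filterlim_at_top_gt[where c=0]
proof (intro allI impI)
  fix C :: real assume C: "0 < C"
  define b where "b = sqrt (2 * C)"
  have b: "b > 0" "b\<^sup>2 = 2 * C" using C by (auto simp: b_def)
  have "\<forall>\<^sub>F n in sequentially. (SUP r. prob {\<omega> \<in> space M. r - b < S n \<omega> / sqrt (real n) \<and> S n \<omega> / sqrt (real n) < r + b}) < 1 / 2"
    using conc[OF b(1)] by (rule order_tendstoD) simp
  then show "\<forall>\<^sub>F n in sequentially. C \<le> variance (S n) / real n"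
    using eventually_gt_at_top[of 0]
  proof eventually_elim
    case (elim n)
    show ?case
    proof (rule ccontr)
      assume "\<not> ?thesis"
      then have v: "variance (S n) < C * real n" using elim(2) by (simp add: field_simps)
      \<comment> \<open>The square of \<open>a\<close> is \<open>2 C n\<close>, so that Chebyshev's inequality gives a probability below \<open>1/2\<close>.\<close>
      define a where "a = b * sqrt (real n)"
      have a: "a > 0" "a\<^sup>2 = 2 * C * real n" using b elim(2) by (auto simp: a_def power_mult_distrib)
      define D where "D = {\<omega> \<in> space M. a \<le> \<bar>S n \<omega> - expectation (S n)\<bar>}"
      have [measurable]: "D \<in> events" by (simp add: D_def)
      have "prob D \<le> variance (S n) / a\<^sup>2"
        unfolding D_def by (rule Chebyshev_inequality) (use sq a in auto)
      also have "\<dots> < 1 / 2" using v C elim(2) by (simp add: a divide_less_eq)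
      finally have "1 / 2 < prob (space M - D)" by (simp add: prob_compl)
      define r where "r = expectation (S n) / sqrt (real n)"
      let ?B = "\<lambda>r. {\<omega> \<in> space M. r - b < S n \<omega> / sqrt (real n) \<and> S n \<omega> / sqrt (real n) < r + b}"
      have "space M - D \<subseteq> ?B r"
      proof
        fix \<omega> assume "\<omega> \<in> space M - D"
        then have w: "\<omega> \<in> space M" "\<bar>S n \<omega> - expectation (S n)\<bar> < b * sqrt (real n)" by (auto simp: D_def a_def)
        have "\<bar>S n \<omega> / sqrt (real n) - r\<bar> = \<bar>S n \<omega> - expectation (S n)\<bar> / sqrt (real n)"
          by (simp add: r_def diff_divide_distrib[symmetric])
        also have "\<dots> < b" using w(2) elim(2) by (simp add: divide_less_eq)
        finally show "\<omega> \<in> ?B r" using w(1) by (auto simp: abs_less_iff)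
      qed
      then have "prob (space M - D) \<le> prob (?B r)" by (intro finite_measure_mono) auto
      also have "\<dots> \<le> (SUP r. prob (?B r))"
        by (rule cSUP_upper) (auto intro!: bdd_aboveI[of _ 1])
      finally show False using \<open>1 / 2 < prob (space M - D)\<close> elim(1) by simp
    qed
  qed
qed

end

section \<open>The chain with countably many levels\<close>

lemma integral_nat_pmf:
  fixes g :: "nat \<Rightarrow> real"
  assumes "summable (\<lambda>j. pmf L j * \<bar>g j\<bar>)"
  shows "integrable (measure_pmf L) g" "mean L g = (\<Sum>j. pmf L j * g j)"
proof -
  have int: "integrable (count_space UNIV) (\<lambda>j. pmf L j * g j)"
    unfolding integrable_count_space_nat_iff using assms by (simp add: abs_mult)
  show "integrable (measure_pmf L) g"
    unfolding measure_pmf_eq_density using int by (subst integrable_density) auto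
  show "mean L g = (\<Sum>j. pmf L j * g j)"
    unfolding measure_pmf_eq_density using int
    by (subst integral_density) (auto intro: integral_count_space_nat)
qed

text \<open>The refresh probability at level \<open>j\<close>. The quadratic exponent makes the variances
\<open>2^(-j) / slow j\<close> of the levels grow so fast that each dominates the sum of the lower ones.\<close>

definition slow :: "nat \<Rightarrow> real" where "slow j = (1 / 2) ^ (j\<^sup>2)"

lemma slow_pos: "0 < slow j" and slow_le_1: "slow j \<le> 1"
  by (auto simp: slow_def power_le_one)

lemma slow_antimono: "i \<le> j \<Longrightarrow> slow j \<le> slow i"
  unfolding slow_def by (intro power_decreasing) (auto simp: power2_nat_le_eq_le)

lemma slow_halving: "i < j \<Longrightarrow> 2 * slow j \<le> slow i"
proof -
  assume "i < j"
  then have "i\<^sup>2 < j\<^sup>2" by (simp add: power_strict_mono)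
  then have "(1 / 2 :: real) ^ (j\<^sup>2) \<le> (1 / 2) ^ Suc (i\<^sup>2)" by (intro power_decreasing) auto
  then show ?thesis by (simp add: slow_def)
qed

lemma slow_le_half_power: "slow j \<le> (1 / 2) ^ j"
  unfolding slow_def by (intro power_decreasing) (auto simp: power2_eq_square)

lemma slow_eq_1_iff: "slow j = 1 \<longleftrightarrow> j = 0"
  using slow_halving[of 0 j] slow_pos[of j] by (cases "j = 0") (auto simp: slow_def)

lemma slow_Suc: "slow (Suc j) = slow j * (1 / 2) ^ (2 * j + 1)"
  unfolding slow_def power_add[symmetric] by (rule arg_cong[where f="\<lambda>k. (1/2) ^ k"]) (simp add: power2_eq_square)

lemma slow_less_iff: "slow i < slow j \<longleftrightarrow> j < i"
  using slow_antimono[of i j] slow_halving[of j i] slow_pos[of i] by (cases "j < i") auto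

text \<open>For \<open>j \<ge> 1\<close>, \<open>q j\<close> is the stationary probability of level \<open>j\<close>; the value \<open>q 0\<close> only starts the
geometric decay, and level \<open>0\<close> receives the remaining mass \<open>weight0\<close>.\<close>

locale level_parameters =
  fixes q :: "nat \<Rightarrow> real"
  assumes q_pos: "0 < q j" and q_Suc: "q (Suc j) \<le> q j / 4"
    and q_le_slow: "q j \<le> slow j ^ 4" and q_0: "q 0 \<le> 1 / 4"
begin

lemma q_add: "q (j + i) \<le> q j * (1 / 4) ^ i"
proof (induction i)
  case (Suc i)
  have "q (j + Suc i) \<le> q (j + i) / 4" using q_Suc[of "j + i"] by simp
  also have "\<dots> \<le> q j * (1 / 4) ^ i / 4" using Suc.IH by (rule divide_right_mono) simp
  finally show ?case by simp
qed simp

lemma q_le: "q j \<le> (1 / 4) ^ Suc j"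
proof -
  have "q 0 * (1 / 4) ^ j \<le> 1 / 4 * (1 / 4) ^ j" by (rule mult_right_mono[OF q_0]) simp
  then show ?thesis using q_add[of 0 j] unfolding power_Suc add_0 by (rule order_trans[rotated])
qed

lemma q_le_1: "q j \<le> 1"
  using q_le[of j] power_le_one[of "1/4::real" "Suc j"] by simp

lemma summable_q: "summable q"
  by (rule summable_comparison_test'[of "\<lambda>j. (1 / 4) ^ Suc j" 0])
     (use q_le q_pos in \<open>auto simp: less_imp_le intro!: summable_mult summable_geometric\<close>)

lemma q_tail: "(\<Sum>i. q (i + Suc m)) \<le> q m"
proof -
  have s: "summable (\<lambda>i. q m * (1 / 4) ^ Suc i)"
    by (intro summable_mult) (simp add: summable_geometric)
  have "(\<Sum>i. q (i + Suc m)) \<le> (\<Sum>i. q m * (1 / 4) ^ Suc i)"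
  proof (rule suminf_le)
    show "q (i + Suc m) \<le> q m * (1 / 4) ^ Suc i" for i using q_add[of m "Suc i"] by (simp add: add.commute)
    show "summable (\<lambda>i. q (i + Suc m))" using summable_q by (rule summable_ignore_initial_segment)
  qed (rule s)
  also have "\<dots> = q m * (\<Sum>i. (1 / 4) ^ Suc i)"
    by (rule suminf_mult) (simp add: summable_geometric)
  also have "(\<Sum>i. (1 / 4 :: real) ^ Suc i) = 1 / 3"
    using suminf_mult[OF summable_geometric[of "1/4::real"], of "1/4"] suminf_geometric[of "1/4::real"] by simp
  finally show ?thesis using q_pos[of m] by simp
qed

definition weight0 :: real where "weight0 = 1 - (\<Sum>i. q (Suc i))"

lemma weight0_ge: "3 / 4 \<le> weight0"
  using q_tail[of 0] q_0 by (simp add: weight0_def)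

definition levels :: "nat pmf" where
  "levels = embed_pmf (\<lambda>j. if j = 0 then weight0 else q j)"

lemma pmf_levels: "pmf levels j = (if j = 0 then weight0 else q j)"
  unfolding levels_def
proof (rule pmf_embed_pmf)
  show nonneg: "0 \<le> (if j = 0 then weight0 else q j)" for j
    using weight0_ge q_pos by (simp add: less_imp_le)
  have s: "(\<lambda>i. q (Suc i)) sums (1 - weight0)"
    using summable_q by (simp add: weight0_def summable_Suc_iff summable_sums)
  then have "(\<lambda>j. if j = 0 then weight0 else q j) sums (1 - weight0 + weight0)"
    by (subst sums_Suc_iff[symmetric, where f="\<lambda>j. if j = 0 then weight0 else q j", simplified]) simp
  then have "(\<Sum>j. ennreal (if j = 0 then weight0 else q j)) = ennreal 1"
    by (intro suminf_ennreal_eq nonneg) simp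
  then show "(\<integral>\<^sup>+j. ennreal (if j = 0 then weight0 else q j) \<partial>count_space UNIV) = 1"
    by (simp add: nn_integral_count_space_nat)
qed

text \<open>The level of a state is its absolute value, and the sign is a fair coin.\<close>

definition states :: "int pmf" where
  "states = map_pmf (\<lambda>(j, b). if b then int j else - int j) (pair_pmf levels (bernoulli_pmf (1 / 2)))"

definition speed :: "int \<Rightarrow> real" where "speed s = slow (nat \<bar>s\<bar>)"

text \<open>The second moment of level \<open>j\<close> is \<open>q j * height j ^ 2 = 2^(-j)\<close>, which is summable, whereas its
contribution to the asymptotic variance is larger by the factor \<open>1 / slow j\<close>.\<close>

definition height :: "nat \<Rightarrow> real" where
  "height j = (if j = 0 then 0 else sqrt ((1 / 2) ^ j / q j))"

definition value_of :: "int \<Rightarrow> real" where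
  "value_of s = of_int (sgn s) * height (nat \<bar>s\<bar>)"

lemma map_abs_states: "map_pmf (\<lambda>s. nat \<bar>s\<bar>) states = levels"
proof -
  have "map_pmf (\<lambda>s. nat \<bar>s\<bar>) states = map_pmf fst (pair_pmf levels (bernoulli_pmf (1 / 2)))"
    unfolding states_def pmf.map_comp by (rule map_pmf_cong) auto
  then show ?thesis by (simp add: map_fst_pair_pmf)
qed

lemma map_uminus_states: "map_pmf uminus states = states"
proof -
  have coin: "map_pmf Not (bernoulli_pmf (1 / 2)) = bernoulli_pmf (1 / 2)"
  proof (rule pmf_eqI)
    fix b
    have "pmf (map_pmf Not (bernoulli_pmf (1 / 2))) (\<not> \<not> b) = pmf (bernoulli_pmf (1 / 2)) (\<not> b)"
      by (rule pmf_map_inj') (auto simp: inj_def)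
    then show "pmf (map_pmf Not (bernoulli_pmf (1 / 2))) b = pmf (bernoulli_pmf (1 / 2)) b"
      by (cases b) auto
  qed
  have "map_pmf uminus states = map_pmf (\<lambda>(j, b). if b then int j else - int j)
      (map_pmf (\<lambda>(j, b). (j, \<not> b)) (pair_pmf levels (bernoulli_pmf (1 / 2))))"
    unfolding states_def pmf.map_comp by (rule map_pmf_cong) auto
  also have "map_pmf (\<lambda>(j, b). (j, \<not> b)) (pair_pmf levels (bernoulli_pmf (1 / 2))) = pair_pmf levels (bernoulli_pmf (1 / 2))"
    using map_pair[of "\<lambda>j. j" Not levels "bernoulli_pmf (1/2)"] by (simp add: coin pmf.map_ident)
  finally show ?thesis by (simp add: states_def)
qed

lemma expectation_even:
  fixes g :: "nat \<Rightarrow> real"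
  assumes "summable (\<lambda>j. pmf levels j * \<bar>g j\<bar>)"
  shows "integrable (measure_pmf states) (\<lambda>s. g (nat \<bar>s\<bar>))"
    "mean states (\<lambda>s. g (nat \<bar>s\<bar>)) = (\<Sum>j. pmf levels j * g j)"
proof -
  have "integrable (measure_pmf (map_pmf (\<lambda>s. nat \<bar>s\<bar>) states)) g"
    unfolding map_abs_states by (rule integral_nat_pmf(1)[OF assms])
  then show "integrable (measure_pmf states) (\<lambda>s. g (nat \<bar>s\<bar>))" by simp
  have "mean states (\<lambda>s. g (nat \<bar>s\<bar>)) = mean (map_pmf (\<lambda>s. nat \<bar>s\<bar>) states) g"
    by simp
  also have "\<dots> = (\<Sum>j. pmf levels j * g j)"
    unfolding map_abs_states by (rule integral_nat_pmf(2)[OF assms])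
  finally show "mean states (\<lambda>s. g (nat \<bar>s\<bar>)) = (\<Sum>j. pmf levels j * g j)" .
qed

lemma summable_levels_bound:
  assumes "\<And>j. j \<ge> 1 \<Longrightarrow> \<bar>q j * g j\<bar> \<le> C * (1 / 2) ^ j"
  shows "summable (\<lambda>j. pmf levels j * \<bar>g j\<bar>)"
proof (rule summable_comparison_test'[of "\<lambda>j. C * (1 / 2) ^ j" 1])
  show "summable (\<lambda>j. C * (1 / 2) ^ j)" by (intro summable_mult) (simp add: summable_geometric)
  fix j :: nat assume "1 \<le> j"
  then show "norm (pmf levels j * \<bar>g j\<bar>) \<le> C * (1 / 2) ^ j"
    using assms[of j] by (simp add: pmf_levels abs_mult)
qed

lemma height_pos: "j \<ge> 1 \<Longrightarrow> 0 < height j"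
  using q_pos by (simp add: height_def)

lemma height_nonneg: "0 \<le> height j"
  using height_pos[of j] by (cases "j = 0") (auto simp: height_def)

lemma q_height_square: "j \<ge> 1 \<Longrightarrow> q j * (height j)\<^sup>2 = (1 / 2) ^ j"
  using q_pos[of j] by (simp add: height_def)

lemma q_height: "j \<ge> 1 \<Longrightarrow> q j * height j \<le> slow j * slow j"
proof -
  assume j: "j \<ge> 1"
  have "(q j * height j)\<^sup>2 = q j * (q j * (height j)\<^sup>2)" by (simp add: power2_eq_square mult_ac)
  also have "\<dots> = q j * (1 / 2) ^ j" by (simp only: q_height_square[OF j])
  also have "\<dots> \<le> q j * 1" using q_pos[of j] by (intro mult_left_mono) (auto simp: power_le_one)
  also have "\<dots> \<le> (slow j * slow j)\<^sup>2" using q_le_slow[of j] by (simp add: power2_eq_square power4_eq_xxxx)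
  finally show ?thesis
    by (rule power2_le_imp_le) (use slow_pos[of j] in auto)
qed

lemma height_ge_1: "j \<ge> 1 \<Longrightarrow> 1 \<le> height j"
proof -
  assume j: "j \<ge> 1"
  have "(1 / 4 :: real) ^ Suc j \<le> (1 / 4) ^ j" by (intro power_decreasing) auto
  then have "q j \<le> (1 / 4) ^ j" using q_le[of j] by linarith
  also have "(1 / 4 :: real) ^ j \<le> (1 / 2) ^ j" by (intro power_mono) auto
  finally show ?thesis using j q_pos[of j] by (simp add: height_def)
qed

lemma height_strict_mono: "strict_mono height"
proof (rule strict_mono_Suc_iff[THEN iffD2], rule allI)
  fix j
  show "height j < height (Suc j)"
  proof (cases "j = 0")
    case True then show ?thesis using height_pos[of "Suc j"] by (simp add: height_def)
  next
    case False
    have "(1 / 2) ^ j / q j < (1 / 2) ^ Suc j / q (Suc j)"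
    proof -
      have "q (Suc j) < q j / 2" using q_Suc[of j] q_pos[of j] by linarith
      then have "(1 / 2 :: real) ^ j * q (Suc j) < (1 / 2) ^ j * (q j / 2)" by (intro mult_strict_left_mono) auto
      then show ?thesis using q_pos[of j] q_pos[of "Suc j"] by (simp add: field_simps)
    qed
    then show ?thesis using False by (simp add: height_def)
  qed
qed

lemma abs_value_of: "\<bar>value_of s\<bar> = height (nat \<bar>s\<bar>)"
proof (cases "s = 0")
  case False
  then have "\<bar>real_of_int (sgn s)\<bar> = 1" by (cases "0 < s") auto
  then show ?thesis using height_nonneg[of "nat \<bar>s\<bar>"] by (simp add: value_of_def abs_mult)
qed (simp add: value_of_def height_def)

lemma inj_value_of: "inj value_of"
proof (rule injI)
  fix s t assume eq: "value_of s = value_of t"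
  have "height (nat \<bar>s\<bar>) = height (nat \<bar>t\<bar>)" using eq abs_value_of by metis
  then have abs: "\<bar>s\<bar> = \<bar>t\<bar>" using height_strict_mono by (auto simp: strict_mono_eq)
  have "sgn s = sgn t"
  proof (cases "t = 0")
    case True then show ?thesis using abs by simp
  next
    case False
    then have "height (nat \<bar>t\<bar>) > 0" by (intro height_pos) auto
    then show ?thesis using eq abs by (simp add: value_of_def)
  qed
  then show "s = t" using abs by (metis abs_mult_sgn mult.commute)
qed

sublocale symmetric_refresh_chain states speed value_of uminus
proof
  show "0 < speed s" "speed s \<le> 1" for s by (simp_all add: speed_def slow_pos slow_le_1)
  show "map_pmf uminus states = states" by (rule map_uminus_states)
  show "speed (- s) = speed s" for s by (simp add: speed_def)
  show "value_of (- s) = - value_of s" for s by (simp add: value_of_def)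
  have "\<bar>q j * (1 / slow j)\<bar> \<le> 1 * (1 / 2) ^ j" for j
  proof -
    have "q j * (1 / slow j) \<le> slow j ^ 4 * (1 / slow j)"
      using q_le_slow slow_pos[of j] by (intro mult_right_mono) auto
    also have "\<dots> = slow j * (slow j)\<^sup>2" using slow_pos[of j] by (simp add: power4_eq_xxxx power2_eq_square)
    also have "\<dots> \<le> slow j * 1" using slow_pos[of j] slow_le_1[of j] by (intro mult_left_mono power_le_one) auto
    finally show ?thesis using slow_le_half_power[of j] q_pos[of j] slow_pos[of j] by simp
  qed
  then show "integrable states (\<lambda>s. 1 / speed s)"
    unfolding speed_def by (intro expectation_even(1) summable_levels_bound) blast
  have "\<bar>q j * (height j / slow j)\<bar> \<le> 1 * (1 / 2) ^ j" if "j \<ge> 1" for j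
  proof -
    have "q j * (height j / slow j) = q j * height j / slow j" by simp
    also have "\<dots> \<le> slow j * slow j / slow j"
      using q_height[OF that] slow_pos[of j] by (intro divide_right_mono) auto
    also have "\<dots> = slow j" using slow_pos[of j] by simp
    finally show ?thesis using slow_le_half_power[of j] q_pos[of j] slow_pos[of j] height_nonneg[of j] by simp
  qed
  then show "integrable states (\<lambda>s. \<bar>value_of s\<bar> / speed s)"
    unfolding speed_def abs_value_of by (intro expectation_even(1) summable_levels_bound) blast
qed

sublocale separated_refresh_chain states speed
proof
  show "2 * speed y \<le> speed x" if "speed y < speed x" for x y
    using that slow_halving by (simp add: speed_def slow_less_iff)
  have "weight0 = pmf (map_pmf (\<lambda>s. nat \<bar>s\<bar>) states) 0" by (simp add: map_abs_states pmf_levels)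
  also have "\<dots> = measure_pmf.prob states ((\<lambda>s. nat \<bar>s\<bar>) -` {0})" by (rule pmf_map)
  also have "(\<lambda>s. nat \<bar>s\<bar>) -` {0} = {s. speed s = 1}" by (auto simp: speed_def slow_eq_1_iff)
  finally show "3 / 4 \<le> measure_pmf.prob states {s. speed s = 1}" using weight0_ge by simp
qed

lemma integrable_square: "integrable states (\<lambda>s. (value_of s)\<^sup>2)"
proof -
  have "(value_of s)\<^sup>2 = (height (nat \<bar>s\<bar>))\<^sup>2" for s
    by (metis abs_value_of power2_abs)
  then show ?thesis
    using expectation_even(1)[OF summable_levels_bound[of "\<lambda>j. (height j)\<^sup>2" 1]] q_height_square by simp
qed

lemma summable_survival: "summable (\<lambda>j. q (Suc j) * (1 - slow (Suc j)) ^ n)"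
proof (rule summable_comparison_test'[of "\<lambda>j. q (Suc j)" 0])
  show "summable (\<lambda>j. q (Suc j))" using summable_q by (simp add: summable_Suc_iff)
  fix j :: nat
  have "(1 - slow (Suc j)) ^ n \<le> 1" "0 \<le> (1 - slow (Suc j)) ^ n"
    using slow_pos[of "Suc j"] slow_le_1[of "Suc j"] by (auto intro!: power_le_one)
  then show "norm (q (Suc j) * (1 - slow (Suc j)) ^ n) \<le> q (Suc j)"
    using q_pos[of "Suc j"] by (simp add: abs_mult mult_left_le)
qed

lemma expectation_survival:
  assumes "n \<ge> 1"
  shows "mean states (\<lambda>s. (1 - speed s) ^ n) = (\<Sum>j. q (Suc j) * (1 - slow (Suc j)) ^ n)"
proof -
  let ?a = "\<lambda>j. pmf levels j * (1 - slow j) ^ n"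
  have a0: "?a 0 = 0" using assms by (simp add: slow_def)
  have aS: "?a (Suc j) = q (Suc j) * (1 - slow (Suc j)) ^ n" for j by (simp add: pmf_levels)
  have pos: "0 \<le> (1 - slow j) ^ n" for j using slow_le_1[of j] by simp
  have s: "summable ?a" using summable_survival by (subst summable_Suc_iff[symmetric]) (simp only: aS)
  have "mean states (\<lambda>s. (1 - speed s) ^ n) = (\<Sum>j. ?a j)"
    unfolding speed_def using s pos by (intro expectation_even(2)) simp
  also have "\<dots> = (\<Sum>j. ?a (Suc j))" using suminf_split_head[OF s] a0 by simp
  finally show ?thesis by (simp only: aS)
qed

lemma escape_even: "escape u (of_int (sgn s) * \<tau>) = escape u \<tau>" if "s \<noteq> 0" for s :: int
  using that by (cases "0 < s") (auto simp: escape_def)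

lemma decay_eq:
  shows "summable (\<lambda>j. q j * escape (slow j) (\<theta> * height j))"
    "decay \<theta> = (\<Sum>j. q j * escape (slow j) (\<theta> * height j))"
proof -
  let ?e = "\<lambda>j. escape (slow j) (\<theta> * height j)"
  have e: "0 \<le> ?e j" "?e j \<le> 2" for j
    using escape_nonneg[OF slow_pos slow_le_1] escape_le_2q[OF slow_pos[of j] slow_le_1[of j], of "\<theta> * height j"] slow_le_1[of j] by auto
  have e0: "?e 0 = 0" by (simp add: height_def escape_def)
  show s: "summable (\<lambda>j. q j * ?e j)"
  proof (rule summable_comparison_test'[of "\<lambda>j. q j * 2" 0])
    show "summable (\<lambda>j. q j * 2)" by (intro summable_mult2 summable_q)
    show "norm (q j * ?e j) \<le> q j * 2" for j using e[of j] q_pos[of j] by (simp add: abs_mult)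
  qed
  have eq: "pmf levels j * ?e j = q j * ?e j" for j using e0 by (cases "j = 0") (simp_all add: pmf_levels)
  have "escape (speed s) (\<theta> * value_of s) = ?e (nat \<bar>s\<bar>)" for s
  proof (cases "s = 0")
    case False
    have "\<theta> * value_of s = of_int (sgn s) * (\<theta> * height (nat \<bar>s\<bar>))"
      unfolding value_of_def by (rule mult.left_commute)
    then show ?thesis by (simp only: escape_even[OF False] speed_def)
  qed (simp add: value_of_def height_def speed_def)
  then have "decay \<theta> = mean states (\<lambda>s. ?e (nat \<bar>s\<bar>))" by (simp add: decay_def)
  also have "\<dots> = (\<Sum>j. pmf levels j * ?e j)"
    by (rule expectation_even(2)) (use s e in \<open>simp add: eq\<close>)
  finally show "decay \<theta> = (\<Sum>j. q j * ?e j)" by (simp only: eq)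
qed

end

section \<open>Asymptotics of the decay rate\<close>

text \<open>Any constant below the limit \<open>1/2\<close> of \<open>(1 - cos \<tau>) / \<tau>\<^sup>2\<close> at \<open>0\<close> would serve instead of \<open>1/4\<close>.\<close>

lemma cos_quadratic_lower:
  obtains \<epsilon> :: real where "\<epsilon> > 0" "\<And>\<tau>. \<bar>\<tau>\<bar> < \<epsilon> \<Longrightarrow> \<tau>\<^sup>2 / 4 \<le> 1 - cos \<tau>"
proof -
  have "((\<lambda>\<tau>::real. (1 - cos \<tau>) / \<tau>\<^sup>2) \<longlongrightarrow> 1 / 2) (at 0)" by real_asymp
  then have "\<forall>\<^sub>F \<tau> in at 0. 1 / 4 < (1 - cos \<tau>) / (\<tau>::real)\<^sup>2" by (rule order_tendstoD) simp
  then obtain \<epsilon> :: real where \<epsilon>: "\<epsilon> > 0" "\<And>\<tau>. \<tau> \<noteq> 0 \<Longrightarrow> \<bar>\<tau>\<bar> < \<epsilon> \<Longrightarrow> 1 / 4 < (1 - cos \<tau>) / \<tau>\<^sup>2"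
    unfolding eventually_at by (auto simp: dist_real_def)
  have "\<tau>\<^sup>2 / 4 \<le> 1 - cos \<tau>" if "\<bar>\<tau>\<bar> < \<epsilon>" for \<tau>
  proof (cases "\<tau> = 0")
    case False
    then show ?thesis using \<epsilon>(2)[OF False that] by (simp add: field_simps)
  qed simp
  with \<epsilon>(1) that show ?thesis by blast
qed

lemma escape_lower:
  assumes u: "0 < u" "u \<le> 1" and "\<bar>\<tau>\<bar> \<le> u" and c: "\<tau>\<^sup>2 / 4 \<le> 1 - cos \<tau>"
  shows "\<tau>\<^sup>2 / (8 * u) \<le> escape u \<tau>"
proof -
  have "\<tau>\<^sup>2 \<le> u\<^sup>2" using assms(3) u by (metis abs_le_square_iff abs_of_pos)
  moreover have "2 * (1 - u) * (1 - cos \<tau>) \<le> 2 * 1 * (\<tau>\<^sup>2 / 2)"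
    using u one_minus_cos_le[of \<tau>] by (intro mult_mono) auto
  ultimately have d: "u\<^sup>2 + 2 * (1 - u) * (1 - cos \<tau>) \<le> 2 * u\<^sup>2" by simp
  have n: "u * 1 * (\<tau>\<^sup>2 / 4) \<le> u * (2 - u) * (1 - cos \<tau>)"
    using u c by (intro mult_mono mult_nonneg_nonneg) auto
  have "\<tau>\<^sup>2 / (8 * u) = (u * 1 * (\<tau>\<^sup>2 / 4)) / (2 * u\<^sup>2)" using u by (simp add: power2_eq_square)
  also have "\<dots> \<le> (u * (2 - u) * (1 - cos \<tau>)) / (u\<^sup>2 + 2 * (1 - u) * (1 - cos \<tau>))"
    using n d u escape_denominator_pos[OF u] by (intro frac_le) auto
  finally show ?thesis by (simp add: escape_def)
qed

text \<open>As \<open>p\<close> tends to \<open>0\<close>, \<open>p\<close> times a geometric variable becomes exponential; with a random sign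
it becomes Laplace distributed, and the limit is one minus the characteristic function of that law.\<close>

lemma escape_limit: "((\<lambda>p. escape p (t * p) / p) \<longlongrightarrow> t\<^sup>2 / (1 + t\<^sup>2)) (at_right 0)"
proof -
  define c where "c p = (1 - cos (t * p)) / p\<^sup>2" for p
  have c: "(c \<longlongrightarrow> t\<^sup>2 / 2) (at_right 0)"
  proof (cases "t = 0")
    case False
    have "((\<lambda>\<tau>::real. (1 - cos \<tau>) / \<tau>\<^sup>2) \<longlongrightarrow> 1 / 2) (at 0)" by real_asymp
    moreover have "filterlim (\<lambda>p. t * p) (at 0) (at_right 0)"
      unfolding filterlim_at
    proof
      show "\<forall>\<^sub>F p in at_right 0. t * p \<in> UNIV \<and> t * p \<noteq> 0"
        using False by (auto simp: eventually_at_filter)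
      have "((\<lambda>p. t * p) \<longlongrightarrow> t * 0) (at_right 0)" by (intro tendsto_mult tendsto_const tendsto_ident_at)
      then show "((\<lambda>p. t * p) \<longlongrightarrow> 0) (at_right 0)" by simp
    qed
    ultimately have "((\<lambda>p. t\<^sup>2 * ((1 - cos (t * p)) / (t * p)\<^sup>2)) \<longlongrightarrow> t\<^sup>2 * (1 / 2)) (at_right 0)"
      by (intro tendsto_mult tendsto_const) (rule filterlim_compose)
    moreover have "t\<^sup>2 * ((1 - cos (t * p)) / (t * p)\<^sup>2) = c p" for p
      using False by (simp add: c_def power_mult_distrib)
    ultimately show ?thesis by simp
  next
    case True
    then have "c = (\<lambda>_. 0)" by (simp add: c_def fun_eq_iff)
    then show ?thesis using True by simp
  qed
  have id: "((\<lambda>p. p) \<longlongrightarrow> 0) (at_right (0::real))" by (rule tendsto_ident_at)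
  have "((\<lambda>p. (2 - p) * c p / (1 + 2 * (1 - p) * c p)) \<longlongrightarrow> (2 - 0) * (t\<^sup>2 / 2) / (1 + 2 * (1 - 0) * (t\<^sup>2 / 2))) (at_right 0)"
  proof (intro tendsto_divide tendsto_mult tendsto_add tendsto_diff tendsto_const c id)
    have "0 < 1 + t\<^sup>2" by (simp add: add_pos_nonneg)
    then show "1 + 2 * (1 - 0) * (t\<^sup>2 / 2) \<noteq> 0" by simp
  qed
  moreover have "\<forall>\<^sub>F p in at_right 0. (2 - p) * c p / (1 + 2 * (1 - p) * c p) = escape p (t * p) / p"
    unfolding eventually_at_filter
  proof (rule eventually_mono[OF always_eventually])
    show "\<forall>x::real. True" by simp
    fix p :: real
    show "p \<noteq> 0 \<longrightarrow> p \<in> {0<..} \<longrightarrow> (2 - p) * c p / (1 + 2 * (1 - p) * c p) = escape p (t * p) / p"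
    proof (intro impI)
      assume "p \<in> {0<..}"
      then have p: "p > 0" by simp
      have cp: "1 - cos (t * p) = c p * p\<^sup>2" using p by (simp add: c_def)
      have n: "p * (2 - p) * (c p * p\<^sup>2) = p * (p\<^sup>2 * ((2 - p) * c p))" by (simp add: mult_ac)
      have d: "p\<^sup>2 + 2 * (1 - p) * (c p * p\<^sup>2) = p\<^sup>2 * (1 + 2 * (1 - p) * c p)" by (simp add: algebra_simps)
      have "escape p (t * p) / p = (p\<^sup>2 * ((2 - p) * c p)) / (p\<^sup>2 * (1 + 2 * (1 - p) * c p))"
        unfolding escape_def cp n d using p by simp
      then show "(2 - p) * c p / (1 + 2 * (1 - p) * c p) = escape p (t * p) / p" using p by simp
    qed
  qed
  ultimately show ?thesis by (simp add: tendsto_cong)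
qed

lemma div_sqrt_tendsto_0: "(\<lambda>n. t / sqrt (real n)) \<longlonglongrightarrow> 0"
  by (rule real_tendsto_divide_at_top[OF tendsto_const filterlim_compose[OF sqrt_at_top filterlim_real_sequentially]])

lemma power_tendsto_exp:
  fixes \<delta> :: "nat \<Rightarrow> real" and J :: "nat \<Rightarrow> nat"
  assumes nonneg: "\<And>m. 0 \<le> \<delta> m" and \<delta>: "\<delta> \<longlonglongrightarrow> 0" and L: "(\<lambda>m. real (J m) * \<delta> m) \<longlonglongrightarrow> L"
  shows "(\<lambda>m. (1 - \<delta> m) ^ J m) \<longlonglongrightarrow> exp (- L)"
proof -
  have "(\<lambda>m. real (J m) * \<delta> m * \<delta> m) \<longlonglongrightarrow> L * 0" by (intro tendsto_mult L \<delta>)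
  then have z: "(\<lambda>m. real (J m) * \<delta> m * \<delta> m) \<longlonglongrightarrow> 0" by simp
  have ev: "\<forall>\<^sub>F m in sequentially. \<delta> m < 1" using \<delta> by (rule order_tendstoD) simp
  have "(\<lambda>m. (1 - \<delta> m) ^ J m - exp (- (real (J m) * \<delta> m))) \<longlonglongrightarrow> 0"
  proof (rule Lim_null_comparison[OF _ z])
    show "\<forall>\<^sub>F m in sequentially. norm ((1 - \<delta> m) ^ J m - exp (- (real (J m) * \<delta> m))) \<le> real (J m) * \<delta> m * \<delta> m"
      using ev
    proof eventually_elim
      case (elim m)
      define d where "d = \<delta> m"
      have d: "0 \<le> d" "d < 1" using nonneg elim by (auto simp: d_def)
      have lo: "1 - d \<le> exp (- d)" using exp_ge_add_one_self[of "- d"] by simp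
      have hi: "exp (- d) \<le> 1 - d + d * d"
      proof -
        have "exp (- d) = 1 / exp d" by (simp add: exp_minus field_simps)
        also have "\<dots> \<le> 1 / (1 + d)" using exp_ge_add_one_self[of d] d by (intro divide_left_mono) auto
        also have "\<dots> \<le> 1 - d + d * d"
        proof -
          have "1 \<le> (1 - d + d * d) * (1 + d)" using d by (simp add: algebra_simps)
          then show ?thesis using d by (simp add: divide_le_eq)
        qed
        finally show ?thesis .
      qed
      have "norm ((1 - d) ^ J m - (exp (- d)) ^ J m) \<le> real (J m) * norm ((1 - d) - exp (- d))"
        by (rule norm_power_diff) (use d in auto)
      also have "\<dots> \<le> real (J m) * (d * d)" using lo hi by (intro mult_left_mono) auto
      finally show ?case
        by (simp add: d_def exp_of_nat_mult[symmetric] mult.assoc)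
    qed
  qed
  moreover have "(\<lambda>m. exp (- (real (J m) * \<delta> m))) \<longlonglongrightarrow> exp (- L)" by (rule tendsto_exp[OF tendsto_minus[OF L]])
  ultimately have "(\<lambda>m. ((1 - \<delta> m) ^ J m - exp (- (real (J m) * \<delta> m))) + exp (- (real (J m) * \<delta> m))) \<longlonglongrightarrow> 0 + exp (- L)"
    by (rule tendsto_add)
  then show ?thesis by simp
qed

context level_parameters
begin

lemma decay_ge_level: "q m * escape (slow m) (\<theta> * height m) \<le> decay \<theta>"
proof -
  have "0 \<le> q j * escape (slow j) (\<theta> * height j)" for j
    using q_pos[of j] escape_nonneg[OF slow_pos slow_le_1] by (simp add: less_imp_le)
  then have "sum (\<lambda>j. q j * escape (slow j) (\<theta> * height j)) {m} \<le> (\<Sum>j. q j * escape (slow j) (\<theta> * height j))"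
    by (intro sum_le_suminf decay_eq(1)) auto
  then show ?thesis by (simp add: decay_eq(2))
qed

lemma level_ratio: "m \<ge> 2 \<Longrightarrow> real m \<le> (1 / 2) ^ m / slow m"
proof -
  assume "m \<ge> 2"
  then have "2 * m \<le> m\<^sup>2" by (simp add: power2_eq_square)
  then have "slow m \<le> (1 / 2) ^ (2 * m)" unfolding slow_def by (intro power_decreasing) auto
  then have "slow m * 2 ^ m \<le> (1 / 2) ^ (2 * m) * 2 ^ m" by (intro mult_right_mono) auto
  also have "\<dots> = (1 / 2) ^ m"
  proof -
    have *: "(1 / 2 :: real) ^ m * 2 ^ m = 1" by (simp add: power_one_over)
    show ?thesis unfolding mult_2 power_add mult.assoc * by simp
  qed
  finally have "2 ^ m \<le> (1 / 2) ^ m / slow m" using slow_pos[of m] by (simp add: le_divide_eq mult.commute)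
  moreover have "real m \<le> 2 ^ m" using of_nat_less_two_power[of m, where 'a=real] by simp
  ultimately show ?thesis by linarith
qed

text \<open>One sufficiently high level \<open>m\<close> is enough: as soon as \<open>t / sqrt n * height m\<close> is small compared to
\<open>slow m\<close>, it contributes at least \<open>t\<^sup>2 / 8\<close> times \<open>2^(-m) / slow m\<close>, which exceeds any bound.\<close>

lemma decay_diverges:
  assumes "t \<noteq> 0"
  shows "filterlim (\<lambda>n. real n * decay (t / sqrt (real n))) at_top sequentially"
  unfolding filterlim_at_top
proof
  fix C :: real
  obtain \<epsilon> :: real where \<epsilon>: "\<epsilon> > 0" "\<And>\<tau>. \<bar>\<tau>\<bar> < \<epsilon> \<Longrightarrow> \<tau>\<^sup>2 / 4 \<le> 1 - cos \<tau>" using cos_quadratic_lower by blast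
  \<comment> \<open>The contribution of level \<open>m\<close> is at least \<open>t\<^sup>2 / 8\<close> times \<open>m\<close>, see \<open>level_ratio\<close>.\<close>
  obtain k :: nat where k: "8 * C / t\<^sup>2 \<le> real k" using real_arch_simple by blast
  define m where "m = max 2 k"
  have m: "m \<ge> 2" "8 * C / t\<^sup>2 \<le> real m" using k by (auto simp: m_def)
  have "C \<le> t\<^sup>2 / 8 * real m" using m(2) assms by (simp add: field_simps)
  also have "\<dots> \<le> t\<^sup>2 / 8 * ((1 / 2) ^ m / slow m)" using level_ratio[OF m(1)] by (intro mult_left_mono) auto
  finally have C: "C \<le> t\<^sup>2 / 8 * ((1 / 2) ^ m / slow m)" .
  have "(\<lambda>n. t / sqrt (real n) * height m) \<longlonglongrightarrow> 0 * height m"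
    by (intro tendsto_mult div_sqrt_tendsto_0 tendsto_const)
  then have "(\<lambda>n. t / sqrt (real n) * height m) \<longlonglongrightarrow> 0" by simp
  then have "\<forall>\<^sub>F n in sequentially. \<bar>t / sqrt (real n) * height m\<bar> < min \<epsilon> (slow m)"
    using \<epsilon>(1) slow_pos[of m] by (auto dest!: tendstoD[where e="min \<epsilon> (slow m)"] simp: dist_real_def)
  then show "\<forall>\<^sub>F n in sequentially. C \<le> real n * decay (t / sqrt (real n))"
    using eventually_gt_at_top[of 0]
  proof eventually_elim
    case (elim n)
    define \<tau> where "\<tau> = t / sqrt (real n) * height m"
    have \<tau>: "\<bar>\<tau>\<bar> < \<epsilon>" "\<bar>\<tau>\<bar> \<le> slow m" using elim(1) by (auto simp: \<tau>_def)
    have "t\<^sup>2 / 8 * ((1 / 2) ^ m / slow m) = real n * (q m * (\<tau>\<^sup>2 / (8 * slow m)))"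
    proof -
      have "real n * \<tau>\<^sup>2 = t\<^sup>2 * (height m)\<^sup>2"
        using elim(2) by (simp add: \<tau>_def power_mult_distrib power_divide)
      then have "real n * (q m * (\<tau>\<^sup>2 / (8 * slow m))) = (q m * (height m)\<^sup>2) * t\<^sup>2 / (8 * slow m)"
        by (simp add: mult_ac)
      also have "q m * (height m)\<^sup>2 = (1 / 2) ^ m" by (rule q_height_square) (use m(1) in simp)
      finally have *: "real n * (q m * (\<tau>\<^sup>2 / (8 * slow m))) = (1 / 2) ^ m * t\<^sup>2 / (8 * slow m)" .
      show ?thesis unfolding * by simp
    qed
    also have "\<dots> \<le> real n * (q m * escape (slow m) \<tau>)"
      using escape_lower[OF slow_pos slow_le_1 \<tau>(2) \<epsilon>(2)[OF \<tau>(1)]] q_pos[of m] by (intro mult_left_mono) auto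
    also have "\<dots> \<le> real n * decay (t / sqrt (real n))"
      using decay_ge_level[of m "t / sqrt (real n)"] by (intro mult_left_mono) (auto simp: \<tau>_def)
    finally show ?case using C by simp
  qed
qed

text \<open>In each step a sojourn at level \<open>m\<close> starts with probability \<open>q m * slow m\<close>, so that within
\<open>horizon m\<close> steps about one is expected. It contributes to the partial sum a term of the
order of \<open>scale m\<close>.\<close>

definition horizon :: "nat \<Rightarrow> nat" where
  "horizon m = nat \<lfloor>1 / (q m * slow m)\<rfloor>"

definition scale :: "nat \<Rightarrow> real" where
  "scale m = height m / slow m"

lemma q_slow_pos: "0 < q m * slow m"
  using q_pos slow_pos by simp

lemma horizon_le: "real (horizon m) * (q m * slow m) \<le> 1"
  and horizon_ge: "1 - q m * slow m \<le> real (horizon m) * (q m * slow m)"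
proof -
  define u where "u = q m * slow m"
  have u: "u > 0" unfolding u_def by (rule q_slow_pos)
  have "real (horizon m) \<le> 1 / u" "1 / u - 1 \<le> real (horizon m)"
    using u unfolding horizon_def u_def[symmetric] by (simp_all add: of_nat_nat)
  then have "real (horizon m) * u \<le> 1 / u * u" "(1 / u - 1) * u \<le> real (horizon m) * u"
    using u by (intro mult_right_mono; simp)+
  moreover have "1 / u * u = 1" "(1 / u - 1) * u = 1 - u" using u by (auto simp: left_diff_distrib)
  ultimately show "real (horizon m) * (q m * slow m) \<le> 1" "1 - q m * slow m \<le> real (horizon m) * (q m * slow m)"
    unfolding u_def by simp_all
qed

lemma horizon_pos: "0 < horizon m"
proof -
  have "q m * slow m \<le> q m * 1" using q_pos[of m] slow_le_1 by (intro mult_left_mono) auto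
  also have "q m \<le> 1" by (rule q_le_1)
  finally show ?thesis using q_slow_pos[of m] by (simp add: horizon_def le_divide_eq)
qed

lemma horizon_Suc: "horizon m < horizon (Suc m)"
proof -
  define u where "u = 1 / (q m * slow m)"
  have "q m * slow m \<le> 1 * 1" using q_le_1[of m] slow_le_1[of m] slow_pos[of m] by (intro mult_mono) auto
  then have u: "1 \<le> u" using q_slow_pos[of m] by (simp add: u_def le_divide_eq)
  have "q (Suc m) * slow (Suc m) \<le> (q m / 4) * slow m"
    using q_Suc slow_antimono[of m "Suc m"] q_pos[of m] slow_pos[of "Suc m"] by (intro mult_mono) auto
  then have "1 / ((q m / 4) * slow m) \<le> 1 / (q (Suc m) * slow (Suc m))"
    by (intro divide_left_mono mult_pos_pos) (auto simp: q_pos slow_pos)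
  then have "4 * u \<le> 1 / (q (Suc m) * slow (Suc m))" by (simp add: u_def)
  then have "u + 1 \<le> 1 / (q (Suc m) * slow (Suc m))" using u by linarith
  then have "\<lfloor>u\<rfloor> + 1 \<le> \<lfloor>1 / (q (Suc m) * slow (Suc m))\<rfloor>" by (metis floor_add_int floor_mono of_int_1)
  then show ?thesis using u unfolding horizon_def u_def[symmetric] by (simp add: nat_less_eq_zless zless_nat_eq_int_zless)
qed

lemma strict_mono_horizon: "strict_mono horizon"
  by (simp add: strict_mono_Suc_iff horizon_Suc)

lemma scale_pos: "m \<ge> 1 \<Longrightarrow> 0 < scale m"
  using height_pos slow_pos by (simp add: scale_def)

lemma slow_tendsto_0: "slow \<longlonglongrightarrow> 0"
proof (rule tendsto_sandwich[OF _ _ tendsto_const])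
  show "(\<lambda>j. (1 / 2) ^ j) \<longlonglongrightarrow> (0::real)" by (rule LIMSEQ_realpow_zero) auto
  show "\<forall>\<^sub>F j in sequentially. slow j \<le> (1 / 2) ^ j" by (simp add: slow_le_half_power)
  show "\<forall>\<^sub>F j in sequentially. 0 \<le> slow j" using slow_pos by (simp add: less_imp_le)
qed

lemma slow_at_right: "filterlim slow (at_right 0) sequentially"
  by (rule tendsto_imp_filterlim_at_right[OF slow_tendsto_0]) (simp add: slow_pos)

lemma scale_diverges: "filterlim scale at_top sequentially"
proof (rule filterlim_at_top_mono)
  show "filterlim (\<lambda>m. 1 / slow m) at_top sequentially"
    using filterlim_compose[OF filterlim_inverse_at_top_right slow_at_right] by (simp add: divide_inverse)
  show "\<forall>\<^sub>F m in sequentially. 1 / slow m \<le> scale m"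
    using eventually_ge_at_top[of 1]
  proof eventually_elim
    case (elim m)
    then show ?case unfolding scale_def using height_ge_1 slow_pos[of m] by (intro divide_right_mono) auto
  qed
qed

text \<open>Level \<open>m\<close> yields the limit through \<open>escape_limit\<close>. The higher levels yield at most twice the ratio
\<open>slow (m + 1) / slow m\<close>, because they are hardly visited at all. A lower level \<open>j\<close> yields at
most \<open>t\<^sup>2\<close> times the ratio of its variance \<open>2^(-j) / slow j\<close> to that of level \<open>m\<close>.\<close>

lemma horizon_decay:
  "(\<lambda>m. real (horizon m) * decay (t / scale m)) \<longlonglongrightarrow> t\<^sup>2 / (1 + t\<^sup>2)"
proof -
  define a where "a m j = q j * escape (slow j) (t / scale m * height j)" for m j
  have a0: "0 \<le> a m j" for m j
    unfolding a_def using q_pos[of j] escape_nonneg[OF slow_pos slow_le_1] by (simp add: less_imp_le)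
  define H where "H m = real (horizon m)" for m
  have Hle: "H m \<le> 1 / (q m * slow m)" for m
    using horizon_le[of m] q_slow_pos[of m] by (simp add: H_def le_divide_eq)
  have H0: "0 \<le> H m" for m by (simp add: H_def)
  \<comment> \<open>The levels above, below and equal to \<open>m\<close>.\<close>
  have split: "decay (t / scale m) = (\<Sum>i. a m (i + Suc m)) + (\<Sum>i<m. a m i) + a m m" for m
    using suminf_split_initial_segment[OF decay_eq(1)[of "t / scale m"], of "Suc m"]
    unfolding decay_eq(2) a_def by simp
  have mid: "(\<lambda>m. H m * a m m) \<longlonglongrightarrow> t\<^sup>2 / (1 + t\<^sup>2)"
  proof -
    have qs: "(\<lambda>m. q m * slow m) \<longlonglongrightarrow> 0"
      by (rule tendsto_sandwich[OF _ _ tendsto_const slow_tendsto_0])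
         (use q_slow_pos q_le_1 slow_pos in \<open>auto simp: less_imp_le mult_left_le_one_le q_pos\<close>)
    have "(\<lambda>m. H m * (q m * slow m)) \<longlonglongrightarrow> 1"
    proof (rule tendsto_sandwich[OF _ _ _ tendsto_const])
      have "(\<lambda>m. 1 - q m * slow m) \<longlonglongrightarrow> 1 - 0" by (intro tendsto_diff tendsto_const qs)
      then show "(\<lambda>m. 1 - q m * slow m) \<longlonglongrightarrow> 1" by simp
    qed (use horizon_le horizon_ge in \<open>auto simp: H_def\<close>)
    moreover have "(\<lambda>m. escape (slow m) (t * slow m) / slow m) \<longlonglongrightarrow> t\<^sup>2 / (1 + t\<^sup>2)"
      using filterlim_compose[OF escape_limit slow_at_right] .
    ultimately have "(\<lambda>m. H m * (q m * slow m) * (escape (slow m) (t * slow m) / slow m)) \<longlonglongrightarrow> 1 * (t\<^sup>2 / (1 + t\<^sup>2))"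
      by (rule tendsto_mult)
    moreover have "\<forall>\<^sub>F m in sequentially. H m * (q m * slow m) * (escape (slow m) (t * slow m) / slow m) = H m * a m m"
      using eventually_ge_at_top[of 1]
    proof eventually_elim
      case (elim m)
      have "t / scale m * height m = t * slow m" using height_pos[OF elim] by (simp add: scale_def)
      then show ?case using slow_pos[of m] by (simp add: a_def)
    qed
    ultimately show ?thesis by (simp add: tendsto_cong)
  qed
  have high: "(\<lambda>m. H m * (\<Sum>i. a m (i + Suc m))) \<longlonglongrightarrow> 0"
  proof (rule Lim_null_comparison)
    show "(\<lambda>m. (1 / 2) ^ m) \<longlonglongrightarrow> (0::real)" by (rule LIMSEQ_realpow_zero) auto
    have "norm (H m * (\<Sum>i. a m (i + Suc m))) \<le> (1 / 2) ^ m" for m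
    proof -
      have sa: "summable (\<lambda>i. a m (i + Suc m))"
        unfolding a_def by (rule summable_ignore_initial_segment[OF decay_eq(1)])
      have sq: "summable (\<lambda>i. q (i + Suc m))" by (rule summable_ignore_initial_segment[OF summable_q])
      have "(\<Sum>i. a m (i + Suc m)) \<le> (\<Sum>i. 2 * slow (Suc m) * q (i + Suc m))"
      proof (rule suminf_le[OF _ sa summable_mult[OF sq]])
        fix i
        have "escape (slow (i + Suc m)) (t / scale m * height (i + Suc m)) \<le> 2 * slow (i + Suc m)"
          by (rule escape_le_2q[OF slow_pos slow_le_1])
        also have "\<dots> \<le> 2 * slow (Suc m)" using slow_antimono[of "Suc m" "i + Suc m"] by simp
        finally show "a m (i + Suc m) \<le> 2 * slow (Suc m) * q (i + Suc m)"
          unfolding a_def using q_pos[of "i + Suc m"] by (simp add: mult.commute mult_right_mono)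
      qed
      also have "\<dots> = 2 * slow (Suc m) * (\<Sum>i. q (i + Suc m))" by (rule suminf_mult[OF sq])
      also have "\<dots> \<le> 2 * slow (Suc m) * q m" using q_tail[of m] slow_pos[of "Suc m"] by (intro mult_left_mono) auto
      finally have "H m * (\<Sum>i. a m (i + Suc m)) \<le> 1 / (q m * slow m) * (2 * slow (Suc m) * q m)"
        using Hle[of m] H0[of m] q_slow_pos[of m] suminf_nonneg[OF sa a0] by (intro mult_mono) auto
      also have "\<dots> = 2 * (1 / 2) ^ (2 * m + 1)"
        unfolding slow_Suc using q_pos[of m] slow_pos[of m] by simp
      also have "\<dots> = (1 / 2) ^ (2 * m)" by simp
      also have "\<dots> \<le> (1 / 2) ^ m" by (intro power_decreasing) auto
      finally show ?thesis using H0[of m] suminf_nonneg[OF sa a0] by simp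
    qed
    then show "\<forall>\<^sub>F m in sequentially. norm (H m * (\<Sum>i. a m (i + Suc m))) \<le> (1 / 2) ^ m" by simp
  qed
  have low: "(\<lambda>m. H m * (\<Sum>i<m. a m i)) \<longlonglongrightarrow> 0"
  proof (rule LIMSEQ_imp_Suc, rule Lim_null_comparison)
    show "(\<lambda>k. t\<^sup>2 * (real (Suc k) * (1 / 2) ^ k)) \<longlonglongrightarrow> 0" by real_asymp
    have "norm (H (Suc k) * (\<Sum>i<Suc k. a (Suc k) i)) \<le> t\<^sup>2 * (real (Suc k) * (1 / 2) ^ k)" for k
    proof -
      define m where "m = Suc k"
      have hm: "0 < height m" by (rule height_pos) (simp add: m_def)
      have "a m i \<le> (t / scale m)\<^sup>2 / slow k" if "i < m" for i
      proof (cases "i = 0")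
        case True
        then show ?thesis using slow_pos[of k] by (simp add: a_def height_def escape_def)
      next
        case False
        have "a m i \<le> q i * ((t / scale m * height i)\<^sup>2 / slow i)"
          unfolding a_def using q_pos[of i] escape_le_square[OF slow_pos slow_le_1] by (intro mult_left_mono) auto
        also have "\<dots> = (t / scale m)\<^sup>2 * (q i * (height i)\<^sup>2) / slow i"
          unfolding power_mult_distrib by (simp only: times_divide_eq_right mult.left_commute)
        also have "\<dots> = (t / scale m)\<^sup>2 * (1 / 2) ^ i / slow i" using q_height_square[of i] False by simp
        also have "\<dots> \<le> (t / scale m)\<^sup>2 * 1 / slow k"
          using slow_antimono[of i k] that slow_pos[of k] by (intro frac_le mult_left_mono) (auto simp: m_def power_le_one)
        finally show ?thesis by simp
      qed
      then have "(\<Sum>i<m. a m i) \<le> (\<Sum>i<m. (t / scale m)\<^sup>2 / slow k)" by (intro sum_mono) auto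
      then have "(\<Sum>i<m. a m i) \<le> real m * ((t / scale m)\<^sup>2 / slow k)" by simp
      then have "H m * (\<Sum>i<m. a m i) \<le> 1 / (q m * slow m) * (real m * ((t / scale m)\<^sup>2 / slow k))"
        using Hle[of m] H0[of m] q_slow_pos[of m] a0 by (intro mult_mono sum_nonneg) auto
      also have "\<dots> = t\<^sup>2 * (real m * (slow m / (q m * (height m)\<^sup>2 * slow k)))"
        using hm slow_pos[of m] slow_pos[of k] q_pos[of m] by (simp add: scale_def power_divide power2_eq_square field_simps)
      also have "slow m / (q m * (height m)\<^sup>2 * slow k) = (1 / 2) ^ (2 * k + 1) / (1 / 2) ^ m"
      proof -
        have qh: "q m * (height m)\<^sup>2 = (1 / 2) ^ m" by (rule q_height_square) (simp add: m_def)
        have sm: "slow m = slow k * (1 / 2) ^ (2 * k + 1)" unfolding m_def by (rule slow_Suc)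
        show ?thesis unfolding qh sm using slow_pos[of k] by simp
      qed
      also have "\<dots> = (1 / 2) ^ k" by (simp add: m_def power_add mult_2)
      finally show ?thesis using H0[of m] a0 by (simp add: m_def[symmetric] sum_nonneg)
    qed
    then show "\<forall>\<^sub>F k in sequentially. norm (H (Suc k) * (\<Sum>i<Suc k. a (Suc k) i)) \<le> t\<^sup>2 * (real (Suc k) * (1 / 2) ^ k)" by simp
  qed
  have "(\<lambda>m. H m * (\<Sum>i. a m (i + Suc m)) + H m * (\<Sum>i<m. a m i) + H m * a m m) \<longlonglongrightarrow> 0 + 0 + t\<^sup>2 / (1 + t\<^sup>2)"
    by (intro tendsto_add high low mid)
  then show ?thesis unfolding split distrib_left H_def by (simp only: add_0)
qed

end

locale level_process = level_parameters q + refresh_process states speed M Y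
  for q and M :: "'a measure" and Y :: "int \<Rightarrow> 'a \<Rightarrow> int"
begin

sublocale symmetric_refresh_process states speed M Y value_of uminus ..

sublocale separated_refresh_process states speed M Y ..

lemma normalized_cf_vanishes:
  assumes "t \<noteq> 0"
  shows "(\<lambda>n. expectation (\<lambda>\<omega>. cis (t * (partial_sum n \<omega> / sqrt (real n))))) \<longlonglongrightarrow> 0"
proof (rule Lim_null_comparison)
  let ?\<theta> = "\<lambda>n. t / sqrt (real n)"
  have "filterlim (\<lambda>n. - (real n * decay (?\<theta> n))) at_bot sequentially"
    using decay_diverges[OF assms] by (simp add: filterlim_uminus_at_top)
  then have "(\<lambda>n. exp (- (real n * decay (?\<theta> n)))) \<longlonglongrightarrow> 0"
    by (rule filterlim_compose[OF exp_at_bot])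
  moreover have "(\<lambda>n. \<bar>?\<theta> n\<bar> * (4 * moment + 3 * moment\<^sup>2)) \<longlonglongrightarrow> \<bar>0\<bar> * (4 * moment + 3 * moment\<^sup>2)"
    by (intro tendsto_mult tendsto_rabs tendsto_const div_sqrt_tendsto_0)
  ultimately have "(\<lambda>n. \<bar>?\<theta> n\<bar> * (4 * moment + 3 * moment\<^sup>2) + exp (- (real n * decay (?\<theta> n)))) \<longlonglongrightarrow> \<bar>0\<bar> * (4 * moment + 3 * moment\<^sup>2) + 0"
    by (intro tendsto_add)
  then show "(\<lambda>n. \<bar>?\<theta> n\<bar> * (4 * moment + 3 * moment\<^sup>2) + exp (- (real n * decay (?\<theta> n)))) \<longlonglongrightarrow> 0" by simp
  have "(\<lambda>n. \<bar>?\<theta> n\<bar> * moment) \<longlonglongrightarrow> \<bar>0\<bar> * moment"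
    by (intro tendsto_mult tendsto_rabs tendsto_const div_sqrt_tendsto_0)
  then have "\<forall>\<^sub>F n in sequentially. \<bar>?\<theta> n\<bar> * moment < 1" by (rule order_tendstoD) simp
  then show "\<forall>\<^sub>F n in sequentially. norm (expectation (\<lambda>\<omega>. cis (t * (partial_sum n \<omega> / sqrt (real n)))))
      \<le> \<bar>?\<theta> n\<bar> * (4 * moment + 3 * moment\<^sup>2) + exp (- (real n * decay (?\<theta> n)))"
    using eventually_ge_at_top[of 1]
  proof eventually_elim
    case (elim n)
    define d where "d = decay (?\<theta> n)"
    have d: "0 \<le> 1 - d" using decay_le[of "?\<theta> n"] elim(1) by (simp add: d_def)
    have "(1 - d) ^ n \<le> exp (- d) ^ n" using d exp_ge_add_one_self[of "- d"] by (intro power_mono) auto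
    then have e: "(1 - d) ^ n \<le> exp (- (real n * d))" by (simp add: exp_of_nat_mult[symmetric])
    have "expectation (\<lambda>\<omega>. cis (t * (partial_sum n \<omega> / sqrt (real n)))) = expectation (\<lambda>\<omega>. cis (?\<theta> n * partial_sum n \<omega>))"
      by simp
    moreover have "cmod (expectation (\<lambda>\<omega>. cis (?\<theta> n * partial_sum n \<omega>)))
       \<le> cmod (expectation (\<lambda>\<omega>. cis (?\<theta> n * partial_sum n \<omega>)) - of_real ((1 - d) ^ n)) + cmod (of_real ((1 - d) ^ n))"
      using norm_triangle_ineq[of "expectation (\<lambda>\<omega>. cis (?\<theta> n * partial_sum n \<omega>)) - of_real ((1 - d) ^ n)" "of_real ((1 - d) ^ n)"]
      by (simp only: diff_add_cancel)
    moreover have "cmod (of_real ((1 - d) ^ n)) = (1 - d) ^ n" unfolding norm_of_real using d by simp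
    moreover have "cmod (expectation (\<lambda>\<omega>. cis (?\<theta> n * partial_sum n \<omega>)) - of_real ((1 - d) ^ n)) \<le> \<bar>?\<theta> n\<bar> * (4 * moment + 3 * moment\<^sup>2)"
      unfolding d_def using elim by (intro cf_partial_sum) auto
    ultimately show ?case using e by (simp only: d_def)
  qed
qed

lemma scaled_cf_converges:
  "(\<lambda>m. expectation (\<lambda>\<omega>. cis (t * (partial_sum (horizon m) \<omega> / scale m)))) \<longlonglongrightarrow> of_real (exp (- (t\<^sup>2 / (1 + t\<^sup>2))))"
proof -
  let ?\<theta> = "\<lambda>m. t / scale m"
  have \<theta>: "?\<theta> \<longlonglongrightarrow> 0"
    by (rule real_tendsto_divide_at_top[OF tendsto_const scale_diverges])
  have \<theta>C: "(\<lambda>m. \<bar>?\<theta> m\<bar> * C) \<longlonglongrightarrow> 0" for C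
    using tendsto_mult[OF tendsto_rabs[OF \<theta>] tendsto_const[of C]] by simp
  have "(\<lambda>m. decay (?\<theta> m)) \<longlonglongrightarrow> 0"
    by (rule tendsto_sandwich[OF _ _ tendsto_const \<theta>C[of moment]]) (intro always_eventually allI decay_nonneg decay_le)+
  then have "(\<lambda>m. (1 - decay (?\<theta> m)) ^ horizon m) \<longlonglongrightarrow> exp (- (t\<^sup>2 / (1 + t\<^sup>2)))"
    by (intro power_tendsto_exp decay_nonneg horizon_decay)
  then have main: "(\<lambda>m. of_real ((1 - decay (?\<theta> m)) ^ horizon m)) \<longlonglongrightarrow> (of_real (exp (- (t\<^sup>2 / (1 + t\<^sup>2)))) :: complex)"
    by (rule tendsto_of_real)
  have "(\<lambda>m. expectation (\<lambda>\<omega>. cis (t * (partial_sum (horizon m) \<omega> / scale m))) - of_real ((1 - decay (?\<theta> m)) ^ horizon m)) \<longlonglongrightarrow> 0"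
  proof (rule Lim_null_comparison[OF _ \<theta>C])
    have "\<forall>\<^sub>F m in sequentially. \<bar>?\<theta> m\<bar> * moment < 1"
      using \<theta>C[of moment] by (rule order_tendstoD) simp
    then show "\<forall>\<^sub>F m in sequentially. norm (expectation (\<lambda>\<omega>. cis (t * (partial_sum (horizon m) \<omega> / scale m))) - of_real ((1 - decay (?\<theta> m)) ^ horizon m))
        \<le> \<bar>?\<theta> m\<bar> * (4 * moment + 3 * moment\<^sup>2)"
    proof eventually_elim
      case (elim m)
      have "expectation (\<lambda>\<omega>. cis (t * (partial_sum (horizon m) \<omega> / scale m))) = expectation (\<lambda>\<omega>. cis (?\<theta> m * partial_sum (horizon m) \<omega>))"
        by simp
      then show ?case using cf_partial_sum[of "?\<theta> m" "horizon m"] elim horizon_pos[of m] by simp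
    qed
  qed
  from tendsto_add[OF this main] show ?thesis by simp
qed

lemma compound_poisson_limit:
  "weak_conv_m (\<lambda>m. distr M borel (\<lambda>\<omega>. partial_sum (horizon m) \<omega> / scale m)) mu_P1sL"
proof (rule levy_continuity[OF _ real_distribution_mu_P1sL])
  have meas: "(\<lambda>\<omega>. partial_sum (horizon m) \<omega> / scale m) \<in> borel_measurable M" for m by measurable
  show "real_distribution (distr M borel (\<lambda>\<omega>. partial_sum (horizon m) \<omega> / scale m))" for m
    by (rule real_distribution_distr[OF meas])
  fix t
  have "char (distr M borel (\<lambda>\<omega>. partial_sum (horizon m) \<omega> / scale m)) t
      = expectation (\<lambda>\<omega>. cis (t * (partial_sum (horizon m) \<omega> / scale m)))" for m
    unfolding char_def by (subst integral_distr[OF meas]) (auto simp: cis_conv_exp)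
  then show "(\<lambda>m. char (distr M borel (\<lambda>\<omega>. partial_sum (horizon m) \<omega> / scale m)) t) \<longlonglongrightarrow> char mu_P1sL t"
    using scaled_cf_converges[of t] by (simp only: char_mu_P1sL)
qed

lemma integrable_partial_sum_square: "integrable M (\<lambda>\<omega>. (partial_sum n \<omega>)\<^sup>2)"
proof -
  have sq: "integrable M (\<lambda>\<omega>. (value_of (Y k \<omega>))\<^sup>2)" for k
    using integrable_state_iff[of "\<lambda>s. (value_of s)\<^sup>2" k] integrable_square by simp
  have prod: "integrable M (\<lambda>\<omega>. value_of (Y k \<omega>) * value_of (Y l \<omega>))" for k l
  proof (rule Bochner_Integration.integrable_bound[OF Bochner_Integration.integrable_add[OF sq[of k] sq[of l]]])
    show "(\<lambda>\<omega>. value_of (Y k \<omega>) * value_of (Y l \<omega>)) \<in> borel_measurable M"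
      by (intro borel_measurable_times state_function_measurable)
    have "\<bar>x * y\<bar> \<le> x\<^sup>2 + y\<^sup>2" for x y :: real
    proof -
      have "2 * (\<bar>x\<bar> * \<bar>y\<bar>) \<le> x\<^sup>2 + y\<^sup>2" using sum_squares_bound[of "\<bar>x\<bar>" "\<bar>y\<bar>"] by (simp add: mult.assoc)
      moreover have "0 \<le> \<bar>x\<bar> * \<bar>y\<bar>" by simp
      ultimately show ?thesis unfolding abs_mult by linarith
    qed
    then show "AE \<omega> in M. norm (value_of (Y k \<omega>) * value_of (Y l \<omega>)) \<le> norm ((value_of (Y k \<omega>))\<^sup>2 + (value_of (Y l \<omega>))\<^sup>2)"
      by (intro AE_I2) simp
  qed
  have "(partial_sum n \<omega>)\<^sup>2 = (\<Sum>k = 1..n. \<Sum>l = 1..n. value_of (Y (int k) \<omega>) * value_of (Y (int l) \<omega>))" for \<omega>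
    unfolding partial_sum_def power2_eq_square by (rule sum_product)
  then show ?thesis by (simp only: prod Bochner_Integration.integrable_sum)
qed

end

section \<open>Choice of the weights and conclusion\<close>

text \<open>Eventually \<open>\<zeta>\<close> exceeds \<open>e^(-c n) \<ge> (1 - c)^n\<close>, and the finitely many other values are positive.\<close>

lemma geometric_below:
  fixes \<zeta> :: "nat \<Rightarrow> real"
  assumes pos: "\<And>n. n \<ge> 1 \<Longrightarrow> \<zeta> n > 0" and c: "0 < c" "c \<le> 1"
    and lim: "filterlim (\<lambda>n. \<zeta> n / exp (- c * real n)) at_top sequentially"
  obtains d where "0 < d" "\<And>n. n \<ge> 1 \<Longrightarrow> d * (1 - c) ^ n \<le> \<zeta> n"
proof -
  have "\<forall>\<^sub>F n in sequentially. 1 \<le> \<zeta> n / exp (- c * real n)"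
    using lim unfolding filterlim_at_top by blast
  then obtain N where N: "\<And>n. n \<ge> N \<Longrightarrow> 1 \<le> \<zeta> n / exp (- c * real n)"
    unfolding eventually_sequentially by blast
  define d where "d = Min (insert 1 (\<zeta> ` {1..N}))"
  have "0 < d" unfolding d_def using pos by (subst Min_gr_iff) auto
  moreover have "d * (1 - c) ^ n \<le> \<zeta> n" if n: "n \<ge> 1" for n
  proof (cases "n \<le> N")
    case True
    have "d \<le> \<zeta> n" unfolding d_def using n True by (intro Min_le) auto
    moreover have "d * (1 - c) ^ n \<le> d * 1" using c \<open>0 < d\<close> by (intro mult_left_mono power_le_one) auto
    ultimately show ?thesis by simp
  next
    case False
    have "(1 - c) ^ n \<le> exp (- c) ^ n" using c exp_ge_add_one_self[of "- c"] by (intro power_mono) auto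
    also have "\<dots> = exp (- c * real n)" by (simp add: exp_of_nat_mult[symmetric] mult.commute)
    also have "\<dots> \<le> \<zeta> n" using N[of n] False by (simp add: le_divide_eq)
    finally have "(1 - c) ^ n \<le> \<zeta> n" .
    moreover have "d * (1 - c) ^ n \<le> 1 * (1 - c) ^ n"
      using c unfolding d_def by (intro mult_right_mono Min_le) auto
    ultimately show ?thesis by simp
  qed
  ultimately show ?thesis using that by blast
qed

text \<open>The mixing bound is a sum of geometric sequences with prefactors \<open>q j\<close>, each of which lies below
\<open>2^(-j) \<zeta>\<close> if its prefactor is small. All other requirements on \<open>q\<close> are upper bounds too,
depending at most on the preceding value, so they can be met recursively.\<close>

lemma level_parameters_exist:
  fixes \<zeta> :: "nat \<Rightarrow> real"
  assumes pos: "\<And>n. n \<ge> 1 \<Longrightarrow> \<zeta> n > 0"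
    and b: "\<And>c::real. c > 0 \<Longrightarrow> filterlim (\<lambda>n. \<zeta> n / exp (- c * real n)) at_top sequentially"
  obtains q where "level_parameters q"
    "\<And>j n. n \<ge> 1 \<Longrightarrow> 10 * (q (Suc j) * (1 - slow (Suc j)) ^ n) \<le> (1 / 2) ^ Suc j * \<zeta> n"
proof -
  have "\<exists>d. 0 < d \<and> (\<forall>n\<ge>1. d * (1 - slow j) ^ n \<le> \<zeta> n)" for j
    using geometric_below[of \<zeta> "slow j", OF pos slow_pos slow_le_1 b[OF slow_pos]] by blast
  then obtain d where d: "\<And>j. 0 < d j" "\<And>j n. n \<ge> 1 \<Longrightarrow> d j * (1 - slow j) ^ n \<le> \<zeta> n" by metis
  define c where "c j = min (slow j ^ 4) ((1 / 2) ^ j * d j / 10)" for j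
  define q where "q = rec_nat (min (c 0) (1 / 4)) (\<lambda>j x. min (c (Suc j)) (x / 4))"
  have q0: "q 0 = min (c 0) (1 / 4)" and qS: "q (Suc j) = min (c (Suc j)) (q j / 4)" for j by (simp_all add: q_def)
  have c0: "0 < c j" for j using d(1)[of j] slow_pos[of j] by (simp add: c_def)
  have qc: "q j \<le> c j" for j by (cases j) (simp_all add: q0 qS)
  have "level_parameters q"
  proof
    show "0 < q j" for j by (induction j) (use c0 in \<open>auto simp: q0 qS\<close>)
    show "q (Suc j) \<le> q j / 4" for j by (simp add: qS)
    show "q j \<le> slow j ^ 4" for j using qc[of j] by (simp add: c_def)
    show "q 0 \<le> 1 / 4" by (simp add: q0)
  qed
  moreover have "10 * (q (Suc j) * (1 - slow (Suc j)) ^ n) \<le> (1 / 2) ^ Suc j * \<zeta> n" if "n \<ge> 1" for j n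
  proof -
    have nn: "0 \<le> (1 - slow (Suc j)) ^ n" using slow_le_1[of "Suc j"] by simp
    have "q (Suc j) \<le> (1 / 2) ^ Suc j * d (Suc j) / 10" using qc[of "Suc j"] by (simp add: c_def)
    from mult_right_mono[OF this nn]
    have "10 * (q (Suc j) * (1 - slow (Suc j)) ^ n) \<le> (1 / 2) ^ Suc j * (d (Suc j) * (1 - slow (Suc j)) ^ n)"
      by simp
    also have "\<dots> \<le> (1 / 2) ^ Suc j * \<zeta> n" by (intro mult_left_mono d(2) that) simp
    finally show ?thesis .
  qed
  ultimately show ?thesis using that by blast
qed

theorem theorem3p3:
  fixes \<zeta> :: "nat \<Rightarrow> real"
  assumes pos: "\<And>n. n \<ge> 1 \<Longrightarrow> \<zeta> n > 0"
    and a: "\<zeta> \<longlonglongrightarrow> 0"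
    and b: "\<And>c::real. c > 0 \<Longrightarrow> filterlim (\<lambda>n. \<zeta> n / exp (- c * real n)) at_top sequentially"
  shows "\<exists>(M :: (int \<Rightarrow> real) measure) (X :: int \<Rightarrow> (int \<Rightarrow> real) \<Rightarrow> real).
    prob_space M \<and>
    countable_state_markov_chain M X \<and> strictly_stationary M X \<and> reversible M X \<and>
    \<comment> \<open>(i)\<close>
    (integrable M (\<lambda>\<omega>. (X 0 \<omega>)\<^sup>2) \<and> prob_space.expectation M (X 0) = 0) \<and>
    \<comment> \<open>(ii)\<close>
    (\<forall>n\<ge>1. alpha_mix M X n \<le> beta_mix M X n \<and> beta_mix M X n \<le> \<zeta> n) \<and>
    \<comment> \<open>(iii)\<close>
    (filterlim (\<lambda>n::nat. prob_space.variance M (\<lambda>\<omega>. \<Sum>k = 1..n. X (int k) \<omega>) / real n)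
       at_top sequentially \<and>
     (\<forall>b::real. b > 0 \<longrightarrow>
       (\<lambda>n::nat. SUP r::real. measure M {\<omega> \<in> space M.
          r - b < (\<Sum>k = 1..n. X (int k) \<omega>) / sqrt (real n) \<and>
          (\<Sum>k = 1..n. X (int k) \<omega>) / sqrt (real n) < r + b}) \<longlonglongrightarrow> 0)) \<and>
    \<comment> \<open>(iv)\<close>
    (\<exists>(J :: nat \<Rightarrow> nat) (b :: nat \<Rightarrow> real).
       strict_mono_on {1..} J \<and> (\<forall>n\<ge>1. J n > 0) \<and>
       (\<forall>n\<ge>1. b n > 0) \<and> filterlim b at_top sequentially \<and>
       weak_conv_m (\<lambda>n. distr M borel (\<lambda>\<omega>. (\<Sum>k = 1..J n. X (int k) \<omega>) / b n)) mu_P1sL)"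
proof -
  obtain q where q: "level_parameters q"
    and small: "\<And>j n. n \<ge> 1 \<Longrightarrow> 10 * (q (Suc j) * (1 - slow (Suc j)) ^ n) \<le> (1 / 2) ^ Suc j * \<zeta> n"
    using level_parameters_exist[OF pos b] by blast
  interpret L: level_parameters q by (rule q)
  obtain M :: "(int \<Rightarrow> real) measure" and Y where "refresh_process L.states L.speed M Y"
    using refresh_process_exists[OF L.refresh_chain_axioms, of L.states] by blast
  then interpret refresh_process L.states L.speed M Y .
  interpret level_process q M Y ..
  let ?X = "\<lambda>k \<omega>. L.value_of (Y k \<omega>)"
  have S: "(\<lambda>\<omega>. \<Sum>k = 1..n. ?X (int k) \<omega>) = partial_sum n" for n
    by (simp add: partial_sum_def fun_eq_iff)
  have beta: "beta_mix M ?X n \<le> \<zeta> n" if n: "n \<ge> 1" for n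
  proof -
    have geo: "(\<lambda>j. (1 / 2) ^ Suc j * \<zeta> n) sums (1 * \<zeta> n)"
      using power_half_series by (intro sums_mult2)
    have "beta_mix M ?X n \<le> 10 * mean L.states (\<lambda>s. (1 - L.speed s) ^ n)"
      by (rule mixing_coefficients(2))
    also have "\<dots> = (\<Sum>j. 10 * (q (Suc j) * (1 - slow (Suc j)) ^ n))"
      unfolding L.expectation_survival[OF n] by (rule suminf_mult[symmetric, OF L.summable_survival])
    also have "\<dots> \<le> (\<Sum>j. (1 / 2) ^ Suc j * \<zeta> n)"
      by (intro suminf_le small n summable_mult L.summable_survival sums_summable[OF geo])
    also have "\<dots> = \<zeta> n" using sums_unique[OF geo] by simp
    finally show ?thesis .
  qed
  have conc: "(\<lambda>n. SUP r. prob {\<omega> \<in> space M. r - b < partial_sum n \<omega> / sqrt (real n) \<and>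
      partial_sum n \<omega> / sqrt (real n) < r + b}) \<longlonglongrightarrow> 0" if "b > 0" for b
    by (rule concentration_tendsto_0[OF _ that normalized_cf_vanishes]) measurable
  have "filterlim (\<lambda>n. variance (partial_sum n) / real n) at_top sequentially"
    by (rule variance_unbounded[OF partial_sum_measurable integrable_partial_sum_square conc])
  moreover have "expectation (?X 0) = 0"
    unfolding expectation_state[of L.value_of 0] by (rule L.expectation_odd) (rule L.f_flip)
  moreover have "integrable M (\<lambda>\<omega>. (?X 0 \<omega>)\<^sup>2)"
    using integrable_state_iff[of "\<lambda>s. (L.value_of s)\<^sup>2" 0] L.integrable_square by simp
  moreover have "strict_mono_on {1..} L.horizon"
    using L.strict_mono_horizon by (auto simp: strict_mono_def strict_mono_on_def)
  ultimately show ?thesis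
    using prob_space_axioms markov[OF L.inj_value_of] stationary[of L.value_of] time_reversible[of L.value_of]
      mixing_coefficients(1)[of L.value_of] beta conc L.horizon_pos L.scale_pos L.scale_diverges compound_poisson_limit
    by (intro exI[of _ M] exI[of _ ?X] conjI exI[of _ L.horizon] exI[of _ L.scale] allI impI)
       (simp_all only: S partial_sum_def)
qed

end
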